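(* Let $p>2$ and let $\mathcal G$ be a regular single-knot graph of length $\ell$ with $H$ half-lines, $P$ pendants and $L$ loops, where $P+L>1$; if $P=0$ assume also $H\ge2$. Then for $\ell$ sufficiently large, no action ground-state of $\mathcal G$ is core-symmetric.
   Context: A single-knot metric graph consists of $H\ge1$ half-lines, $P\ge0$ pendants and $L\ge0$ loops attached at a common vertex $\mathbf 0$; regular of length $\ell$ means each pendant has length $\ell$ and each loop length $2\ell$. Convention: a dummy vertex is placed at the midpoint of each loop, so every compact edge has length $\ell$, identified with $[0,\ell]$ with $\mathbf 0$ at $x=0$. A bound-state is a nontrivial $u\in H^1(\mathcal G)$ with $\int_{\mathcal G}u'\eta'+u\eta-|u|^{p-2}u\eta=0$ for all $\eta\in H^1(\mathcal G)$; $S(u)=\frac12\int(|u'|^2+|u|^2)-\frac1p\int|u|^p$; an action ground-state is a bound-state minimizing $S$ among all bound-states. $u$ is core-symmetric if its restrictions to all compact edges coincide. *)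

theory Defs
  imports "HOL-Analysis.Analysis"
begin

text \<open>Regular single-knot graph with H half-lines, P pendants, L loops, length l.
  Half-line i (i < H) is identified with [0,\<infinity>); compact edge j (j < P + 2L) with [0,l],
  the vertex 0 sitting at x = 0.  Edges j < P are the pendants; for k < L the edges
  P+2k and P+2k+1 are the two halves of the k-th loop, glued at the dummy vertex x = l.
  A function on the graph is stored edgewise together with a (weak) derivative.\<close>

record gfun =
  hl  :: "nat \<Rightarrow> real \<Rightarrow> real"
  dhl :: "nat \<Rightarrow> real \<Rightarrow> real"
  ce  :: "nat \<Rightarrow> real \<Rightarrow> real"
  dce :: "nat \<Rightarrow> real \<Rightarrow> real"

definition L2_on :: "real set \<Rightarrow> (real \<Rightarrow> real) \<Rightarrow> bool" where
  "L2_on I f \<longleftrightarrow> set_borel_measurable lborel I f \<and> set_integrable lborel I (\<lambda>x. (f x)\<^sup>2)"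

text \<open>H^1 on an interval I starting at 0 (I = [0,l] or [0,\<infinity>)), continuous representative u
  with weak derivative du.\<close>
definition H1_on :: "real set \<Rightarrow> (real \<Rightarrow> real) \<Rightarrow> (real \<Rightarrow> real) \<Rightarrow> bool" where
  "H1_on I u du \<longleftrightarrow> L2_on I u \<and> L2_on I du \<and>
     (\<forall>x\<in>I. set_integrable lborel {0..x} du \<and> u x = u 0 + (LINT t:{0..x}|lborel. du t))"

definition in_H1 :: "nat \<Rightarrow> nat \<Rightarrow> nat \<Rightarrow> real \<Rightarrow> gfun \<Rightarrow> bool" where
  "in_H1 H P L l u \<longleftrightarrow>
     (\<forall>i<H. H1_on {0..} (hl u i) (dhl u i)) \<and>
     (\<forall>j<P + 2*L. H1_on {0..l} (ce u j) (dce u j)) \<and>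
     (\<forall>i<H. hl u i 0 = hl u 0 0) \<and>
     (\<forall>j<P + 2*L. ce u j 0 = hl u 0 0) \<and>
     (\<forall>k<L. ce u (P + 2*k) l = ce u (P + 2*k + 1) l)"

definition gint :: "nat \<Rightarrow> nat \<Rightarrow> nat \<Rightarrow> real \<Rightarrow>
    (nat \<Rightarrow> real \<Rightarrow> real) \<Rightarrow> (nat \<Rightarrow> real \<Rightarrow> real) \<Rightarrow> real" where
  "gint H P L l fh fc =
     (\<Sum>i<H. LINT x:{0..}|lborel. fh i x) + (\<Sum>j<P + 2*L. LINT x:{0..l}|lborel. fc j x)"

definition nontrivial :: "nat \<Rightarrow> nat \<Rightarrow> nat \<Rightarrow> real \<Rightarrow> gfun \<Rightarrow> bool" where
  "nontrivial H P L l u \<longleftrightarrow>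
     (\<exists>i<H. \<exists>x\<ge>0. hl u i x \<noteq> 0) \<or> (\<exists>j<P + 2*L. \<exists>x\<in>{0..l}. ce u j x \<noteq> 0)"

definition bound_state :: "nat \<Rightarrow> nat \<Rightarrow> nat \<Rightarrow> real \<Rightarrow> real \<Rightarrow> gfun \<Rightarrow> bool" where
  "bound_state H P L l p u \<longleftrightarrow> in_H1 H P L l u \<and> nontrivial H P L l u \<and>
     (\<forall>\<eta>. in_H1 H P L l \<eta> \<longrightarrow>
        gint H P L l
          (\<lambda>i x. dhl u i x * dhl \<eta> i x + hl u i x * hl \<eta> i x
                 - \<bar>hl u i x\<bar> powr (p - 2) * hl u i x * hl \<eta> i x)
          (\<lambda>j x. dce u j x * dce \<eta> j x + ce u j x * ce \<eta> j x
                 - \<bar>ce u j x\<bar> powr (p - 2) * ce u j x * ce \<eta> j x) = 0)"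

definition action :: "nat \<Rightarrow> nat \<Rightarrow> nat \<Rightarrow> real \<Rightarrow> real \<Rightarrow> gfun \<Rightarrow> real" where
  "action H P L l p u =
     1/2 * gint H P L l (\<lambda>i x. (dhl u i x)\<^sup>2 + (hl u i x)\<^sup>2) (\<lambda>j x. (dce u j x)\<^sup>2 + (ce u j x)\<^sup>2)
     - 1/p * gint H P L l (\<lambda>i x. \<bar>hl u i x\<bar> powr p) (\<lambda>j x. \<bar>ce u j x\<bar> powr p)"

definition action_ground_state :: "nat \<Rightarrow> nat \<Rightarrow> nat \<Rightarrow> real \<Rightarrow> real \<Rightarrow> gfun \<Rightarrow> bool" where
  "action_ground_state H P L l p u \<longleftrightarrow> bound_state H P L l p u \<and>
     (\<forall>v. bound_state H P L l p v \<longrightarrow> action H P L l p u \<le> action H P L l p v)"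

definition core_symmetric :: "nat \<Rightarrow> nat \<Rightarrow> real \<Rightarrow> gfun \<Rightarrow> bool" where
  "core_symmetric P L l u \<longleftrightarrow> (\<forall>j<P + 2*L. \<forall>x\<in>{0..l}. ce u j x = ce u 0 x)"

end

theory Submission
  imports Defs
begin

text \<open>Let \<open>F u = u^2 - (2/p) |u|^p\<close>, so that the soliton satisfies \<open>phi'^2 = F phi\<close>, let \<open>mst\<close> be the positive
  zero of \<open>F\<close> and \<open>G y\<close> the integral of \<open>sqrt F\<close> over \<open>[0, y]\<close>; a half-soliton has action \<open>G mst\<close>.
  Put \<open>m = 1\<close> if there is a pendant and \<open>m = 2\<close> otherwise.

  For long edges a core-symmetric bound state has action at least \<open>m G(mst) + eps\<close>.  Indeed, if the
  squared H1 norm of a function is at most the p-th power of its Lp norm, rescaling it to have maximum \<open>mst\<close>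
  does not increase the bound \<open>(1/2 - 1/p) ||u||^2\<close> for its action, and \<open>u'^2 + F u >= 2 |u'| sqrt(F u)\<close>
  then gives \<open>G mst\<close> for each passage between a value near 0 and the maximum.  Either this applies to all
  \<open>P + 2L >= 2m\<close> compact edges, or the Nehari identity gives half-lines with negative defect
  \<open>||u||^2 - ||u||_p^p\<close>.  All defects on half-lines have the same modulus because the energy of the orbit
  vanishes there, so at least \<open>m\<close> of them are negative (this needs \<open>H >= 2\<close> if \<open>P = 0\<close>), and each such half-line
  carries a bump.

  Conversely there is a bound state of action at most \<open>m G(mst) + eps/2\<close>: it carries a half-soliton on
  \<open>m\<close> compact edges only (a pendant, or the two halves of a loop) and is small elsewhere.  It is found by
  shooting from the far ends of the edges, with the maximum of the bump as parameter and Kirchhoff's condition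
  as the equation.\<close>

section \<open>Absolutely continuous functions\<close>

text \<open>The gap \<open>eps\<close> in the half-line alternative comes from a dichotomy on the
  vertex value. If it is small, a bump on a half-line rises from nearly 0 and falls back to 0, so it
  costs nearly \<open>2 * G mst\<close> instead of \<open>G mst\<close>. If it is not small, every
  compact edge pays a fixed amount of H1 norm near the vertex. In the other alternative at least
  \<open>2 * m\<close> edges carry a passage each, against the \<open>m\<close> of the competitor.

  The inequality \<open>m \<le> H\<close> acts in two places: in the count of half-lines with
  negative defect, and in the sign of the Kirchhoff defect when the bump is the exact soliton. That
  soliton has zero energy, so its slope at the vertex balances at most the tails on the half-lines,
  and the small edges tip the sign. Starting slightly above \<open>mst\<close> gives positive
  energy: the slope at the vertex then stays away from 0 while the vertex value becomes small for
  long edges, which yields the opposite sign.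

  Weak derivatives are stored data, and core symmetry identifies only the values on the edges. The
  lower bound on edges therefore works with one function and several derivatives, under a single
  inequality on the sum of the norms.\<close>

definition ac_on :: "real \<Rightarrow> real \<Rightarrow> (real \<Rightarrow> real) \<Rightarrow> (real \<Rightarrow> real) \<Rightarrow> bool" where
  "ac_on a b u du \<longleftrightarrow> set_integrable lborel {a..b} du \<and> (\<forall>x\<in>{a..b}. u x = u a + integral {a..x} du)"

text \<open>Substitute for almost everywhere differentiability: statements on absolutely continuous functions
  are checked on short intervals, up to an error that is additive in the interval.\<close>
lemma local_to_global_bound:
  fixes g P :: "real \<Rightarrow> real"
  assumes ab: "a \<le> b" and d: "\<delta> > 0"
    and loc: "\<And>x y. a \<le> x \<Longrightarrow> x \<le> y \<Longrightarrow> y \<le> b \<Longrightarrow> y - x < \<delta> \<Longrightarrow> \<bar>g y - g x\<bar> \<le> P y - P x"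
  shows "\<bar>g b - g a\<bar> \<le> P b - P a"
proof -
  obtain n :: nat where n: "(b - a) / \<delta> < real n" using reals_Archimedean2 by blast
  have n0: "n > 0" using n ab d by (cases n) (auto simp: divide_less_0_iff)
  define h where "h = (b - a) / n"
  have h0: "h \<ge> 0" using ab by (simp add: h_def)
  have hd: "h < \<delta>" using n d n0 by (simp add: h_def field_simps)
  have "\<bar>g (a + k * h) - g a\<bar> \<le> P (a + k * h) - P a" if "k \<le> n" for k :: nat
    using that
  proof (induction k)
    case (Suc k)
    have "real (Suc k) * h \<le> n * h" using Suc.prems h0 by (intro mult_right_mono) auto
    also have "n * h = b - a" using n0 by (simp add: h_def)
    finally have "a + (1 + real k) * h \<le> b" by simp
    then have "\<bar>g (a + (1 + real k) * h) - g (a + k * h)\<bar> \<le> P (a + (1 + real k) * h) - P (a + k * h)"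
      using h0 hd by (intro loc) (auto simp: algebra_simps)
    then show ?case using Suc by simp
  qed simp
  from this[of n] show ?thesis using n0 by (simp add: h_def)
qed

lemma set_integrable_continuous_mult:
  fixes f g :: "real \<Rightarrow> real"
  assumes g: "set_integrable lborel {a..b} g" and f: "continuous_on {a..b} f"
  shows "set_integrable lborel {a..b} (\<lambda>x. f x * g x)"
proof -
  have "bounded (f ` {a..b})" using f compact_Icc compact_continuous_image compact_imp_bounded by blast
  then obtain K where K: "\<And>x. x \<in> {a..b} \<Longrightarrow> \<bar>f x\<bar> \<le> K" unfolding bounded_iff by force
  have m1: "(\<lambda>x. indicator {a..b} x *\<^sub>R f x) \<in> borel_measurable lborel"
    using borel_measurable_continuous_on_indicator[OF _ f] by simp
  have m2: "(\<lambda>x. indicator {a..b} x *\<^sub>R g x) \<in> borel_measurable lborel"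
    using g unfolding set_integrable_def by auto
  have "(\<lambda>x. (indicator {a..b} x *\<^sub>R f x) * (indicator {a..b} x *\<^sub>R g x)) \<in> borel_measurable lborel"
    using m1 m2 by measurable
  also have "(\<lambda>x. (indicator {a..b} x *\<^sub>R f x) * (indicator {a..b} x *\<^sub>R g x))
     = (\<lambda>x. indicator {a..b} x *\<^sub>R (f x * g x))" by (auto simp: indicator_def)
  finally have m: "(\<lambda>x. indicator {a..b} x *\<^sub>R (f x * g x)) \<in> borel_measurable lborel" .
  have "set_integrable lborel {a..b} (\<lambda>x. K * g x)" using g by simp
  then show ?thesis unfolding set_integrable_def
  proof (rule Bochner_Integration.integrable_bound)
    show "AE x in lborel. norm (indicator {a..b} x *\<^sub>R (f x * g x)) \<le> norm (indicator {a..b} x *\<^sub>R (K * g x))"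
      using K by (intro AE_I2) (fastforce simp: indicator_def abs_mult intro!: mult_right_mono)
  qed (use m in auto)
qed

lemma set_integrable_lborel_subinterval:
  fixes f :: "real \<Rightarrow> real"
  assumes "set_integrable lborel {a..b} f" "a \<le> x" "y \<le> b"
  shows "set_integrable lborel {x..y} f"
  by (rule set_integrable_subset[OF assms(1)]) (use assms(2,3) in auto)

lemma ac_on_continuous: "ac_on a b u du \<Longrightarrow> continuous_on {a..b} u"
proof -
  assume A: "ac_on a b u du"
  then have "du integrable_on {a..b}"
    unfolding ac_on_def using set_borel_integral_eq_integral(1) by blast
  then have "continuous_on {a..b} (\<lambda>x. u a + integral {a..x} du)"
    by (intro continuous_intros indefinite_integral_continuous_1)
  then show ?thesis using A unfolding ac_on_def by (metis (no_types, lifting) continuous_on_cong)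
qed

lemma ac_on_diff:
  assumes A: "ac_on a b u du" and "a \<le> x" "x \<le> y" "y \<le> b"
  shows "u y - u x = integral {x..y} du"
proof -
  have "du integrable_on {a..b}"
    using A unfolding ac_on_def using set_borel_integral_eq_integral(1) by blast
  then have "du integrable_on {a..y}" using assms integrable_on_subinterval by fastforce
  then have "integral {a..x} du + integral {x..y} du = integral {a..y} du"
    using assms by (intro Henstock_Kurzweil_Integration.integral_combine) auto
  moreover have "u x = u a + integral {a..x} du" "u y = u a + integral {a..y} du"
    using A assms(2-4) unfolding ac_on_def by (meson atLeastAtMost_iff order_trans)+
  ultimately show ?thesis by simp
qed

lemma ac_on_subinterval:
  assumes "ac_on a b u du" "a \<le> c" "c \<le> d" "d \<le> b"
  shows "ac_on c d u du"
proof -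
  have "u x = u c + integral {c..x} du" if "x \<in> {c..d}" for x
    using ac_on_diff[OF assms(1), of c x] that assms by auto
  then show ?thesis using assms unfolding ac_on_def
    using set_integrable_lborel_subinterval[of a b du c d] by blast
qed

lemma ac_on_deriv:
  fixes q dq :: "real \<Rightarrow> real"
  assumes "\<And>t. t \<in> {a..b} \<Longrightarrow> (q has_real_derivative dq t) (at t within {a..b})"
    and "continuous_on {a..b} dq"
  shows "ac_on a b q dq"
proof -
  have "integral {a..x} dq = q x - q a" if "x \<in> {a..b}" for x
  proof (rule integral_unique, rule fundamental_theorem_of_calculus)
    fix t assume t: "t \<in> {a..x}"
    have "(q has_real_derivative dq t) (at t within {a..x})"
      by (rule DERIV_subset[OF assms(1)]) (use that t in auto)
    then show "(q has_vector_derivative dq t) (at t within {a..x})"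
      by (simp add: has_real_derivative_iff_has_vector_derivative)
  qed (use that in auto)
  then show ?thesis using borel_integrable_atLeastAtMost'[OF assms(2)] by (auto simp: ac_on_def)
qed

lemma integral_indefinite_diff:
  fixes f :: "real \<Rightarrow> real"
  assumes "f integrable_on {a..b}" "a \<le> x" "x \<le> y" "y \<le> b"
  shows "integral {a..y} f - integral {a..x} f = integral {x..y} f"
proof -
  have "f integrable_on {a..y}" using assms integrable_on_subinterval by fastforce
  then show ?thesis using assms Henstock_Kurzweil_Integration.integral_combine[of a x y f] by auto
qed

lemma set_integrable_abs_le_imp:
  fixes f g :: "real \<Rightarrow> real"
  assumes "set_integrable lborel {x..y} f" "set_integrable lborel {x..y} g"
    "\<And>t. t \<in> {x..y} \<Longrightarrow> \<bar>f t\<bar> \<le> g t"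
  shows "\<bar>integral {x..y} f\<bar> \<le> integral {x..y} g"
  using integral_norm_bound_integral[of f "{x..y}" g]
    set_borel_integral_eq_integral(1)[OF assms(1)] set_borel_integral_eq_integral(1)[OF assms(2)] assms(3)
  by simp

text \<open>Integration by parts. On a short interval the increment of \<open>u * q\<close> is the
  integral of \<open>u x * dq + q y * du\<close>, with coefficients frozen at the two end points;
  uniform continuity bounds the error by \<open>e\<close> times the integral of
  \<open>|dq| + |du|\<close>, which is additive in the interval.\<close>

lemma ac_on_integral_mult:
  assumes ab: "a \<le> b" and U: "ac_on a b u du" and Q: "ac_on a b q dq"
  shows "integral {a..b} (\<lambda>t. u t * dq t + q t * du t) = u b * q b - u a * q a"
proof -
  let ?h = "\<lambda>t. u t * dq t + q t * du t"
  let ?m = "\<lambda>t. \<bar>dq t\<bar> + \<bar>du t\<bar>"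
  have si: "set_integrable lborel {a..b} du" "set_integrable lborel {a..b} dq"
    using U Q by (auto simp: ac_on_def)
  have c: "continuous_on {a..b} u" "continuous_on {a..b} q" using U Q ac_on_continuous by auto
  have hi: "set_integrable lborel {a..b} ?h"
    by (intro set_integral_add set_integrable_continuous_mult c si)
  have mi: "set_integrable lborel {a..b} ?m"
    by (intro set_integral_add set_integrable_abs si)
  note hk = set_borel_integral_eq_integral(1)
  have key: "\<bar>u b * q b - u a * q a - integral {a..b} ?h\<bar> \<le> e * integral {a..b} ?m" if e: "e > 0" for e
  proof -
    have "uniformly_continuous_on {a..b} u" "uniformly_continuous_on {a..b} q"
      using c by (auto intro: compact_uniformly_continuous)
    then obtain d1 d2 where d: "d1 > 0" "d2 > 0"
      "\<And>x y. x \<in> {a..b} \<Longrightarrow> y \<in> {a..b} \<Longrightarrow> dist y x < d1 \<Longrightarrow> dist (u y) (u x) < e"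
      "\<And>x y. x \<in> {a..b} \<Longrightarrow> y \<in> {a..b} \<Longrightarrow> dist y x < d2 \<Longrightarrow> dist (q y) (q x) < e"
      unfolding uniformly_continuous_on_def using e by metis
    let ?g = "\<lambda>x. u x * q x - integral {a..x} ?h"
    let ?P = "\<lambda>x. e * integral {a..x} ?m"
    have "\<bar>?g b - ?g a\<bar> \<le> ?P b - ?P a"
    proof (rule local_to_global_bound[OF ab, where \<delta> = "min d1 d2"])
      fix x y assume xy: "a \<le> x" "x \<le> y" "y \<le> b" "y - x < min d1 d2"
      have s: "set_integrable lborel {x..y} f" if "set_integrable lborel {a..b} f" for f :: "real \<Rightarrow> real"
        by (rule set_integrable_lborel_subinterval[OF that]) (use xy in auto)
      have k1: "integral {a..y} ?h - integral {a..x} ?h = integral {x..y} ?h"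
        using xy by (intro integral_indefinite_diff[of _ a b] hk hi) auto
      have k2: "integral {a..y} ?m - integral {a..x} ?m = integral {x..y} ?m"
        using xy by (intro integral_indefinite_diff[of _ a b] hk mi) auto
      have s1: "set_integrable lborel {x..y} (\<lambda>t. u x * dq t + q y * du t)"
        by (intro set_integral_add set_integrable_mult_right impI s si)
      have "u y * q y - u x * q x = u x * (q y - q x) + q y * (u y - u x)" by (simp add: algebra_simps)
      also have "\<dots> = integral {x..y} (\<lambda>t. u x * dq t) + integral {x..y} (\<lambda>t. q y * du t)"
        using ac_on_diff[OF U, of x y] ac_on_diff[OF Q, of x y] xy by simp
      also have "\<dots> = integral {x..y} (\<lambda>t. u x * dq t + q y * du t)"
        by (intro Henstock_Kurzweil_Integration.integral_add[symmetric] hk set_integrable_mult_right impI s si)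
      finally have k3: "u y * q y - u x * q x = integral {x..y} (\<lambda>t. u x * dq t + q y * du t)" .
      have "?g y - ?g x = integral {x..y} (\<lambda>t. u x * dq t + q y * du t) - integral {x..y} ?h"
        using k1 k3 by simp
      also have "\<dots> = integral {x..y} (\<lambda>t. (u x * dq t + q y * du t) - ?h t)"
        by (intro Henstock_Kurzweil_Integration.integral_diff[symmetric] hk s1 s hi)
      also have "\<bar>\<dots>\<bar> \<le> integral {x..y} (\<lambda>t. e * ?m t)"
      proof (rule set_integrable_abs_le_imp)
        show "set_integrable lborel {x..y} (\<lambda>t. (u x * dq t + q y * du t) - ?h t)"
          by (intro set_integral_diff s1 s hi)
        show "set_integrable lborel {x..y} (\<lambda>t. e * ?m t)"
          by (intro set_integrable_mult_right impI s mi)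
        fix t assume t: "t \<in> {x..y}"
        have 1: "\<bar>u x - u t\<bar> \<le> e" using d(3)[of t x] t xy by (auto simp: dist_real_def)
        have 2: "\<bar>q y - q t\<bar> \<le> e" using d(4)[of t y] t xy by (auto simp: dist_real_def)
        have "\<bar>(u x * dq t + q y * du t) - ?h t\<bar> = \<bar>(u x - u t) * dq t + (q y - q t) * du t\<bar>"
          by (simp add: algebra_simps)
        also have "\<dots> \<le> \<bar>u x - u t\<bar> * \<bar>dq t\<bar> + \<bar>q y - q t\<bar> * \<bar>du t\<bar>"
          by (metis abs_mult abs_triangle_ineq)
        also have "\<dots> \<le> e * \<bar>dq t\<bar> + e * \<bar>du t\<bar>" using 1 2 by (intro add_mono mult_right_mono) auto
        finally show "\<bar>(u x * dq t + q y * du t) - ?h t\<bar> \<le> e * ?m t" by (simp add: algebra_simps)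
      qed
      also have "\<dots> = ?P y - ?P x" using k2 by (simp add: right_diff_distrib[symmetric] del: distrib_left)
      finally show "\<bar>?g y - ?g x\<bar> \<le> ?P y - ?P x" .
    qed (use d in auto)
    then show ?thesis by simp
  qed
  have "\<bar>u b * q b - u a * q a - integral {a..b} ?h\<bar> \<le> 0 + e" if e: "e > 0" for e
  proof -
    define I where "I = integral {a..b} ?m"
    have I0: "I \<ge> 0" unfolding I_def by (intro Henstock_Kurzweil_Integration.integral_nonneg hk mi) auto
    have "\<bar>u b * q b - u a * q a - integral {a..b} ?h\<bar> \<le> e / (I + 1) * I"
      unfolding I_def[symmetric] using key[of "e / (I + 1)"] e I0 by (simp add: I_def)
    also have "\<dots> \<le> e" using I0 e by (simp add: field_simps)
    finally show ?thesis by simp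
  qed
  then have "\<bar>u b * q b - u a * q a - integral {a..b} ?h\<bar> \<le> 0" by (rule field_le_epsilon)
  then show ?thesis by simp
qed

text \<open>Compare \<open>u x\<close> with \<open>u y\<close> by integrating
  \<open>2 * u * du\<close>, then average over \<open>y\<close> in the unit interval. This trace
  estimate serves both the decay on half-lines and the price of a nonzero vertex value.\<close>

lemma ac_on_left_value_bound:
  assumes U: "ac_on x (x + 1) u du" and d2: "set_integrable lborel {x..x+1} (\<lambda>t. (du t)\<^sup>2)"
  shows "(u x)\<^sup>2 \<le> 2 * integral {x..x+1} (\<lambda>t. (u t)\<^sup>2) + integral {x..x+1} (\<lambda>t. (du t)\<^sup>2)"
proof -
  have c: "continuous_on {x..x+1} u" using U ac_on_continuous by auto
  have i1: "set_integrable lborel {x..x+1} (\<lambda>t. (u t)\<^sup>2)"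
    by (intro borel_integrable_atLeastAtMost' continuous_intros c)
  have si: "set_integrable lborel {x..x+1} du" using U by (auto simp: ac_on_def)
  note hk = set_borel_integral_eq_integral(1)
  let ?s = "\<lambda>t. (u t)\<^sup>2 + (du t)\<^sup>2"
  have iss: "set_integrable lborel {x..x+1} ?s" by (intro set_integral_add i1 d2)
  define I where "I = integral {x..x+1} ?s"
  have "(u x)\<^sup>2 \<le> (u y)\<^sup>2 + I" if y: "y \<in> {x..x+1}" for y
  proof -
    have U': "ac_on x y u du" using U y by (auto intro: ac_on_subinterval)
    have sub: "{x..y} \<subseteq> {x..x+1}" using y by auto
    have "integral {x..y} (\<lambda>t. u t * du t + u t * du t) = u y * u y - u x * u x"
      using y by (intro ac_on_integral_mult U') auto
    then have "(u x)\<^sup>2 - (u y)\<^sup>2 \<le> \<bar>integral {x..y} (\<lambda>t. u t * du t + u t * du t)\<bar>"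
      by (simp add: power2_eq_square)
    also have "\<dots> \<le> integral {x..y} ?s"
    proof (rule set_integrable_abs_le_imp)
      show "set_integrable lborel {x..y} (\<lambda>t. u t * du t + u t * du t)"
        by (intro set_integral_add set_integrable_continuous_mult
            continuous_on_subset[OF c sub] set_integrable_subset[OF si _ sub]) auto
      show "set_integrable lborel {x..y} ?s" by (rule set_integrable_subset[OF iss _ sub]) auto
      fix t
      have "(\<bar>u t\<bar> - \<bar>du t\<bar>)\<^sup>2 \<ge> 0" by simp
      then show "\<bar>u t * du t + u t * du t\<bar> \<le> ?s t"
        by (simp add: power2_eq_square algebra_simps abs_mult[symmetric])
    qed
    also have "\<dots> \<le> I" unfolding I_def
      by (rule integral_subset_le[OF sub hk[OF set_integrable_subset[OF iss _ sub]] hk[OF iss]]) auto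
    finally show ?thesis by simp
  qed
  then have "integral {x..x+1} (\<lambda>y. (u x)\<^sup>2) \<le> integral {x..x+1} (\<lambda>y. (u y)\<^sup>2 + I)"
    by (intro integral_le integrable_continuous_real continuous_intros c) auto
  also have "\<dots> = integral {x..x+1} (\<lambda>y. (u y)\<^sup>2) + I"
    by (subst Henstock_Kurzweil_Integration.integral_add[OF hk[OF i1] integrable_const_ivl]) simp
  finally have "(u x)\<^sup>2 \<le> integral {x..x+1} (\<lambda>y. (u y)\<^sup>2) + I" by simp
  also have "I = integral {x..x+1} (\<lambda>y. (u y)\<^sup>2) + integral {x..x+1} (\<lambda>y. (du y)\<^sup>2)"
    unfolding I_def by (intro Henstock_Kurzweil_Integration.integral_add hk i1 d2)
  finally show ?thesis by simp
qed

section \<open>The nonlinearity\<close>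

text \<open>The exponent above 1 leaves a factor \<open>|h| powr (q - 1)\<close>. This settles the
  difference quotient of \<open>|u| powr q\<close> at the origin, where the two smooth branches
  meet.\<close>

lemma powr_quotient_tendsto_0:
  fixes s :: "real \<Rightarrow> real"
  assumes q: "q > 1" and s: "\<And>h. 0 \<le> s h \<and> s h \<le> \<bar>h\<bar>"
  shows "((\<lambda>h. s h powr q / h) \<longlongrightarrow> 0) (at 0)"
proof (rule tendsto_rabs_zero_cancel, rule tendsto_sandwich)
  show "\<forall>\<^sub>F h in at 0. 0 \<le> \<bar>s h powr q / h\<bar>" by simp
  have "\<bar>s h powr q / h\<bar> \<le> \<bar>h\<bar> powr (q - 1)" if "h \<noteq> 0" for h
  proof -
    have "s h powr q \<le> \<bar>h\<bar> powr q" using s[of h] q by (intro powr_mono2) auto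
    also have "\<dots> = \<bar>h\<bar> powr (q - 1) * \<bar>h\<bar>" using that by (simp add: powr_diff)
    finally show ?thesis using that by (simp add: divide_le_eq)
  qed
  then show "\<forall>\<^sub>F h in at 0. \<bar>s h powr q / h\<bar> \<le> \<bar>h\<bar> powr (q - 1)"
    by (auto simp: eventually_at_filter)
  have "((\<lambda>h::real. \<bar>h\<bar> powr (q - 1)) \<longlongrightarrow> \<bar>0\<bar> powr (q - 1)) (at 0)"
    using q by (intro tendsto_powr' tendsto_intros) auto
  then show "((\<lambda>h::real. \<bar>h\<bar> powr (q - 1)) \<longlongrightarrow> 0) (at 0)" by simp
qed auto

lemma has_real_derivative_abs_powr:
  fixes u q :: real
  assumes q: "q > 1"
  shows "((\<lambda>u. \<bar>u\<bar> powr q) has_real_derivative q * (\<bar>u\<bar> powr (q - 2) * u)) (at u)"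
proof -
  consider "u > 0" | "u < 0" | "u = 0" by linarith
  then show ?thesis
  proof cases
    case 1
    have "((\<lambda>u. u powr q) has_real_derivative q * u powr (q - 1)) (at u)"
      using 1 by (rule has_real_derivative_powr)
    also have "q * u powr (q - 1) = q * (\<bar>u\<bar> powr (q - 2) * u)" using 1
      by (simp add: powr_mult_base[symmetric] mult.commute) (simp add: powr_diff power2_eq_square)
    finally show ?thesis
      by (rule has_field_derivative_transform_within_open[where S = "{0<..}"]) (use 1 in auto)
  next
    case 2
    have "((\<lambda>u. (- u) powr q) has_real_derivative q * (- u) powr (q - of_nat 1) * (- 1)) (at u)"
      using 2 by (intro DERIV_fun_powr derivative_eq_intros) auto
    also have "q * (- u) powr (q - of_nat 1) * (- 1) = q * (\<bar>u\<bar> powr (q - 2) * u)" using 2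
      by (simp add: powr_diff power2_eq_square)
    finally show ?thesis
      by (rule has_field_derivative_transform_within_open[where S = "{..<0}"]) (use 2 in auto)
  next
    case 3
    have "((\<lambda>h. \<bar>h\<bar> powr q / h) \<longlongrightarrow> 0) (at 0)"
      using q by (intro powr_quotient_tendsto_0) auto
    then show ?thesis using 3 q by (simp add: DERIV_def)
  qed
qed

locale nls =
  fixes p :: real
  assumes p_gt_2: "p > 2"
begin

definition f :: "real \<Rightarrow> real" where "f u = u - \<bar>u\<bar> powr (p - 2) * u"
definition F :: "real \<Rightarrow> real" where "F u = u\<^sup>2 - 2 / p * \<bar>u\<bar> powr p"
text \<open>The rate in the explicit soliton
  \<open>mst * cosh (th * x) powr (- 1 / th)\<close>.\<close>

definition th :: real where "th = (p - 2) / 2"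
definition mst :: real where "mst = (p / 2) powr (1 / (p - 2))"
text \<open>Clipping at 0 makes \<open>R\<close> continuous on the whole line and \<open>G\<close>
  constant beyond \<open>mst\<close>, so that \<open>G mst\<close> bounds \<open>G\<close> on all
  nonnegative arguments.\<close>

definition R :: "real \<Rightarrow> real" where "R u = sqrt (max 0 (F u))"
definition G :: "real \<Rightarrow> real" where "G y = integral {0..y} R"

definition E1 :: "real set \<Rightarrow> (real \<Rightarrow> real) \<Rightarrow> (real \<Rightarrow> real) \<Rightarrow> real" where
  "E1 I u du = (LINT x:I|lborel. (du x)\<^sup>2 + (u x)\<^sup>2)"

definition Ep :: "real set \<Rightarrow> (real \<Rightarrow> real) \<Rightarrow> real" where
  "Ep I u = (LINT x:I|lborel. \<bar>u x\<bar> powr p)"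

abbreviation weak :: "real set \<Rightarrow> (real \<Rightarrow> real) \<Rightarrow> (real \<Rightarrow> real) \<Rightarrow> (real \<Rightarrow> real) \<Rightarrow> (real \<Rightarrow> real) \<Rightarrow> real" where
  "weak I u du \<eta> d\<eta> \<equiv> (LINT x:I|lborel. du x * d\<eta> x + u x * \<eta> x - \<bar>u x\<bar> powr (p - 2) * u x * \<eta> x)"

lemma th_pos: "th > 0" using p_gt_2 by (simp add: th_def)

lemma F_deriv: "(F has_real_derivative 2 * f u) (at u)"
proof -
  have "((\<lambda>u. u\<^sup>2 - 2 / p * \<bar>u\<bar> powr p) has_real_derivative
      2 * u - 2 / p * (p * (\<bar>u\<bar> powr (p - 2) * u))) (at u)"
    by (intro DERIV_diff DERIV_cmult has_real_derivative_abs_powr)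
      (use p_gt_2 in \<open>auto intro!: derivative_eq_intros\<close>)
  moreover have "2 * u - 2 / p * (p * (\<bar>u\<bar> powr (p - 2) * u)) = 2 * f u"
    using p_gt_2 by (simp add: f_def algebra_simps)
  ultimately show ?thesis unfolding F_def[abs_def] by simp
qed

lemma F_continuous: "continuous_on S F"
  using F_deriv by (metis DERIV_isCont continuous_at_imp_continuous_on)

lemma f_continuous: "continuous_on S f"
  unfolding f_def using p_gt_2 by (intro continuous_intros continuous_on_powr') auto

lemma F_0 [simp]: "F 0 = 0" and f_0 [simp]: "f 0 = 0"
  by (simp_all add: F_def f_def)

lemma F_abs [simp]: "F \<bar>u\<bar> = F u" by (simp add: F_def)

lemma F_le_square: "F u \<le> u\<^sup>2" using p_gt_2 by (simp add: F_def)

lemma mst_gt_1: "mst > 1" unfolding mst_def using p_gt_2 by (intro gr_one_powr) auto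

lemma mst_powr: "mst powr (p - 2) = p / 2"
  using p_gt_2 by (simp add: mst_def powr_powr)

lemma powr_p: "\<bar>u\<bar> powr p = \<bar>u\<bar> powr (p - 2) * u\<^sup>2"
  by (cases "u = 0") (auto simp: powr_diff)

lemma F_factor: "F u = u\<^sup>2 * (1 - 2 / p * \<bar>u\<bar> powr (p - 2))"
  by (simp add: F_def powr_p algebra_simps)

lemma f_factor: "f u = u * (1 - \<bar>u\<bar> powr (p - 2))"
  by (simp add: f_def algebra_simps)

lemma F_mst [simp]: "F mst = 0"
  using mst_gt_1 mst_powr p_gt_2 by (simp add: F_factor)

lemma F_pos: assumes "0 < \<bar>u\<bar>" "\<bar>u\<bar> < mst" shows "F u > 0"
proof -
  have "\<bar>u\<bar> powr (p - 2) < p / 2" using powr_less_mono2[of "p - 2" "\<bar>u\<bar>" mst] assms p_gt_2 mst_powr by simp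
  then have "2 / p * \<bar>u\<bar> powr (p - 2) < 1" using p_gt_2 by (simp add: field_simps)
  then show ?thesis using assms by (simp add: F_factor)
qed

lemma F_nonneg: assumes "\<bar>u\<bar> \<le> mst" shows "F u \<ge> 0"
proof (cases "u = 0 \<or> \<bar>u\<bar> = mst")
  case True then show ?thesis using F_mst F_abs by (metis F_0 order_refl)
next
  case False then show ?thesis using F_pos[of u] assms by force
qed

lemma F_neg: assumes "mst < \<bar>u\<bar>" shows "F u < 0"
proof -
  have "\<bar>u\<bar> powr (p - 2) > p / 2" using powr_less_mono2[of "p - 2" mst "\<bar>u\<bar>"] assms p_gt_2 mst_powr mst_gt_1 by simp
  then have "2 / p * \<bar>u\<bar> powr (p - 2) > 1" using p_gt_2 by (simp add: field_simps)
  then show ?thesis using assms mst_gt_1 by (auto simp: F_factor mult_pos_neg)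
qed

lemma R_continuous: "continuous_on S R"
  unfolding R_def[abs_def] by (intro continuous_intros F_continuous)

lemma R_nonneg [simp]: "R u \<ge> 0" by (simp add: R_def)
lemma R_abs [simp]: "R \<bar>u\<bar> = R u" by (simp add: R_def)
lemma R_0 [simp]: "R 0 = 0" by (simp add: R_def)

lemma R_le: "R u \<le> \<bar>u\<bar>"
proof -
  have "max 0 (F u) \<le> u\<^sup>2" using F_le_square by simp
  then have "R u \<le> sqrt (u\<^sup>2)" unfolding R_def by (rule real_sqrt_le_mono)
  then show ?thesis by simp
qed

lemma G_0 [simp]: "G 0 = 0" by (simp add: G_def)

lemma R_integrable: "R integrable_on {a..b}"
  by (intro integrable_continuous_real R_continuous)

lemma G_diff: "0 \<le> x \<Longrightarrow> x \<le> y \<Longrightarrow> G y - G x = integral {x..y} R"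
  unfolding G_def by (rule integral_indefinite_diff[OF R_integrable]) auto

lemma G_mono: "0 \<le> x \<Longrightarrow> x \<le> y \<Longrightarrow> G x \<le> G y"
  using G_diff[of x y] Henstock_Kurzweil_Integration.integral_nonneg[OF R_integrable, of x y] by simp

lemma G_nonneg: "0 \<le> x \<Longrightarrow> G x \<ge> 0"
  using G_mono[of 0 x] by simp

lemma G_diff_le:
  assumes "0 \<le> x" "x \<le> y" and "\<And>r. x \<le> r \<Longrightarrow> r \<le> y \<Longrightarrow> R r \<le> K"
  shows "G y - G x \<le> K * (y - x)"
proof -
  have "integral {x..y} R \<le> integral {x..y} (\<lambda>_. K)"
    using assms by (intro integral_le R_integrable) auto
  then show ?thesis using G_diff[of x y] assms by (simp add: mult.commute)
qed

lemma G_deriv: assumes "y > 0" shows "(G has_real_derivative R y) (at y)"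
proof -
  have "((\<lambda>x. integral {0..x} R) has_real_derivative R y) (at y within {0..y+1})"
    using assms by (intro integral_has_real_derivative R_continuous) auto
  moreover have "at y within {0..y+1} = at y" using assms by (intro at_within_interior) auto
  ultimately show ?thesis by (simp add: G_def[abs_def])
qed

lemma G_continuous: "continuous_on {0..} G"
  unfolding continuous_on_def
proof
  fix x :: real assume "x \<in> {0..}"
  then have x: "x \<ge> 0" by simp
  have "continuous_on {0..x+1} G"
    unfolding G_def by (intro indefinite_integral_continuous_1 R_integrable)
  then have "(G \<longlongrightarrow> G x) (at x within {0..x+1})" using x by (auto simp: continuous_on_def)
  moreover have "at x within {0..x+1} = at x within {0..}"
    by (rule at_within_nhd[of _ "{..<x+1}"]) (use x in auto)
  ultimately show "(G \<longlongrightarrow> G x) (at x within {0..})" by simp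
qed

lemma G_above: assumes "y \<ge> mst" shows "G y = G mst"
proof -
  have "G y - G mst \<le> 0 * (y - mst)"
    using assms mst_gt_1 F_neg by (intro G_diff_le) (fastforce simp: R_def intro: F_nonneg simp: le_less)+
  then show ?thesis using G_mono[of mst y] assms mst_gt_1 by simp
qed

lemma G_le_Gm: "0 \<le> y \<Longrightarrow> G y \<le> G mst"
  by (metis G_above G_mono linear)

lemma G_mst_pos: "G mst > 0"
proof -
  have "G (1/2) < G 1"
  proof (rule DERIV_pos_imp_increasing_open[where f = G])
    fix x :: real assume x: "1/2 < x" "x < 1"
    have "F x > 0" using F_pos[of x] x mst_gt_1 by auto
    then show "\<exists>y. (G has_real_derivative y) (at x) \<and> 0 < y"
      using G_deriv[of x] x by (intro exI[of _ "R x"]) (auto simp: R_def)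
  qed (auto intro: continuous_on_subset[OF G_continuous])
  then show ?thesis using G_nonneg[of "1/2"] G_le_Gm[of 1] by simp
qed

end

section \<open>Functions of class H1\<close>

lemma set_integral_halfline_limit:
  fixes h :: "real \<Rightarrow> real"
  assumes "set_integrable lborel {0..} h"
  shows "((\<lambda>x. integral {0..x} h) \<longlongrightarrow> (LINT x:{0..}|lborel. h x)) at_top"
proof -
  have "((\<lambda>b. set_lebesgue_integral lborel {0..b} h) \<longlongrightarrow> set_lebesgue_integral lborel {0..} h) at_top"
    using assms by (intro tendsto_set_lebesgue_integral_at_top) auto
  moreover have "set_lebesgue_integral lborel {0..b} h = integral {0..b} h" for b
    by (rule set_borel_integral_eq_integral(2), rule set_integrable_subset[OF assms]) auto
  ultimately show ?thesis by simp
qed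

lemma H1_on_ac_on:
  assumes "H1_on I u du" "{0..b} \<subseteq> I"
  shows "ac_on 0 b u du"
proof (cases "b \<ge> 0")
  case True
  have 1: "set_integrable lborel {0..x} du" "u x = u 0 + (LINT t:{0..x}|lborel. du t)" if "x \<in> {0..b}" for x
    using assms that unfolding H1_on_def by blast+
  have A: "\<forall>x\<in>{0..b}. u x = u 0 + integral {0..x} du"
  proof
    fix x assume x: "x \<in> {0..b}"
    show "u x = u 0 + integral {0..x} du"
      using 1(2)[OF x] unfolding set_borel_integral_eq_integral(2)[OF 1(1)[OF x]] .
  qed
  show ?thesis unfolding ac_on_def by (intro conjI A 1(1)) (use True in auto)
next
  case False
  then show ?thesis by (simp add: ac_on_def set_integrable_def)
qed

lemma H1_on_square_integrable:
  assumes "H1_on I u du"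
  shows "set_integrable lborel I (\<lambda>x. (u x)\<^sup>2)" "set_integrable lborel I (\<lambda>x. (du x)\<^sup>2)"
  using assms by (auto simp: H1_on_def L2_on_def)

lemma L2_on_mult:
  assumes f: "L2_on I f" and g: "L2_on I g"
  shows "set_integrable lborel I (\<lambda>x. f x * g x)"
proof -
  have mf: "(\<lambda>x. indicator I x *\<^sub>R f x) \<in> borel_measurable lborel"
    and mg: "(\<lambda>x. indicator I x *\<^sub>R g x) \<in> borel_measurable lborel"
    using f g unfolding L2_on_def set_borel_measurable_def by blast+
  have "(\<lambda>x. (indicator I x *\<^sub>R f x) * (indicator I x *\<^sub>R g x)) \<in> borel_measurable lborel"
    by (rule borel_measurable_times[OF mf mg])
  also have "(\<lambda>x. (indicator I x *\<^sub>R f x) * (indicator I x *\<^sub>R g x))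
     = (\<lambda>x. indicator I x *\<^sub>R (f x * g x))" by (auto simp: indicator_def)
  finally have m: "(\<lambda>x. indicator I x *\<^sub>R (f x * g x)) \<in> borel_measurable lborel" .
  have "set_integrable lborel I (\<lambda>x. (f x)\<^sup>2 + (g x)\<^sup>2)"
    using f g unfolding L2_on_def by (intro set_integral_add) auto
  then show ?thesis unfolding set_integrable_def
  proof (rule Bochner_Integration.integrable_bound)
    have "\<bar>a * b\<bar> \<le> a\<^sup>2 + b\<^sup>2" for a b :: real
    proof -
      have "2 * \<bar>a * b\<bar> \<le> a\<^sup>2 + b\<^sup>2" using sum_squares_bound[of "\<bar>a\<bar>" "\<bar>b\<bar>"] by (simp add: abs_mult)
      then show ?thesis by linarith
    qed
    then show "AE x in lborel. norm (indicator I x *\<^sub>R (f x * g x)) \<le> norm (indicator I x *\<^sub>R ((f x)\<^sup>2 + (g x)\<^sup>2))"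
      by (intro AE_I2) (simp add: indicator_def)
  qed (use m in auto)
qed

text \<open>Since \<open>h 0 = 0\<close>, composition with \<open>h\<close> commutes with
  multiplication by the indicator of \<open>I\<close>.\<close>

lemma set_borel_measurable_compose_0:
  fixes h :: "real \<Rightarrow> real"
  assumes "set_borel_measurable lborel I u" "h 0 = 0" "continuous_on UNIV h"
  shows "set_borel_measurable lborel I (\<lambda>x. h (u x))"
proof -
  have h: "h \<in> borel_measurable borel" using assms(3) by (rule borel_measurable_continuous_onI)
  have "(\<lambda>x. h (indicator I x *\<^sub>R u x)) \<in> borel_measurable lborel"
    by (rule measurable_compose[OF _ h]) (use assms(1) in \<open>simp add: set_borel_measurable_def\<close>)
  also have "(\<lambda>x. h (indicator I x *\<^sub>R u x)) = (\<lambda>x. indicator I x *\<^sub>R h (u x))"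
    using assms(2) by (auto simp: indicator_def)
  finally show ?thesis unfolding set_borel_measurable_def .
qed

text \<open>By the trace estimate \<open>(u x)^2\<close> is at most an integral over
  \<open>{x..x+1}\<close>, which is a difference of two values of a convergent primitive.\<close>

lemma H1_on_halfline_tendsto_0:
  assumes H: "H1_on {0..} u du"
  shows "(u \<longlongrightarrow> 0) at_top"
proof -
  note i = H1_on_square_integrable[OF H]
  note hk = set_borel_integral_eq_integral(1)
  have ii: "set_integrable lborel {0..} (\<lambda>t. 2 * (u t)\<^sup>2 + (du t)\<^sup>2)" using i by (intro set_integral_add) auto
  let ?I = "\<lambda>x. integral {0..x} (\<lambda>t. 2 * (u t)\<^sup>2 + (du t)\<^sup>2)"
  have l: "(?I \<longlongrightarrow> (LINT t:{0..}|lborel. 2 * (u t)\<^sup>2 + (du t)\<^sup>2)) at_top"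
    by (rule set_integral_halfline_limit[OF ii])
  have l1: "((\<lambda>x. ?I (x + 1)) \<longlongrightarrow> (LINT t:{0..}|lborel. 2 * (u t)\<^sup>2 + (du t)\<^sup>2)) at_top"
    by (rule filterlim_compose[OF l]) (subst add.commute, rule filterlim_tendsto_add_at_top[OF tendsto_const filterlim_ident])
  have 0: "((\<lambda>x. ?I (x + 1) - ?I x) \<longlongrightarrow> 0) at_top" using tendsto_diff[OF l1 l] by simp
  have b: "(u x)\<^sup>2 \<le> ?I (x + 1) - ?I x" if x: "x \<ge> 0" for x
  proof -
    have ac: "ac_on x (x+1) u du" by (rule ac_on_subinterval[OF H1_on_ac_on[OF H, of "x+1"]]) (use x in auto)
    have s: "set_integrable lborel {x..x+1} h" if "set_integrable lborel {0..} h" for h :: "real \<Rightarrow> real"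
      by (rule set_integrable_subset[OF that]) (use x in auto)
    have "(u x)\<^sup>2 \<le> 2 * integral {x..x+1} (\<lambda>t. (u t)\<^sup>2) + integral {x..x+1} (\<lambda>t. (du t)\<^sup>2)"
      by (rule ac_on_left_value_bound[OF ac s[OF i(2)]])
    also have "\<dots> = integral {x..x+1} (\<lambda>t. 2 * (u t)\<^sup>2) + integral {x..x+1} (\<lambda>t. (du t)\<^sup>2)" by simp
    also have "\<dots> = integral {x..x+1} (\<lambda>t. 2 * (u t)\<^sup>2 + (du t)\<^sup>2)"
      by (intro Henstock_Kurzweil_Integration.integral_add[symmetric] hk s i set_integrable_mult_right impI)
    also have "\<dots> = ?I (x + 1) - ?I x"
      by (rule integral_indefinite_diff[symmetric, of _ 0 "x+1"], rule hk, rule set_integrable_subset[OF ii]) (use x in auto)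
    finally show ?thesis .
  qed
  have "((\<lambda>x. (u x)\<^sup>2) \<longlongrightarrow> 0) at_top"
    by (rule tendsto_sandwich[OF _ _ tendsto_const 0])
      (auto simp: eventually_at_top_linorder intro!: exI[of _ 0] b)
  then have "((\<lambda>x. sqrt ((u x)\<^sup>2)) \<longlongrightarrow> sqrt 0) at_top" by (rule tendsto_real_sqrt)
  then show ?thesis by (simp add: tendsto_rabs_zero_iff)
qed

lemma H1_on_bounded:
  assumes H: "H1_on I u du" and I: "I = {0..} \<or> I = {0..l}"
  obtains M where "\<And>x. x \<in> I \<Longrightarrow> \<bar>u x\<bar> \<le> M"
proof -
  have cpt: "\<exists>M. \<forall>x\<in>{0..b}. \<bar>u x\<bar> \<le> M" if "{0..b} \<subseteq> I" for b
  proof -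
    have "continuous_on {0..b} u" using H1_on_ac_on[OF H that] ac_on_continuous by blast
    then have "bounded (u ` {0..b})" using compact_continuous_image compact_imp_bounded by blast
    then show ?thesis unfolding bounded_iff by force
  qed
  show ?thesis
  proof (cases "I = {0..}")
    case True
    have "\<forall>\<^sub>F x in at_top. \<bar>u x\<bar> < 1"
      using H1_on_halfline_tendsto_0[of u du] H True by (auto simp: tendsto_iff)
    then obtain b where b: "\<And>x. x \<ge> b \<Longrightarrow> \<bar>u x\<bar> < 1" by (auto simp: eventually_at_top_linorder)
    obtain M where M: "\<forall>x\<in>{0..b}. \<bar>u x\<bar> \<le> M" using cpt[of b] True by auto
    show ?thesis
    proof (rule that[of "max M 1"])
      fix x assume "x \<in> I"
      then show "\<bar>u x\<bar> \<le> max M 1" using True M b[of x] by (cases "x \<le> b") (auto simp: le_max_iff_disj)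
    qed
  next
    case False
    then obtain M where "\<forall>x\<in>{0..l}. \<bar>u x\<bar> \<le> M" using I cpt[of l] by auto
    then show ?thesis using I False that[of M] by blast
  qed
qed

context nls
begin

text \<open>\<open>F\<close> is maximal on nonnegative numbers at its critical point 1. This makes
  rescaling harmless: if the norm \<open>A\<close> is at most the p-th power \<open>B\<close>, then
  \<open>s^2/2 * A - s powr p / p * B\<close> is at most \<open>(1/2 - 1/p) * A\<close> for every
  \<open>s \<ge> 0\<close>.\<close>

lemma half_F_le: assumes "s \<ge> 0" shows "s\<^sup>2 / 2 - s powr p / p \<le> 1/2 - 1/p"
proof -
  have "F s \<le> F 1"
  proof (cases "s \<le> 1")
    case True
    show ?thesis
    proof (rule DERIV_nonneg_imp_nondecreasing[OF True])
      fix x assume x: "s \<le> x" "x \<le> 1"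
      have "\<bar>x\<bar> powr (p - 2) \<le> 1" using x assms p_gt_2 powr_mono2[of "p-2" x 1] by simp
      then show "\<exists>y. (F has_real_derivative y) (at x) \<and> 0 \<le> y"
        using F_deriv[of x] x assms by (intro exI[of _ "2 * f x"]) (auto simp: f_factor)
    qed
  next
    case False
    show ?thesis
    proof (rule DERIV_nonpos_imp_nonincreasing[of 1 s F])
      fix x assume x: "1 \<le> x" "x \<le> s"
      have "\<bar>x\<bar> powr (p - 2) \<ge> 1" using x assms p_gt_2 powr_mono2[of "p-2" 1 x] by simp
      then show "\<exists>y. (F has_real_derivative y) (at x) \<and> y \<le> 0"
        using F_deriv[of x] x assms by (intro exI[of _ "2 * f x"]) (auto simp: f_factor mult_nonneg_nonpos)
    qed (use False in auto)
  qed
  then show ?thesis using assms by (simp add: F_def)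
qed

lemma powr_minus_continuous: "continuous_on S (\<lambda>u. \<bar>u\<bar> powr (p - 2) * u)"
  using p_gt_2 by (intro continuous_intros continuous_on_powr') auto

lemma powr_le_bound:
  assumes "\<bar>a\<bar> \<le> M"
  shows "\<bar>a\<bar> powr (p - 2) \<le> M powr (p - 2)"
  using assms p_gt_2 by (intro powr_mono2) auto

lemma L2_on_powr:
  assumes u: "L2_on I u" and M: "\<And>x. x \<in> I \<Longrightarrow> \<bar>u x\<bar> \<le> M"
  shows "L2_on I (\<lambda>x. \<bar>u x\<bar> powr (p - 2) * u x)"
proof -
  have m: "set_borel_measurable lborel I (\<lambda>x. \<bar>u x\<bar> powr (p - 2) * u x)"
    by (rule set_borel_measurable_compose_0[where h = "\<lambda>u. \<bar>u\<bar> powr (p - 2) * u"])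
      (use u in \<open>auto simp: L2_on_def powr_minus_continuous\<close>)
  have m2: "set_borel_measurable lborel I (\<lambda>x. (\<bar>u x\<bar> powr (p - 2) * u x)\<^sup>2)"
    by (rule set_borel_measurable_compose_0[where h = "\<lambda>u. (\<bar>u\<bar> powr (p - 2) * u)\<^sup>2"])
      (use u in \<open>auto simp: L2_on_def intro!: continuous_on_power powr_minus_continuous\<close>)
  have "set_integrable lborel I (\<lambda>x. (M powr (p - 2))\<^sup>2 * (u x)\<^sup>2)"
    using u unfolding L2_on_def by auto
  then have "set_integrable lborel I (\<lambda>x. (\<bar>u x\<bar> powr (p - 2) * u x)\<^sup>2)" unfolding set_integrable_def
  proof (rule Bochner_Integration.integrable_bound)
    have "(\<bar>u x\<bar> powr (p - 2) * u x)\<^sup>2 \<le> (M powr (p - 2))\<^sup>2 * (u x)\<^sup>2" if "x \<in> I" for x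
      using powr_le_bound[OF M[OF that]] by (auto simp: power_mult_distrib intro!: mult_right_mono power_mono)
    then show "AE x in lborel. norm (indicator I x *\<^sub>R (\<bar>u x\<bar> powr (p - 2) * u x)\<^sup>2)
         \<le> norm (indicator I x *\<^sub>R ((M powr (p - 2))\<^sup>2 * (u x)\<^sup>2))"
      by (intro AE_I2) (auto simp: indicator_def)
  qed (use m2 in \<open>auto simp: set_borel_measurable_def\<close>)
  then show ?thesis using m by (auto simp: L2_on_def)
qed

lemma abs_powr_p_integrable:
  assumes "L2_on I u" and "\<And>x. x \<in> I \<Longrightarrow> \<bar>u x\<bar> \<le> M"
  shows "set_integrable lborel I (\<lambda>x. \<bar>u x\<bar> powr p)"
proof -
  have "set_integrable lborel I (\<lambda>x. (\<bar>u x\<bar> powr (p - 2) * u x) * u x)"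
    by (rule L2_on_mult[OF L2_on_powr]) (use assms in auto)
  moreover have "(\<bar>u x\<bar> powr (p - 2) * u x) * u x = \<bar>u x\<bar> powr p" for x
    by (simp add: powr_p power2_eq_square)
  ultimately show ?thesis by simp
qed

text \<open>AM-GM: \<open>du^2 + F u >= 2 |du| sqrt (F u)\<close>, and the right-hand side is twice the variation of \<open>G |u|\<close>.\<close>
lemma action_ge_G_diff:
  assumes ab: "a \<le> b" and U: "ac_on a b u du" and d2: "set_integrable lborel {a..b} (\<lambda>t. (du t)\<^sup>2)"
    and um: "\<And>t. t \<in> {a..b} \<Longrightarrow> \<bar>u t\<bar> \<le> mst"
  shows "\<bar>G \<bar>u b\<bar> - G \<bar>u a\<bar>\<bar> \<le> integral {a..b} (\<lambda>t. ((du t)\<^sup>2 + F (u t)) / 2)"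
proof -
  let ?h = "\<lambda>t. ((du t)\<^sup>2 + F (u t)) / 2"
  have c: "continuous_on {a..b} u" using U ac_on_continuous by auto
  have cF: "continuous_on {a..b} (\<lambda>t. F (u t))" by (rule continuous_on_compose2[OF F_continuous[of UNIV] c]) auto
  have hi: "set_integrable lborel {a..b} ?h"
    by (intro set_integral_add set_integrable_divide d2 impI borel_integrable_atLeastAtMost' cF)
  have si: "set_integrable lborel {a..b} du" using U by (auto simp: ac_on_def)
  have mi: "set_integrable lborel {a..b} (\<lambda>t. \<bar>du t\<bar>)" by (intro set_integrable_abs si)
  note hk = set_borel_integral_eq_integral(1)
  \<comment> \<open>One \<open>e\<close> pays for bounding \<open>R\<close> by
    \<open>R (u x)\<close> on the values crossed between \<open>u x\<close> and \<open>u y\<close>,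
    the other for returning from \<open>R (u x)\<close> to \<open>R (u t)\<close> under the
    integral.\<close>
  have key: "\<bar>G \<bar>u b\<bar> - G \<bar>u a\<bar>\<bar> \<le> integral {a..b} (\<lambda>t. ?h t + 2 * e * \<bar>du t\<bar>)" if e: "e > 0" for e
  proof -
    let ?k = "\<lambda>t. ?h t + 2 * e * \<bar>du t\<bar>"
    have ki: "set_integrable lborel {a..b} ?k" by (intro set_integral_add hi set_integrable_mult_right impI mi)
    have "uniformly_continuous_on {0..mst} R"
      by (intro compact_uniformly_continuous R_continuous) auto
    then obtain d' where d': "d' > 0"
      "\<And>r s. r \<in> {0..mst} \<Longrightarrow> s \<in> {0..mst} \<Longrightarrow> dist s r < d' \<Longrightarrow> dist (R s) (R r) < e"
      unfolding uniformly_continuous_on_def using e by metis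
    have "uniformly_continuous_on {a..b} u" using c by (auto intro: compact_uniformly_continuous)
    then obtain d where d: "d > 0"
      "\<And>x y. x \<in> {a..b} \<Longrightarrow> y \<in> {a..b} \<Longrightarrow> dist y x < d \<Longrightarrow> dist (u y) (u x) < d'"
      unfolding uniformly_continuous_on_def using d' by metis
    let ?P = "\<lambda>x. integral {a..x} ?k"
    have "\<bar>G \<bar>u b\<bar> - G \<bar>u a\<bar>\<bar> \<le> ?P b - ?P a"
    proof (rule local_to_global_bound[OF ab d(1)])
      fix x y assume xy: "a \<le> x" "x \<le> y" "y \<le> b" "y - x < d"
      have s: "set_integrable lborel {x..y} h" if "set_integrable lborel {a..b} h" for h :: "real \<Rightarrow> real"
        by (rule set_integrable_lborel_subinterval[OF that]) (use xy in auto)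
      have um': "\<bar>u x\<bar> \<le> mst" "\<bar>u y\<bar> \<le> mst" using um xy by auto
      have uxy: "\<bar>u y - u x\<bar> < d'" using d(2)[of x y] xy by (auto simp: dist_real_def)
      have Rr: "R r \<le> R (u x) + e" if "\<bar>r - \<bar>u x\<bar>\<bar> < d'" "0 \<le> r" "r \<le> mst" for r
        using d'(2)[of "\<bar>u x\<bar>" r] that um' by (auto simp: dist_real_def)
      have 1: "\<bar>G \<bar>u y\<bar> - G \<bar>u x\<bar>\<bar> \<le> (R (u x) + e) * \<bar>\<bar>u y\<bar> - \<bar>u x\<bar>\<bar>"
      proof (cases "\<bar>u x\<bar> \<le> \<bar>u y\<bar>")
        case True
        have "G \<bar>u y\<bar> - G \<bar>u x\<bar> \<le> (R (u x) + e) * (\<bar>u y\<bar> - \<bar>u x\<bar>)"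
          using True uxy um' by (intro G_diff_le Rr) auto
        then show ?thesis using G_mono[of "\<bar>u x\<bar>" "\<bar>u y\<bar>"] True by simp
      next
        case False
        have "G \<bar>u x\<bar> - G \<bar>u y\<bar> \<le> (R (u x) + e) * (\<bar>u x\<bar> - \<bar>u y\<bar>)"
          using False uxy um' by (intro G_diff_le Rr) auto
        then show ?thesis using G_mono[of "\<bar>u y\<bar>" "\<bar>u x\<bar>"] False by simp
      qed
      have 2: "\<bar>\<bar>u y\<bar> - \<bar>u x\<bar>\<bar> \<le> integral {x..y} (\<lambda>t. \<bar>du t\<bar>)"
      proof -
        have "\<bar>\<bar>u y\<bar> - \<bar>u x\<bar>\<bar> \<le> \<bar>integral {x..y} du\<bar>" using ac_on_diff[OF U, of x y] xy by simp
        also have "\<dots> \<le> integral {x..y} (\<lambda>t. \<bar>du t\<bar>)"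
          by (rule set_integrable_abs_le_imp[OF s[OF si] s[OF mi]]) auto
        finally show ?thesis .
      qed
      have "\<bar>G \<bar>u y\<bar> - G \<bar>u x\<bar>\<bar> \<le> (R (u x) + e) * integral {x..y} (\<lambda>t. \<bar>du t\<bar>)"
        using 1 2 e by (meson R_nonneg add_nonneg_nonneg less_imp_le mult_left_mono order_trans)
      also have "\<dots> = integral {x..y} (\<lambda>t. (R (u x) + e) * \<bar>du t\<bar>)" by simp
      also have "\<dots> \<le> integral {x..y} ?k"
      proof (rule integral_le)
        show "(\<lambda>t. (R (u x) + e) * \<bar>du t\<bar>) integrable_on {x..y}"
          by (intro hk set_integrable_mult_right impI s mi)
        show "?k integrable_on {x..y}" by (rule hk[OF s[OF ki]])
        fix t assume t: "t \<in> {x..y}"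
        have "dist (u t) (u x) < d'" using t xy by (intro d(2)) (auto simp: dist_real_def)
        then have "dist \<bar>u t\<bar> \<bar>u x\<bar> < d'" by (auto simp: dist_real_def)
        moreover have "\<bar>u t\<bar> \<le> mst" using um[of t] t xy by auto
        ultimately have "dist (R \<bar>u x\<bar>) (R \<bar>u t\<bar>) < e" using um' by (intro d'(2)) (auto simp: dist_commute)
        then have "R (u x) \<le> R (u t) + e" by (simp add: dist_real_def abs_less_iff)
        then have "(R (u x) + e) * \<bar>du t\<bar> \<le> (R (u t) + 2 * e) * \<bar>du t\<bar>" by (intro mult_right_mono) auto
        also have "\<dots> = R (u t) * \<bar>du t\<bar> + 2 * e * \<bar>du t\<bar>" by (simp add: algebra_simps)
        also have "R (u t) * \<bar>du t\<bar> \<le> ?h t"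
        proof -
          have "F (u t) \<ge> 0" using um[of t] t xy by (intro F_nonneg) auto
          then have "(R (u t))\<^sup>2 = F (u t)" by (simp add: R_def)
          then show ?thesis using sum_squares_bound[of "\<bar>du t\<bar>" "R (u t)"] by (simp add: mult_ac)
        qed
        finally show "(R (u x) + e) * \<bar>du t\<bar> \<le> ?k t" by simp
      qed
      also have "\<dots> = ?P y - ?P x"
        by (rule integral_indefinite_diff[symmetric, of _ a b]) (use xy hk[OF ki] in auto)
      finally show "\<bar>G \<bar>u y\<bar> - G \<bar>u x\<bar>\<bar> \<le> ?P y - ?P x" .
    qed
    then show ?thesis by simp
  qed
  define J where "J = integral {a..b} (\<lambda>t. \<bar>du t\<bar>)"
  have J0: "J \<ge> 0" unfolding J_def by (intro Henstock_Kurzweil_Integration.integral_nonneg hk mi) auto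
  show ?thesis
  proof (rule field_le_epsilon)
    fix e :: real assume e: "e > 0"
    let ?e = "e / (2 * (J + 1))"
    have "\<bar>G \<bar>u b\<bar> - G \<bar>u a\<bar>\<bar> \<le> integral {a..b} (\<lambda>t. ?h t + 2 * ?e * \<bar>du t\<bar>)"
      using J0 e by (intro key) auto
    also have "\<dots> = integral {a..b} ?h + integral {a..b} (\<lambda>t. 2 * ?e * \<bar>du t\<bar>)"
      by (intro Henstock_Kurzweil_Integration.integral_add hk hi set_integrable_mult_right impI mi)
    also have "integral {a..b} (\<lambda>t. 2 * ?e * \<bar>du t\<bar>) = 2 * ?e * J" unfolding J_def by (rule integral_mult_right)
    also have "2 * ?e * J \<le> e" using J0 e by (simp add: field_simps)
    finally show "\<bar>G \<bar>u b\<bar> - G \<bar>u a\<bar>\<bar> \<le> integral {a..b} ?h + e" by simp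
  qed
qed

end

section \<open>Lower bounds by rescaling\<close>

lemma ac_on_scale:
  assumes "ac_on a b u du"
  shows "ac_on a b (\<lambda>x. c * u x) (\<lambda>x. c * du x)"
proof -
  have 1: "u x = u a + integral {a..x} du" if "x \<in> {a..b}" for x
    using assms that unfolding ac_on_def by blast
  have 2: "\<forall>x\<in>{a..b}. c * u x = c * u a + integral {a..x} (\<lambda>x. c * du x)"
  proof
    fix x assume "x \<in> {a..b}"
    from 1[OF this] have "c * u x = c * (u a + integral {a..x} du)" by (rule arg_cong)
    then show "c * u x = c * u a + integral {a..x} (\<lambda>x. c * du x)" by (simp add: distrib_left)
  qed
  have "set_integrable lborel {a..b} (\<lambda>x. c * du x)"
    using assms by (intro set_integrable_mult_right) (simp add: ac_on_def)
  then show ?thesis unfolding ac_on_def using 2 by blast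
qed

context nls
begin

lemma F_scale: "s \<ge> 0 \<Longrightarrow> F (s * u) = s\<^sup>2 * u\<^sup>2 - 2 / p * (s powr p * \<bar>u\<bar> powr p)"
  by (simp add: F_def power_mult_distrib abs_mult powr_mult)

text \<open>The estimate for \<open>s * u\<close>, written so that the norm part and the power part
  carry their own powers of \<open>s\<close> and can be integrated separately.\<close>

lemma scaled_action_ge:
  assumes ab: "a \<le> b" and U: "ac_on a b u du" and d2: "set_integrable lborel {a..b} (\<lambda>t. (du t)\<^sup>2)"
    and um: "\<And>t. t \<in> {a..b} \<Longrightarrow> s * \<bar>u t\<bar> \<le> mst" and s: "s \<ge> 0"
  shows "\<bar>G (s * \<bar>u b\<bar>) - G (s * \<bar>u a\<bar>)\<bar> \<le>
     integral {a..b} (\<lambda>t. s\<^sup>2 / 2 * ((du t)\<^sup>2 + (u t)\<^sup>2) - s powr p / p * \<bar>u t\<bar> powr p)"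
proof -
  have "set_integrable lborel {a..b} (\<lambda>t. (s * du t)\<^sup>2)" using d2 by (simp add: power_mult_distrib)
  then have "\<bar>G \<bar>s * u b\<bar> - G \<bar>s * u a\<bar>\<bar> \<le> integral {a..b} (\<lambda>t. ((s * du t)\<^sup>2 + F (s * u t)) / 2)"
    using um s by (intro action_ge_G_diff ac_on_scale ab U) (auto simp: abs_mult)
  also have "(\<lambda>t. ((s * du t)\<^sup>2 + F (s * u t)) / 2) =
      (\<lambda>t. s\<^sup>2 / 2 * ((du t)\<^sup>2 + (u t)\<^sup>2) - s powr p / p * \<bar>u t\<bar> powr p)"
    using p_gt_2 by (simp add: F_scale[OF s] power_mult_distrib field_simps)
  finally show ?thesis using s by (simp add: abs_mult)
qed

text \<open>Allows the part of an edge outside the passage from minimum to maximum to be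
  discarded.\<close>

lemma scaled_action_integrand_nonneg:
  assumes "s * \<bar>u\<bar> \<le> mst" "s \<ge> 0"
  shows "s\<^sup>2 / 2 * (d\<^sup>2 + u\<^sup>2) - s powr p / p * \<bar>u\<bar> powr p \<ge> 0"
proof -
  have "F (s * u) \<ge> 0" using assms by (intro F_nonneg) (simp add: abs_mult)
  then have "s\<^sup>2 / 2 * u\<^sup>2 - s powr p / p * \<bar>u\<bar> powr p \<ge> 0" by (simp add: F_scale[OF assms(2)] algebra_simps)
  moreover have "s\<^sup>2 / 2 * d\<^sup>2 \<ge> 0" by simp
  ultimately show ?thesis by (simp only: distrib_left)
qed

lemma abs_powr_le_square: "\<bar>u\<bar> \<le> 1 \<Longrightarrow> \<bar>u\<bar> powr p \<le> u\<^sup>2"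
  using powr_le_bound[of u 1] by (simp add: powr_p mult_left_le_one_le)

text \<open>One scaling factor \<open>s = mst / max |u|\<close> serves all edges, since they share
  the values of \<open>u\<close>; only the sum of their norms has to be compared with the p-th
  power. Every scaled edge contains a passage from the minimum of \<open>|u|\<close> up to
  \<open>mst\<close>, and the minimum is of order \<open>1 / sqrt l\<close> unless the claimed bound
  holds already.\<close>

lemma edges_lower_bound:
  assumes l: "l > 0" and N: "(N::nat) > 0"
    and H: "\<And>j. j < N \<Longrightarrow> H1_on {0..l} u (du j)"
    and D: "(\<Sum>j<N. E1 {0..l} u (du j)) \<le> N * Ep {0..l} u"
    and nz: "x1 \<in> {0..l}" "u x1 \<noteq> 0"
  shows "N * (G mst - G (mst * sqrt (G mst / ((1/2 - 1/p) * l))))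
    \<le> (1/2 - 1/p) * (\<Sum>j<N. E1 {0..l} u (du j))"
proof -
  define A where "A j = E1 {0..l} u (du j)" for j
  define S where "S = (\<Sum>j<N. A j)"
  define B where "B = Ep {0..l} u"
  define k where "k = 1/2 - 1/p"
  have k0: "k > 0" using p_gt_2 by (simp add: k_def field_simps)
  note H0 = H[OF N]
  obtain M0 where M0: "\<And>x. x \<in> {0..l} \<Longrightarrow> \<bar>u x\<bar> \<le> M0" using H1_on_bounded[OF H0, of l] by blast
  have u2: "set_integrable lborel {0..l} (\<lambda>x. (u x)\<^sup>2)" using H1_on_square_integrable(1)[OF H0] .
  have d2: "set_integrable lborel {0..l} (\<lambda>x. (du j x)\<^sup>2)" if "j < N" for j
    using H1_on_square_integrable(2)[OF H[OF that]] .
  have Ai: "set_integrable lborel {0..l} (\<lambda>x. (du j x)\<^sup>2 + (u x)\<^sup>2)" if "j < N" for j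
    by (intro set_integral_add d2 u2 that)
  have Bi: "set_integrable lborel {0..l} (\<lambda>x. \<bar>u x\<bar> powr p)"
    by (rule abs_powr_p_integrable[OF _ M0]) (use H0 in \<open>simp_all add: H1_on_def\<close>)
  note hk = set_borel_integral_eq_integral
  have A': "A j = integral {0..l} (\<lambda>x. (du j x)\<^sup>2 + (u x)\<^sup>2)" if "j < N" for j
    unfolding A_def E1_def using hk(2)[OF Ai[OF that]] .
  have B': "B = integral {0..l} (\<lambda>x. \<bar>u x\<bar> powr p)" unfolding B_def Ep_def using hk(2)[OF Bi] .
  have ac: "ac_on 0 l u (du j)" if "j < N" for j using H1_on_ac_on[OF H[OF that]] by simp
  have c: "continuous_on {0..l} (\<lambda>x. \<bar>u x\<bar>)" using ac_on_continuous[OF ac[OF N]] by (intro continuous_intros)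
  obtain xm where xm: "xm \<in> {0..l}" "\<And>x. x \<in> {0..l} \<Longrightarrow> \<bar>u x\<bar> \<le> \<bar>u xm\<bar>"
    using continuous_attains_sup[OF compact_Icc _ c] l by auto
  obtain x0 where x0: "x0 \<in> {0..l}" "\<And>x. x \<in> {0..l} \<Longrightarrow> \<bar>u x0\<bar> \<le> \<bar>u x\<bar>"
    using continuous_attains_inf[OF compact_Icc _ c] l by auto
  have Mp: "\<bar>u xm\<bar> > 0" using xm(2)[OF nz(1)] nz(2) by simp
  have SB: "S \<le> N * B" using D by (simp add: S_def A_def B_def)
  define U where "U = integral {0..l} (\<lambda>x. (u x)\<^sup>2)"
  have UA: "U \<le> A j" if "j < N" for j
    unfolding U_def A'[OF that] by (intro integral_le hk(1) u2 Ai that) auto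
  have NU: "N * U \<le> S" unfolding S_def using sum_bounded_below[of "{..<N}" U A] UA by simp
  have "l * (u x0)\<^sup>2 = integral {0..l} (\<lambda>x. (u x0)\<^sup>2)" using l by simp
  also have "\<dots> \<le> U" unfolding U_def
    by (intro integral_le hk(1)[OF u2] integrable_const_ivl) (use x0(2) in \<open>auto simp: abs_le_square_iff\<close>)
  finally have lu: "l * (u x0)\<^sup>2 \<le> U" .
  have Upos: "U > 0"
  proof (rule ccontr)
    assume "\<not> U > 0"
    moreover have "U \<ge> 0" unfolding U_def by (intro Henstock_Kurzweil_Integration.integral_nonneg hk(1) u2) auto
    ultimately have I0: "integral {0..l} (\<lambda>x. (u x)\<^sup>2) = 0" by (simp add: U_def)
    have "continuous_on {0..l} (\<lambda>x. (u x)\<^sup>2)" by (intro continuous_intros ac_on_continuous[OF ac[OF N]])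
    from integral_eq_0_iff[OF this l] I0 have "\<forall>x\<in>{0..l}. (u x)\<^sup>2 = 0" by simp
    then show False using nz by auto
  qed
  \<comment> \<open>A maximum below 1 would give \<open>|u| powr p \<le> q * u^2\<close> with
    \<open>q < 1\<close>, against \<open>D\<close>. The bound yields \<open>s \<le> mst\<close>, so
    scaling cannot make the small minimum large.\<close>
  have M1: "\<bar>u xm\<bar> \<ge> 1"
  proof (rule ccontr)
    assume *: "\<not> \<bar>u xm\<bar> \<ge> 1"
    define q where "q = \<bar>u xm\<bar> powr (p - 2)"
    have q: "q < 1" unfolding q_def using powr_less_mono2[of "p - 2" "\<bar>u xm\<bar>" 1] * p_gt_2 by simp
    have "B \<le> integral {0..l} (\<lambda>x. q * (u x)\<^sup>2)" unfolding B'
      by (intro integral_le hk(1) Bi set_integrable_mult_right impI u2)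
        (use xm(2) powr_le_bound in \<open>auto simp: powr_p q_def intro!: mult_right_mono\<close>)
    also have "\<dots> = q * U" by (simp add: U_def)
    also have "\<dots> < U" using q Upos by simp
    finally have "N * B < N * U" using N by simp
    then show False using SB NU by linarith
  qed
  define s where "s = mst / \<bar>u xm\<bar>"
  have s: "s > 0" "s \<le> mst" "s * \<bar>u xm\<bar> = mst" using Mp M1 mst_gt_1 by (auto simp: s_def field_simps)
  have sm: "s * \<bar>u x\<bar> \<le> mst" if "x \<in> {0..l}" for x
    using xm(2)[OF that] s(1) by (subst s(3)[symmetric]) simp
  have each: "G mst - G (s * \<bar>u x0\<bar>) \<le> s\<^sup>2 / 2 * A j - s powr p / p * B" if j: "j < N" for j
  proof -
    let ?h = "\<lambda>t. s\<^sup>2 / 2 * ((du j t)\<^sup>2 + (u t)\<^sup>2) - s powr p / p * \<bar>u t\<bar> powr p"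
    have hi: "set_integrable lborel {0..l} ?h"
      by (intro set_integral_diff set_integrable_mult_right impI Ai Bi j)
    have tin: "t \<in> {0..l}" if "t \<in> {min x0 xm..max x0 xm}" for t
      using that x0(1) xm(1) by (auto simp: min_def max_def split: if_splits)
    have "G mst - G (s * \<bar>u x0\<bar>) \<le> \<bar>G (s * \<bar>u (max x0 xm)\<bar>) - G (s * \<bar>u (min x0 xm)\<bar>)\<bar>"
      using s(3) by (auto simp: max_def min_def)
    also have "\<dots> \<le> integral {min x0 xm..max x0 xm} ?h"
      by (intro scaled_action_ge ac_on_subinterval[OF ac[OF j]] set_integrable_lborel_subinterval[OF d2[OF j]])
        (use x0(1) xm(1) s(1) sm[OF tin] in auto)
    also have "\<dots> \<le> integral {0..l} ?h"
    proof (rule integral_subset_le)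
      show "?h integrable_on {min x0 xm..max x0 xm}"
        by (rule hk(1), rule set_integrable_lborel_subinterval[OF hi]) (use x0 xm in auto)
    qed (use x0 xm hk(1)[OF hi] scaled_action_integrand_nonneg sm s(1) in auto)
    also have "\<dots> = s\<^sup>2 / 2 * A j - s powr p / p * B"
      unfolding A'[OF j] B'
      by (subst Henstock_Kurzweil_Integration.integral_diff)
        (intro hk(1) set_integrable_mult_right impI Ai Bi j, intro hk(1) set_integrable_mult_right impI Ai Bi j, simp)
    finally show ?thesis .
  qed
  have "N * (G mst - G (s * \<bar>u x0\<bar>)) \<le> (\<Sum>j<N. s\<^sup>2 / 2 * A j - s powr p / p * B)"
    using sum_bounded_below[of "{..<N}" "G mst - G (s * \<bar>u x0\<bar>)" "\<lambda>j. s\<^sup>2 / 2 * A j - s powr p / p * B"] each by simp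
  also have "\<dots> = s\<^sup>2 / 2 * S - s powr p / p * (N * B)"
    by (simp add: S_def sum_subtractf sum_distrib_left)
  also have "\<dots> \<le> s\<^sup>2 / 2 * S - s powr p / p * S"
    using SB p_gt_2 by (simp add: mult_left_mono divide_right_mono)
  also have "\<dots> = (s\<^sup>2 / 2 - s powr p / p) * S" by (simp add: algebra_simps)
  also have "\<dots> \<le> k * S" unfolding k_def
    by (rule mult_right_mono[OF half_F_le]) (use s NU Upos N in \<open>auto intro: order_trans[OF _ NU]\<close>)
  finally have main: "N * (G mst - G (s * \<bar>u x0\<bar>)) \<le> k * S" .
  \<comment> \<open>Either the norms are so large that nothing is left to prove, or they are
    bounded, and then \<open>k * l * (u x0)^2 \<le> G mst\<close> makes the minimum small.\<close>
  have "N * (G mst - G (mst * sqrt (G mst / (k * l)))) \<le> k * S"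
  proof (cases "k * S \<ge> N * G mst")
    case True
    have "G (mst * sqrt (G mst / (k * l))) \<ge> 0"
      using k0 l mst_gt_1 G_mst_pos by (intro G_nonneg) auto
    then have "N * (G mst - G (mst * sqrt (G mst / (k * l)))) \<le> N * G mst" by (intro mult_left_mono) auto
    then show ?thesis using True by linarith
  next
    case False
    have "N * (k * (l * (u x0)\<^sup>2)) \<le> N * (k * U)" using lu k0 by (intro mult_left_mono) auto
    also have "\<dots> = k * (N * U)" by simp
    also have "\<dots> \<le> k * S" using NU k0 by (intro mult_left_mono) auto
    also have "\<dots> \<le> N * G mst" using False by simp
    finally have "k * l * (u x0)\<^sup>2 \<le> G mst" using N by (simp add: mult.assoc)
    then have "(u x0)\<^sup>2 \<le> G mst / (k * l)" using k0 l by (simp add: field_simps)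
    then have "\<bar>u x0\<bar> \<le> sqrt (G mst / (k * l))" using real_sqrt_le_mono by fastforce
    then have "s * \<bar>u x0\<bar> \<le> mst * sqrt (G mst / (k * l))" using s by (intro mult_mono) auto
    then have "G (s * \<bar>u x0\<bar>) \<le> G (mst * sqrt (G mst / (k * l)))" using s by (intro G_mono) auto
    then have "N * (G mst - G (mst * sqrt (G mst / (k * l)))) \<le> N * (G mst - G (s * \<bar>u x0\<bar>))"
      by (intro mult_left_mono) auto
    then show ?thesis using main by linarith
  qed
  then show ?thesis by (simp add: S_def A_def k_def)
qed

text \<open>There are two passages: from the vertex to the maximum, and from the maximum to the
  value 0 at infinity. The strict inequality \<open>D\<close> forces a value above 1, hence
  \<open>s \<le> mst\<close>; the only loss is the part of the first passage below the scaled vertex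
  value.\<close>

lemma halfline_lower_bound:
  assumes H: "H1_on {0..} u du"
    and D: "E1 {0..} u du < Ep {0..} u"
  shows "2 * G mst - G (mst * \<bar>u 0\<bar>) \<le> (1/2 - 1/p) * E1 {0..} u du"
proof -
  define A where "A = E1 {0..} u du"
  define B where "B = Ep {0..} u"
  obtain M0 where M0: "\<And>x. x \<in> {0..} \<Longrightarrow> \<bar>u x\<bar> \<le> M0" using H1_on_bounded[OF H] by blast
  note i2 = H1_on_square_integrable[OF H]
  have Ai: "set_integrable lborel {0..} (\<lambda>x. (du x)\<^sup>2 + (u x)\<^sup>2)" by (intro set_integral_add i2)
  have Bi: "set_integrable lborel {0..} (\<lambda>x. \<bar>u x\<bar> powr p)"
    by (rule abs_powr_p_integrable[OF _ M0]) (use H in \<open>simp_all add: H1_on_def\<close>)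
  note hk = set_borel_integral_eq_integral
  have ac: "ac_on 0 b u du" for b using H1_on_ac_on[OF H] by auto
  have lim: "(u \<longlongrightarrow> 0) at_top" by (rule H1_on_halfline_tendsto_0[OF H])
  have A0: "A \<ge> 0" unfolding A_def E1_def set_lebesgue_integral_def by (intro Bochner_Integration.integral_nonneg) auto
  have "\<exists>x1\<ge>0. \<bar>u x1\<bar> > 1"
  proof (rule ccontr)
    assume "\<not> ?thesis"
    then have "\<bar>u x\<bar> powr p \<le> (du x)\<^sup>2 + (u x)\<^sup>2" if "x \<ge> 0" for x
      using abs_powr_le_square[of "u x"] that by (smt (verit) zero_le_power2)
    then have "B \<le> A" unfolding A_def B_def E1_def Ep_def by (intro set_integral_mono Ai Bi) auto
    then show False using D by (simp add: A_def B_def)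
  qed
  then obtain x1 where x1: "x1 \<ge> 0" "\<bar>u x1\<bar> > 1" by blast
  obtain b where b: "\<And>x. x \<ge> b \<Longrightarrow> \<bar>u x\<bar> < 1"
    using lim unfolding tendsto_iff eventually_at_top_linorder by (metis diff_zero dist_real_def zero_less_one)
  define b' where "b' = max b x1"
  have c: "continuous_on {0..b'} (\<lambda>x. \<bar>u x\<bar>)" using ac_on_continuous[OF ac] by (intro continuous_intros)
  obtain xm where xm: "xm \<in> {0..b'}" "\<And>x. x \<in> {0..b'} \<Longrightarrow> \<bar>u x\<bar> \<le> \<bar>u xm\<bar>"
    using continuous_attains_sup[OF compact_Icc _ c] x1 by (auto simp: b'_def le_max_iff_disj)
  have M1: "\<bar>u xm\<bar> > 1" using xm(2)[of x1] x1 by (auto simp: b'_def)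
  have um: "\<bar>u x\<bar> \<le> \<bar>u xm\<bar>" if "x \<ge> 0" for x
    using b[of x] M1 xm(2)[of x] that by (cases "x \<le> b'") (auto simp: b'_def max_def split: if_splits)
  define s where "s = mst / \<bar>u xm\<bar>"
  have s: "s > 0" "s \<le> mst" "s * \<bar>u xm\<bar> = mst" using M1 mst_gt_1 by (auto simp: s_def field_simps)
  have sm: "s * \<bar>u x\<bar> \<le> mst" if "x \<ge> 0" for x
    using um[OF that] s(1) by (subst s(3)[symmetric]) simp
  let ?h = "\<lambda>t. s\<^sup>2 / 2 * ((du t)\<^sup>2 + (u t)\<^sup>2) - s powr p / p * \<bar>u t\<bar> powr p"
  have hi: "set_integrable lborel {0..} ?h"
    by (intro set_integral_diff set_integrable_mult_right impI Ai Bi)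
  have hs: "set_integrable lborel {x..y} ?h" if "0 \<le> x" for x y
    by (rule set_integrable_subset[OF hi]) (use that in auto)
  have ds: "set_integrable lborel {x..y} (\<lambda>t. (du t)\<^sup>2)" if "0 \<le> x" for x y
    by (rule set_integrable_subset[OF i2(2)]) (use that in auto)
  have "2 * G mst - G (s * \<bar>u 0\<bar>) - G (s * \<bar>u r\<bar>) \<le> integral {0..r} ?h" if r: "r \<ge> xm" for r
  proof -
    have x0: "0 \<le> xm" using xm(1) by simp
    have "\<bar>G (s * \<bar>u xm\<bar>) - G (s * \<bar>u 0\<bar>)\<bar> \<le> integral {0..xm} ?h"
      by (rule scaled_action_ge[OF x0 ac ds]) (use s sm in auto)
    moreover have "\<bar>G (s * \<bar>u r\<bar>) - G (s * \<bar>u xm\<bar>)\<bar> \<le> integral {xm..r} ?h"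
      by (rule scaled_action_ge[OF r ac_on_subinterval[OF ac[of r]] ds]) (use s sm x0 r in auto)
    moreover have "integral {0..xm} ?h + integral {xm..r} ?h = integral {0..r} ?h"
      by (rule Henstock_Kurzweil_Integration.integral_combine[OF x0 r hk(1)[OF hs]]) simp
    ultimately show ?thesis unfolding s(3) by linarith
  qed
  then have ev: "\<forall>\<^sub>F r in at_top. 2 * G mst - G (s * \<bar>u 0\<bar>) - G (s * \<bar>u r\<bar>) \<le> integral {0..r} ?h"
    by (auto simp: eventually_at_top_linorder)
  have "((\<lambda>r. s * \<bar>u r\<bar>) \<longlongrightarrow> s * \<bar>0\<bar>) at_top" by (intro tendsto_intros lim)
  then have "((\<lambda>r. G (s * \<bar>u r\<bar>)) \<longlongrightarrow> G (s * \<bar>0\<bar>)) at_top"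
    by (rule continuous_on_tendsto_compose[OF G_continuous]) (use s in auto)
  then have l1: "((\<lambda>r. 2 * G mst - G (s * \<bar>u 0\<bar>) - G (s * \<bar>u r\<bar>)) \<longlongrightarrow> 2 * G mst - G (s * \<bar>u 0\<bar>) - 0) at_top"
    by (intro tendsto_intros) simp
  have "2 * G mst - G (s * \<bar>u 0\<bar>) - 0 \<le> (LINT t:{0..}|lborel. ?h t)"
    by (rule tendsto_le[OF _ set_integral_halfline_limit[OF hi] l1 ev]) simp
  also have "\<dots> = s\<^sup>2 / 2 * A - s powr p / p * B" unfolding A_def B_def E1_def Ep_def
    by (subst set_integral_diff(2)) (intro set_integrable_mult_right impI Ai Bi, intro set_integrable_mult_right impI Ai Bi, simp)
  also have "\<dots> \<le> s\<^sup>2 / 2 * A - s powr p / p * A"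
    using D p_gt_2 by (simp add: mult_left_mono divide_right_mono A_def B_def)
  also have "\<dots> = (s\<^sup>2 / 2 - s powr p / p) * A" by (simp add: algebra_simps)
  also have "\<dots> \<le> (1/2 - 1/p) * A"
    by (rule mult_right_mono[OF half_F_le A0]) (use s in auto)
  finally have "2 * G mst - G (s * \<bar>u 0\<bar>) \<le> (1/2 - 1/p) * A" by simp
  moreover have "G (s * \<bar>u 0\<bar>) \<le> G (mst * \<bar>u 0\<bar>)"
    using s by (intro G_mono mult_right_mono) auto
  ultimately show ?thesis by (simp add: A_def)
qed

text \<open>The price of the vertex value on a compact edge, needed when that value is too large for
  a half-line bump to cost nearly two passages.\<close>

lemma edge_norm_ge:
  assumes l: "l \<ge> 1" and H: "H1_on {0..l} u du"
  shows "(u 0)\<^sup>2 / 2 \<le> E1 {0..l} u du"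
proof -
  note i2 = H1_on_square_integrable[OF H]
  note hk = set_borel_integral_eq_integral
  have Ai: "set_integrable lborel {0..l} (\<lambda>x. (du x)\<^sup>2 + (u x)\<^sup>2)" by (intro set_integral_add i2)
  have s: "set_integrable lborel {0..1} h" if "set_integrable lborel {0..l} h" for h :: "real \<Rightarrow> real"
    by (rule set_integrable_subset[OF that]) (use l in auto)
  have "(u 0)\<^sup>2 \<le> 2 * integral {0..0+1} (\<lambda>t. (u t)\<^sup>2) + integral {0..0+1} (\<lambda>t. (du t)\<^sup>2)"
    by (rule ac_on_left_value_bound) (use l H1_on_ac_on[OF H, of 1] s[OF i2(2)] in auto)
  also have "\<dots> \<le> 2 * (integral {0..1} (\<lambda>t. (du t)\<^sup>2) + integral {0..1} (\<lambda>t. (u t)\<^sup>2))"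
    using Henstock_Kurzweil_Integration.integral_nonneg[OF hk(1)[OF s[OF i2(2)]]] by simp
  also have "integral {0..1} (\<lambda>t. (du t)\<^sup>2) + integral {0..1} (\<lambda>t. (u t)\<^sup>2) = integral {0..1} (\<lambda>x. (du x)\<^sup>2 + (u x)\<^sup>2)"
    by (intro Henstock_Kurzweil_Integration.integral_add[symmetric] hk(1) s i2)
  also have "\<dots> \<le> integral {0..l} (\<lambda>x. (du x)\<^sup>2 + (u x)\<^sup>2)"
    by (rule integral_subset_le[OF _ hk(1)[OF s[OF Ai]] hk(1)[OF Ai]]) (use l in auto)
  finally show ?thesis unfolding E1_def hk(2)[OF Ai] by simp
qed

end

section \<open>Regularity on half-lines\<close>

text \<open>Derivatives are relative to the closed interval, which is the form in which primitives
  and solutions of differential equations provide them at the end points.\<close>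

lemma has_real_derivative_nonpos_imp_le:
  fixes g g' :: "real \<Rightarrow> real"
  assumes "a \<le> b" and d: "\<And>t. t \<in> {a..b} \<Longrightarrow> (g has_real_derivative g' t) (at t within {a..b})"
    and n: "\<And>t. t \<in> {a..b} \<Longrightarrow> g' t \<le> 0"
  shows "g b \<le> g a"
proof -
  have "\<exists>x\<in>{a..b}. g b - g a = g' x * (b - a)"
    by (rule mvt_very_simple[OF assms(1)]) (use d in \<open>auto simp: has_field_derivative_def\<close>)
  then obtain x where "x \<in> {a..b}" "g b - g a = g' x * (b - a)" by blast
  then show ?thesis using n[of x] assms(1) mult_nonpos_nonneg[of "g' x" "b - a"] by simp
qed

section \<open>Closure properties of L2 and H1, and extension by zero\<close>

lemma L2_on_add:
  assumes f: "L2_on I f" and g: "L2_on I g"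
  shows "L2_on I (\<lambda>x. f x + g x)"
proof -
  have mf: "(\<lambda>x. indicator I x *\<^sub>R f x) \<in> borel_measurable lborel"
    and mg: "(\<lambda>x. indicator I x *\<^sub>R g x) \<in> borel_measurable lborel"
    using f g unfolding L2_on_def set_borel_measurable_def by blast+
  have "(\<lambda>x. indicator I x *\<^sub>R f x + indicator I x *\<^sub>R g x) \<in> borel_measurable lborel"
    by (rule borel_measurable_add[OF mf mg])
  then have m: "set_borel_measurable lborel I (\<lambda>x. f x + g x)"
    unfolding set_borel_measurable_def by (simp add: distrib_left)
  have "set_integrable lborel I (\<lambda>x. ((f x)\<^sup>2 + (g x)\<^sup>2) + 2 * (f x * g x))"
    using f g L2_on_mult[OF f g] unfolding L2_on_def
    by (intro set_integral_add set_integrable_mult_right impI) auto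
  also have "(\<lambda>x. ((f x)\<^sup>2 + (g x)\<^sup>2) + 2 * (f x * g x)) = (\<lambda>x. (f x + g x)\<^sup>2)"
    by (auto simp: power2_sum)
  finally show ?thesis using m by (simp add: L2_on_def)
qed

lemma L2_on_cmult:
  assumes f: "L2_on I f"
  shows "L2_on I (\<lambda>x. c * f x)"
proof -
  have "(\<lambda>x. indicator I x *\<^sub>R f x) \<in> borel_measurable lborel"
    using f unfolding L2_on_def set_borel_measurable_def by blast
  then have "(\<lambda>x. c * (indicator I x *\<^sub>R f x)) \<in> borel_measurable lborel" by (rule borel_measurable_times[OF borel_measurable_const])
  then have "set_borel_measurable lborel I (\<lambda>x. c * f x)"
    unfolding set_borel_measurable_def by (simp add: mult.left_commute)
  then show ?thesis using f by (auto simp: L2_on_def power_mult_distrib)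
qed

lemma L2_on_continuous:
  assumes "continuous_on {a..b} f"
  shows "L2_on {a..b} f"
proof -
  have "set_borel_measurable lborel {a..b} f"
    using borel_measurable_continuous_on_indicator[OF _ assms] unfolding set_borel_measurable_def by simp
  moreover have "set_integrable lborel {a..b} (\<lambda>x. (f x)\<^sup>2)"
    by (intro borel_integrable_atLeastAtMost' continuous_intros assms)
  ultimately show ?thesis by (simp add: L2_on_def)
qed

lemma L2_on_interval_integrable:
  assumes "L2_on {a..b} f"
  shows "set_integrable lborel {a..b} f"
  using L2_on_mult[OF assms L2_on_continuous[OF continuous_on_const[of _ 1]]] by simp

lemma L2_on_subset:
  assumes f: "L2_on I f" and J: "J \<subseteq> I" "J \<in> sets lborel"
  shows "L2_on J f"
proof -
  have m: "(\<lambda>x. indicator I x *\<^sub>R f x) \<in> borel_measurable lborel"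
    using f unfolding L2_on_def set_borel_measurable_def by blast
  have "(\<lambda>x. indicator J x *\<^sub>R (indicator I x *\<^sub>R f x)) \<in> borel_measurable lborel"
    by (rule borel_measurable_scaleR[OF borel_measurable_indicator[OF J(2)] m])
  also have "(\<lambda>x. indicator J x *\<^sub>R (indicator I x *\<^sub>R f x)) = (\<lambda>x. indicator J x *\<^sub>R f x)"
    using J(1) by (intro ext) (auto simp: indicator_def)
  finally have "set_borel_measurable lborel J f" by (simp add: set_borel_measurable_def)
  moreover have "set_integrable lborel J (\<lambda>x. (f x)\<^sup>2)"
    using f by (intro set_integrable_subset[OF _ J(2,1)]) (simp add: L2_on_def)
  ultimately show ?thesis by (simp add: L2_on_def)
qed

lemma H1_on_of_ac_on:
  assumes u: "ac_on 0 b u du" and d: "L2_on {0..b} du"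
  shows "H1_on {0..b} u du"
proof -
  have A: "u x = u 0 + integral {0..x} du" if "x \<in> {0..b}" for x
    using u that unfolding ac_on_def by blast
  have si: "set_integrable lborel {0..x} du" if "x \<in> {0..b}" for x
    by (rule set_integrable_subset[of _ "{0..b}"]) (use u that in \<open>auto simp: ac_on_def\<close>)
  have "\<forall>x\<in>{0..b}. set_integrable lborel {0..x} du \<and> u x = u 0 + (LINT t:{0..x}|lborel. du t)"
  proof
    fix x assume x: "x \<in> {0..b}"
    show "set_integrable lborel {0..x} du \<and> u x = u 0 + (LINT t:{0..x}|lborel. du t)"
      unfolding set_borel_integral_eq_integral(2)[OF si[OF x]] using A[OF x] si[OF x] by (rule conjI[rotated])
  qed
  then show ?thesis using d L2_on_continuous[OF ac_on_continuous[OF u]] by (simp only: H1_on_def)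
qed

lemma set_integrable_extend_0:
  fixes h :: "real \<Rightarrow> real"
  assumes "set_integrable lborel {0..b} h" "\<And>x. x > b \<Longrightarrow> h' x = 0" "\<And>x. x \<in> {0..b} \<Longrightarrow> h' x = h x"
    "{0..b} \<subseteq> S" "S \<subseteq> {0..}"
  shows "set_integrable lborel S h'" "(LINT x:S|lborel. h' x) = integral {0..b} h"
proof -
  have eq: "(\<lambda>x. indicator S x *\<^sub>R h' x) = (\<lambda>x. indicator {0..b} x *\<^sub>R h x)"
  proof
    fix x
    show "indicator S x *\<^sub>R h' x = indicator {0..b} x *\<^sub>R h x"
      using assms(2)[of x] assms(3)[of x] subsetD[OF assms(4), of x] subsetD[OF assms(5), of x]
      by (cases "x \<in> {0..b}"; cases "x > b") (auto simp: indicator_def)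
  qed
  show "set_integrable lborel S h'" using assms(1) unfolding set_integrable_def eq .
  show "(LINT x:S|lborel. h' x) = integral {0..b} h"
    using set_borel_integral_eq_integral(2)[OF assms(1)] unfolding set_lebesgue_integral_def eq .
qed

lemma L2_on_extend_0:
  assumes h: "L2_on {0..b} h"
  shows "L2_on {0..} (\<lambda>x. if x \<le> b then h x else 0)"
proof -
  have eq: "(\<lambda>x. indicator {0..} x *\<^sub>R (if x \<le> b then h x else 0)) = (\<lambda>x. indicator {0..b} x *\<^sub>R h x)"
    by (auto simp: indicator_def)
  have "set_borel_measurable lborel {0..} (\<lambda>x. if x \<le> b then h x else 0)"
    using h unfolding L2_on_def set_borel_measurable_def eq by blast
  moreover have "set_integrable lborel {0..} (\<lambda>x. (if x \<le> b then h x else 0)\<^sup>2)"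
    by (rule set_integrable_extend_0(1)[of b "\<lambda>x. (h x)\<^sup>2"]) (use h in \<open>auto simp: L2_on_def\<close>)
  ultimately show ?thesis by (simp add: L2_on_def)
qed

lemma H1_on_extend_0:
  assumes H: "H1_on {0..b} u du" and u0: "u b = 0" and b: "b \<ge> 0"
  shows "H1_on {0..} (\<lambda>x. if x \<le> b then u x else 0) (\<lambda>x. if x \<le> b then du x else 0)"
proof -
  let ?u = "\<lambda>x. if x \<le> b then u x else 0" and ?d = "\<lambda>x. if x \<le> b then du x else 0"
  have L: "L2_on {0..b} u" "L2_on {0..b} du" using H unfolding H1_on_def by blast+
  have A: "set_integrable lborel {0..x} du" "u x = u 0 + (LINT t:{0..x}|lborel. du t)" if "x \<in> {0..b}" for x
    using H that unfolding H1_on_def by blast+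
  have "set_integrable lborel {0..x} ?d \<and> ?u x = ?u 0 + (LINT t:{0..x}|lborel. ?d t)" if x: "x \<in> {0..}" for x
  proof (cases "x \<le> b")
    case True
    then have xb: "x \<in> {0..b}" using x by auto
    have "set_integrable lborel {0..x} ?d" "(LINT t:{0..x}|lborel. ?d t) = (LINT t:{0..x}|lborel. du t)"
      using A(1)[OF xb] True unfolding set_integrable_def set_lebesgue_integral_def
      by (auto cong: integrable_cong integral_cong simp: indicator_def if_distrib intro!: Bochner_Integration.integral_cong
            elim!: Bochner_Integration.integrable_cong[THEN iffD1, rotated 2])
    then show ?thesis using A(2)[OF xb] True b by simp
  next
    case False
    have bb: "b \<in> {0..b}" using b by auto
    have "set_integrable lborel {0..x} ?d" "(LINT t:{0..x}|lborel. ?d t) = integral {0..b} du"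
      by (rule set_integrable_extend_0[OF A(1)[OF bb]]; use False in auto)+
    moreover have "0 = u 0 + integral {0..b} du"
      using A(2)[OF bb] set_borel_integral_eq_integral(2)[OF A(1)[OF bb]] u0 by simp
    ultimately show ?thesis using False b by simp
  qed
  then show ?thesis unfolding H1_on_def using L2_on_extend_0[OF L(1)] L2_on_extend_0[OF L(2)] by blast
qed

lemma H1_on_add_cmult:
  assumes U: "H1_on I u du" and V: "H1_on I v dv"
  shows "H1_on I (\<lambda>x. u x + c * v x) (\<lambda>x. du x + c * dv x)"
proof -
  have L: "L2_on I u" "L2_on I du" "L2_on I v" "L2_on I dv" using U V unfolding H1_on_def by blast+
  have "set_integrable lborel {0..x} (\<lambda>x. du x + c * dv x) \<and>
     u x + c * v x = u 0 + c * v 0 + (LINT t:{0..x}|lborel. du t + c * dv t)" if "x \<in> I" for x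
  proof -
    have s: "set_integrable lborel {0..x} du" "set_integrable lborel {0..x} (\<lambda>x. c * dv x)"
      using U V that unfolding H1_on_def by (auto intro: set_integrable_mult_right)
    have e: "u x = u 0 + (LINT t:{0..x}|lborel. du t)" "v x = v 0 + (LINT t:{0..x}|lborel. dv t)"
      using U V that unfolding H1_on_def by blast+
    have "(LINT t:{0..x}|lborel. du t + c * dv t) = (LINT t:{0..x}|lborel. du t) + c * (LINT t:{0..x}|lborel. dv t)"
      by (simp add: set_integral_add(2)[OF s])
    then show ?thesis using set_integral_add(1)[OF s] by (subst e(1), subst e(2)) (simp add: algebra_simps)
  qed
  then show ?thesis unfolding H1_on_def using L by (intro conjI L2_on_add L2_on_cmult ballI) auto
qed

context nls
begin

text \<open>Du Bois-Reymond: with \<open>V\<close> the primitive of \<open>f u\<close>, the test function is the primitive of the deviation of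
  \<open>du - V\<close> from its mean over \<open>[0, b]\<close>.\<close>
lemma halfline_first_integral:
  assumes H: "H1_on {0..} u du"
    and W: "\<And>\<eta> d\<eta>. H1_on {0..} \<eta> d\<eta> \<Longrightarrow> \<eta> 0 = 0 \<Longrightarrow>
      weak {0..} u du \<eta> d\<eta> = 0"
    and b: "b > 0"
  shows "\<exists>k. \<forall>x\<in>{0..b}. u x = u 0 + k * x + integral {0..x} (\<lambda>s. integral {0..s} (\<lambda>t. f (u t)))"
proof -
  let ?h = "\<lambda>t. f (u t)"
  let ?V = "\<lambda>s. integral {0..s} ?h"
  note hk = set_borel_integral_eq_integral(1)
  have ac: "ac_on 0 b u du" using H1_on_ac_on[OF H] by auto
  have cu: "continuous_on {0..b} u" by (rule ac_on_continuous[OF ac])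
  have ch: "continuous_on {0..b} ?h" by (rule continuous_on_compose2[OF f_continuous[of UNIV] cu]) auto
  have Vd: "(?V has_real_derivative ?h t) (at t within {0..b})" if "t \<in> {0..b}" for t
    by (rule integral_has_real_derivative[OF ch that])
  have acV: "ac_on 0 b ?V ?h" by (rule ac_on_deriv[OF Vd ch])
  have cV: "continuous_on {0..b} ?V" by (rule ac_on_continuous[OF acV])
  have Ld: "L2_on {0..b} du" by (rule L2_on_subset[of "{0..}"]) (use H in \<open>auto simp: H1_on_def\<close>)
  define g where "g x = du x + (-1) * ?V x" for x
  have Lg: "L2_on {0..b} g" unfolding g_def by (intro L2_on_add L2_on_cmult Ld L2_on_continuous cV)
  define k where "k = integral {0..b} g / b"
  define w where "w x = g x + (- k)" for x
  have Lw: "L2_on {0..b} w" unfolding w_def by (intro L2_on_add Lg L2_on_continuous continuous_on_const)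
  have wi: "set_integrable lborel {0..b} w" by (rule L2_on_interval_integrable[OF Lw])
  have gi: "set_integrable lborel {0..b} g" by (rule L2_on_interval_integrable[OF Lg])
  define e where "e x = integral {0..x} w" for x
  have e0: "e 0 = 0" by (simp add: e_def)
  have ace: "ac_on 0 b e w" unfolding ac_on_def using wi by (simp add: e_def)
  have "e b = integral {0..b} g + integral {0..b} (\<lambda>x. - k)" unfolding e_def w_def
    by (intro Henstock_Kurzweil_Integration.integral_add hk gi integrable_const_ivl)
  then have eb: "e b = 0" using b by (simp add: k_def)
  let ?e = "\<lambda>x. if x \<le> b then e x else 0" and ?w = "\<lambda>x. if x \<le> b then w x else 0"
  have He: "H1_on {0..} ?e ?w"
    using H1_on_of_ac_on[OF ace Lw] eb b by (intro H1_on_extend_0) auto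
  have hei: "set_integrable lborel {0..b} (\<lambda>x. du x * w x + ?h x * e x)"
    by (intro set_integral_add L2_on_mult Ld Lw L2_on_continuous ch ac_on_continuous[OF ace])
  have "(LINT x:{0..}|lborel. du x * ?w x + u x * ?e x - \<bar>u x\<bar> powr (p - 2) * u x * ?e x)
      = integral {0..b} (\<lambda>x. du x * w x + ?h x * e x)"
    by (rule set_integrable_extend_0(2)[OF hei]) (use b in \<open>auto simp: f_def algebra_simps\<close>)
  then have 1: "integral {0..b} (\<lambda>x. du x * w x + ?h x * e x) = 0"
    using W[OF He] e0 b by simp
  have "integral {0..b} (\<lambda>t. ?V t * w t + e t * ?h t) = ?V b * e b - ?V 0 * e 0"
    by (rule ac_on_integral_mult[OF less_imp_le[OF b] acV ace])
  then have 2: "integral {0..b} (\<lambda>t. ?V t * w t + e t * ?h t) = 0" using eb e0 by simp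
  have Vei: "set_integrable lborel {0..b} (\<lambda>x. ?V x * w x + e x * ?h x)"
    by (intro set_integral_add L2_on_mult Lw L2_on_continuous ch cV ac_on_continuous[OF ace])
  \<comment> \<open>The weak equation minus integration by parts for \<open>?V * e\<close> leaves
    the integral of \<open>w^2 + k * w\<close>; the linear term drops out because the integral of
    \<open>w\<close> is \<open>e b = 0\<close>.\<close>
  have "integral {0..b} (\<lambda>x. (du x * w x + ?h x * e x) - (?V x * w x + e x * ?h x)) = 0"
    using 1 2 by (subst Henstock_Kurzweil_Integration.integral_diff[OF hk[OF hei] hk[OF Vei]]) simp
  moreover have "(du x * w x + ?h x * e x) - (?V x * w x + e x * ?h x) = (w x)\<^sup>2 + k * w x" for x
    by (simp add: w_def g_def power2_eq_square algebra_simps)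
  ultimately have 3: "integral {0..b} (\<lambda>x. (w x)\<^sup>2 + k * w x) = 0" by simp
  have w2i: "set_integrable lborel {0..b} (\<lambda>x. (w x)\<^sup>2)" using Lw by (simp add: L2_on_def)
  have "integral {0..b} (\<lambda>x. (w x)\<^sup>2 + k * w x) = integral {0..b} (\<lambda>x. (w x)\<^sup>2) + integral {0..b} (\<lambda>x. k * w x)"
    by (intro Henstock_Kurzweil_Integration.integral_add hk w2i set_integrable_mult_right impI wi)
  then have 4: "integral {0..b} (\<lambda>x. (w x)\<^sup>2) = 0" using 3 eb by (simp add: e_def)
  \<comment> \<open>The integral of \<open>w^2\<close> is 0, and what is needed is that the
    primitive of \<open>w\<close> vanishes. The inequality
    \<open>|w| \<le> \<delta> + w^2 / \<delta>\<close> bounds this primitive by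
    \<open>\<delta> * b\<close>.\<close>
  have ez: "e x = 0" if x: "x \<in> {0..b}" for x
  proof -
    have "\<bar>e x\<bar> \<le> 0 + \<epsilon>" if \<epsilon>: "\<epsilon> > 0" for \<epsilon>
    proof -
      define \<delta> where "\<delta> = \<epsilon> / b"
      have \<delta>: "\<delta> > 0" using \<epsilon> b by (simp add: \<delta>_def)
      have bi: "set_integrable lborel {0..b} (\<lambda>t. \<delta> + (w t)\<^sup>2 / \<delta>)"
        by (intro set_integral_add set_integrable_divide w2i impI borel_integrable_atLeastAtMost' continuous_on_const)
      have sub: "{0..x} \<subseteq> {0..b}" using x by auto
      have bix: "set_integrable lborel {0..x} (\<lambda>t. \<delta> + (w t)\<^sup>2 / \<delta>)"
        by (rule set_integrable_subset[OF bi _ sub]) simp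
      have "\<bar>e x\<bar> \<le> integral {0..x} (\<lambda>t. \<delta> + (w t)\<^sup>2 / \<delta>)" unfolding e_def
      proof (rule set_integrable_abs_le_imp[OF set_integrable_subset[OF wi _ sub] bix])
        fix t
        have "2 * \<delta> * \<bar>w t\<bar> \<le> \<delta>\<^sup>2 + (w t)\<^sup>2" using sum_squares_bound[of \<delta> "\<bar>w t\<bar>"] by simp
        moreover have "\<delta> * \<bar>w t\<bar> \<ge> 0" using \<delta> by simp
        ultimately have "\<delta> * \<bar>w t\<bar> \<le> \<delta>\<^sup>2 + (w t)\<^sup>2" by linarith
        then show "\<bar>w t\<bar> \<le> \<delta> + (w t)\<^sup>2 / \<delta>" using \<delta> by (simp add: field_simps power2_eq_square)
      qed simp
      also have "\<dots> \<le> integral {0..b} (\<lambda>t. \<delta> + (w t)\<^sup>2 / \<delta>)"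
        by (rule integral_subset_le[OF sub hk[OF bix] hk[OF bi]]) (use \<delta> in auto)
      also have "\<dots> = integral {0..b} (\<lambda>t. \<delta>) + integral {0..b} (\<lambda>t. (w t)\<^sup>2 / \<delta>)"
        by (intro Henstock_Kurzweil_Integration.integral_add hk set_integrable_divide w2i impI integrable_const_ivl)
      also have "\<dots> = \<epsilon>" using 4 b by (simp add: \<delta>_def)
      finally show ?thesis by simp
    qed
    then have "\<bar>e x\<bar> \<le> 0" by (rule field_le_epsilon)
    then show ?thesis by simp
  qed
  have "u x = u 0 + k * x + integral {0..x} ?V" if x: "x \<in> {0..b}" for x
  proof -
    have sub: "{0..x} \<subseteq> {0..b}" using x by auto
    have wix: "set_integrable lborel {0..x} w" by (rule set_integrable_subset[OF wi _ sub]) simp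
    have cVx: "continuous_on {0..x} ?V" by (rule continuous_on_subset[OF cV sub])
    have "u x - u 0 = integral {0..x} du" using x by (intro ac_on_diff[OF ac]) auto
    also have "du = (\<lambda>t. w t + (k + ?V t))" by (auto simp: w_def g_def)
    also have "integral {0..x} (\<lambda>t. w t + (k + ?V t)) = integral {0..x} w + integral {0..x} (\<lambda>t. k + ?V t)"
      by (intro Henstock_Kurzweil_Integration.integral_add hk wix integrable_continuous_real continuous_intros cVx)
    also have "integral {0..x} (\<lambda>t. k + ?V t) = integral {0..x} (\<lambda>t. k) + integral {0..x} ?V"
      by (intro Henstock_Kurzweil_Integration.integral_add integrable_continuous_real continuous_intros cVx)
    finally show ?thesis using ez[OF x] x by (simp add: e_def mult.commute)
  qed
  then show ?thesis by blast
qed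

text \<open>Here \<open>k\<close> is the derivative of \<open>u\<close> at the vertex. The energy of
  the orbit is constant and tends to 0 along a sequence, so it vanishes; this gives \<open>k\<close>
  up to sign, and it also bounds the derivative by \<open>|u|\<close>, so an orbit starting at 0
  stays there. The formula for the defect is the boundary term that appears when \<open>u\<close>,
  corrected to vanish at the vertex, is used as test function.\<close>

lemma halfline_regularity:
  assumes H: "H1_on {0..} u du"
    and W: "\<And>\<eta> d\<eta>. H1_on {0..} \<eta> d\<eta> \<Longrightarrow> \<eta> 0 = 0 \<Longrightarrow>
      weak {0..} u du \<eta> d\<eta> = 0"
  obtains k where "k\<^sup>2 = F (u 0)"
    "E1 {0..} u du - Ep {0..} u = - (u 0 * k)"
    "u 0 = 0 \<Longrightarrow> (\<forall>x\<ge>0. u x = 0)"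
proof -
  let ?h = "\<lambda>t. f (u t)"
  let ?V = "\<lambda>s. integral {0..s} ?h"
  let ?W = "\<lambda>x. integral {0..x} ?V"
  note hk = set_borel_integral_eq_integral(1)
  have ac: "ac_on 0 b u du" for b using H1_on_ac_on[OF H] by auto
  have cu: "continuous_on {0..b} u" for b by (rule ac_on_continuous[OF ac])
  have ch: "continuous_on {0..b} ?h" for b by (rule continuous_on_compose2[OF f_continuous[of UNIV] cu]) auto
  have Vd: "(?V has_real_derivative ?h t) (at t within {0..b})" if "t \<in> {0..b}" for t b
    by (rule integral_has_real_derivative[OF ch that])
  have acV: "ac_on 0 b ?V ?h" for b by (rule ac_on_deriv[OF Vd ch])
  have cV: "continuous_on {0..b} ?V" for b by (rule ac_on_continuous[OF acV])
  obtain k where k1: "\<forall>x\<in>{0..1}. u x = u 0 + k * x + ?W x"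
    using halfline_first_integral[OF H W, of 1] by auto
  \<comment> \<open>The slope obtained on each bounded interval is the same, as evaluation at 1
    shows.\<close>
  have k: "u x = u 0 + k * x + ?W x" if x: "x \<ge> 0" for x
  proof -
    have max_pos: "0 < max 1 x" by simp
    obtain k' where k': "\<forall>y\<in>{0..max 1 x}. u y = u 0 + k' * y + ?W y"
      using halfline_first_integral[OF H W max_pos] by blast
    have "u 1 = u 0 + k * 1 + ?W 1" by (rule bspec[OF k1]) simp
    moreover have "u 1 = u 0 + k' * 1 + ?W 1" by (rule bspec[OF k']) simp
    ultimately have "k = k'" by simp
    then show ?thesis using bspec[OF k', of x] x by simp
  qed
  define w where "w x = k + ?V x" for x
  have wd: "(w has_real_derivative ?h t) (at t within {0..b})" if "t \<in> {0..b}" for t b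
    unfolding w_def using Vd[OF that] by (auto intro!: derivative_eq_intros)
  have ud: "(u has_real_derivative w t) (at t within {0..b})" if t: "t \<in> {0..b}" for t b
  proof -
    have "(?W has_real_derivative ?V t) (at t within {0..b})" by (rule integral_has_real_derivative[OF cV t])
    then have "((\<lambda>x. u 0 + k * x + ?W x) has_real_derivative w t) (at t within {0..b})"
      unfolding w_def by (auto intro!: derivative_eq_intros)
    then show ?thesis
      by (rule has_field_derivative_transform_within[OF _ zero_less_one t]) (metis atLeastAtMost_iff k)
  qed
  have Fd: "((\<lambda>x. F (u x)) has_real_derivative 2 * ?h t * w t) (at t within {0..b})" if t: "t \<in> {0..b}" for t b
    using DERIV_chain2[OF F_deriv ud[OF t]] by simp
  have energy: "(w x)\<^sup>2 - F (u x) = k\<^sup>2 - F (u 0)" if x: "x \<ge> 0" for x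
  proof -
    have "((\<lambda>x. (w x)\<^sup>2 - F (u x)) has_real_derivative 0) (at t within {0..x})" if t: "t \<in> {0..x}" for t
      by (rule derivative_eq_intros wd[OF t] Fd[OF t] refl)+ simp
    then have "\<exists>c. \<forall>t\<in>{0..x}. (w t)\<^sup>2 - F (u t) = c"
      by (intro has_field_derivative_zero_constant) auto
    then obtain c where c: "\<And>t. t \<in> {0..x} \<Longrightarrow> (w t)\<^sup>2 - F (u t) = c" by auto
    have "w 0 = k" by (simp add: w_def)
    then show ?thesis using c[of 0] c[of x] x by simp
  qed
  have lim: "(u \<longlongrightarrow> 0) at_top" by (rule H1_on_halfline_tendsto_0[OF H])
  \<comment> \<open>Mean value points in consecutive unit intervals give a sequence along which both
    \<open>u\<close> and its derivative \<open>w\<close> tend to 0; since the energy is constant,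
    one sequence is enough.\<close>
  have "\<exists>z\<in>{real n<..<real n + 1}. u (real n + 1) - u (real n) = w z * (real n + 1 - real n)" for n
  proof (rule mvt_simple)
    fix x assume x: "real n \<le> x" "x \<le> real n + 1"
    have "(u has_real_derivative w x) (at x within {0..real n + 1})" using x by (intro ud) auto
    then have "(u has_real_derivative w x) (at x within {real n..real n + 1})"
      by (rule DERIV_subset) auto
    then show "(u has_derivative (*) (w x)) (at x within {real n..real n + 1})"
      by (simp add: has_field_derivative_def)
  qed simp
  then have "\<forall>n. \<exists>z. real n < z \<and> u (real n + 1) - u (real n) = w z" by fastforce
  then obtain z where z: "\<And>n. real n < z n" "\<And>n. u (real n + 1) - u (real n) = w (z n)" by metis
  have zt: "filterlim z at_top sequentially"
    by (rule filterlim_at_top_mono[OF filterlim_real_sequentially]) (simp add: z(1) less_imp_le)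
  have uz: "(\<lambda>n. u (z n)) \<longlonglongrightarrow> 0" by (rule filterlim_compose[OF lim zt])
  have "(\<lambda>n. u (real n + 1)) \<longlonglongrightarrow> 0"
    by (rule filterlim_compose[OF lim])
      (subst add.commute, rule filterlim_tendsto_add_at_top[OF tendsto_const filterlim_real_sequentially])
  moreover have "(\<lambda>n. u (real n)) \<longlonglongrightarrow> 0" by (rule filterlim_compose[OF lim filterlim_real_sequentially])
  ultimately have "(\<lambda>n. u (real n + 1) - u (real n)) \<longlonglongrightarrow> 0 - 0" by (rule tendsto_diff)
  then have wz: "(\<lambda>n. w (z n)) \<longlonglongrightarrow> 0" unfolding z(2) by simp
  have "(\<lambda>n. F (u (z n))) \<longlonglongrightarrow> F 0"
    by (rule continuous_on_tendsto_compose[OF F_continuous[of UNIV] uz]) auto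
  then have "(\<lambda>n. (w (z n))\<^sup>2 - F (u (z n))) \<longlonglongrightarrow> 0\<^sup>2 - F 0" by (intro tendsto_intros wz)
  moreover have "(w (z n))\<^sup>2 - F (u (z n)) = k\<^sup>2 - F (u 0)" for n
    by (rule energy) (use z(1)[of n] in linarith)
  ultimately have e0: "k\<^sup>2 - F (u 0) = 0" by (simp add: LIMSEQ_const_iff)
  then have kF: "k\<^sup>2 = F (u 0)" by simp
  have wu: "\<bar>w x\<bar> \<le> \<bar>u x\<bar>" if "x \<ge> 0" for x
  proof -
    have "(w x)\<^sup>2 \<le> (u x)\<^sup>2" using energy[OF that] e0 F_le_square[of "u x"] by linarith
    then show ?thesis by (simp add: abs_le_square_iff)
  qed
  \<comment> \<open>Gronwall: \<open>|w| \<le> |u|\<close> makes \<open>u^2 * exp (- 2 * x)\<close>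
    nonincreasing.\<close>
  have zero: "u x = 0" if u0: "u 0 = 0" and x: "x \<ge> 0" for x
  proof -
    have "(u x)\<^sup>2 * exp (- 2 * x) \<le> (u 0)\<^sup>2 * exp (- 2 * 0)"
    proof (rule has_real_derivative_nonpos_imp_le[OF x])
      fix t assume t: "t \<in> {0..x}"
      show "((\<lambda>x. (u x)\<^sup>2 * exp (- 2 * x)) has_real_derivative
          (2 * (u t * w t) - 2 * (u t)\<^sup>2) * exp (- 2 * t)) (at t within {0..x})"
        by (rule derivative_eq_intros ud[OF t] refl)+ (simp add: algebra_simps power2_eq_square)
      have "u t * w t \<le> \<bar>u t\<bar> * \<bar>w t\<bar>" by (metis abs_ge_self abs_mult)
      also have "\<dots> \<le> \<bar>u t\<bar> * \<bar>u t\<bar>" using wu[of t] t by (intro mult_left_mono) auto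
      finally show "(2 * (u t * w t) - 2 * (u t)\<^sup>2) * exp (- 2 * t) \<le> 0"
        by (intro mult_nonpos_nonneg) (auto simp: power2_eq_square)
    qed
    then have "(u x)\<^sup>2 * exp (- 2 * x) \<le> 0" using u0 by simp
    then show ?thesis by (simp add: mult_le_0_iff)
  qed
  define v where "v = u 0"
  \<comment> \<open>The hat function \<open>?z\<close> has value 1 at the vertex, so
    \<open>u - v * ?z\<close> is an admissible test function. Pairing the equation with
    \<open>?z\<close> itself produces the boundary term \<open>- k\<close>.\<close>
  have z1: "ac_on 0 1 (\<lambda>x. 1 - x) (\<lambda>x. - 1)"
    by (rule ac_on_deriv) (auto intro!: derivative_eq_intros)
  let ?z = "\<lambda>x::real. if x \<le> 1 then 1 - x else 0" and ?dz = "\<lambda>x::real. if x \<le> 1 then - 1 else (0::real)"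
  have Hz: "H1_on {0..} ?z ?dz"
    by (rule H1_on_extend_0[OF H1_on_of_ac_on[OF z1 L2_on_continuous]]) auto
  have He: "H1_on {0..} (\<lambda>x. u x + (- v) * ?z x) (\<lambda>x. du x + (- v) * ?dz x)"
    by (rule H1_on_add_cmult[OF H Hz])
  obtain M where M: "\<And>x. x \<in> {0..} \<Longrightarrow> \<bar>u x\<bar> \<le> M" using H1_on_bounded[OF H] by blast
  have Ld: "L2_on {0..} du" and Lu: "L2_on {0..} u" using H unfolding H1_on_def by blast+
  have Ai: "set_integrable lborel {0..} (\<lambda>x. (du x)\<^sup>2 + (u x)\<^sup>2)"
    using Ld Lu by (intro set_integral_add) (auto simp: L2_on_def)
  have Bi: "set_integrable lborel {0..} (\<lambda>x. \<bar>u x\<bar> powr p)" by (rule abs_powr_p_integrable[OF Lu M])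
  have Ci0: "set_integrable lborel {0..1} (\<lambda>x. du x * (- 1) + ?h x * (1 - x))"
    by (intro set_integral_add L2_on_mult L2_on_continuous ch continuous_intros L2_on_subset[OF Ld]) auto
  have Ci: "set_integrable lborel {0..} (\<lambda>x. du x * ?dz x + ?h x * ?z x)"
     and Cv: "(LINT x:{0..}|lborel. du x * ?dz x + ?h x * ?z x) = integral {0..1} (\<lambda>x. du x * (- 1) + ?h x * (1 - x))"
    by (rule set_integrable_extend_0[OF Ci0]; auto)+
  have hi: "set_integrable lborel {0..1} ?h" by (rule borel_integrable_atLeastAtMost'[OF ch])
  have dui: "set_integrable lborel {0..1} du" using ac[of 1] by (simp add: ac_on_def)
  have h1i: "set_integrable lborel {0..1} (\<lambda>x. ?h x * (1 - x))"
    by (intro L2_on_mult L2_on_continuous ch continuous_intros)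
  have "integral {0..1} (\<lambda>x. du x * (- 1) + ?h x * (1 - x)) = integral {0..1} (\<lambda>x. du x * (- 1)) + integral {0..1} (\<lambda>x. ?h x * (1 - x))"
    by (intro Henstock_Kurzweil_Integration.integral_add hk set_integrable_mult_left impI dui h1i)
  also have "integral {0..1} (\<lambda>x. du x * (- 1)) = - (u 1 - u 0)"
    using ac_on_diff[OF ac[of 1], of 0 1] by simp
  also have "u 1 - u 0 = k + ?W 1" using k[of 1] by simp
  also have "integral {0..1} (\<lambda>x. ?h x * (1 - x)) = ?W 1"
  proof -
    have "integral {0..1} (\<lambda>t. ?V t * (- 1) + (1 - t) * ?h t) = ?V 1 * (1 - 1) - ?V 0 * (1 - 0)"
      by (rule ac_on_integral_mult[OF zero_le_one acV z1])
    then have "integral {0..1} (\<lambda>t. ?V t * (- 1) + (1 - t) * ?h t) = 0" by simp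
    moreover have "integral {0..1} (\<lambda>t. ?V t * (- 1) + (1 - t) * ?h t)
        = integral {0..1} (\<lambda>t. ?V t * (- 1)) + integral {0..1} (\<lambda>t. (1 - t) * ?h t)"
      by (intro Henstock_Kurzweil_Integration.integral_add integrable_continuous_real continuous_intros cV ch)
    ultimately show ?thesis by (simp add: mult.commute)
  qed
  finally have C: "(LINT x:{0..}|lborel. du x * ?dz x + ?h x * ?z x) = - k" unfolding Cv by simp
  have "(LINT x:{0..}|lborel. du x * (du x + (- v) * ?dz x) + u x * (u x + (- v) * ?z x)
      - \<bar>u x\<bar> powr (p - 2) * u x * (u x + (- v) * ?z x)) = 0"
    by (rule W[OF He]) (simp add: v_def)
  also have "(\<lambda>x. du x * (du x + (- v) * ?dz x) + u x * (u x + (- v) * ?z x)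
      - \<bar>u x\<bar> powr (p - 2) * u x * (u x + (- v) * ?z x)) =
     (\<lambda>x. (((du x)\<^sup>2 + (u x)\<^sup>2) - \<bar>u x\<bar> powr p) + (- v) * (du x * ?dz x + ?h x * ?z x))"
    unfolding f_def powr_p power2_eq_square by (rule ext) (simp only: algebra_simps)
  also have "(LINT x:{0..}|lborel. (((du x)\<^sup>2 + (u x)\<^sup>2) - \<bar>u x\<bar> powr p) + (- v) * (du x * ?dz x + ?h x * ?z x))
     = (LINT x:{0..}|lborel. ((du x)\<^sup>2 + (u x)\<^sup>2) - \<bar>u x\<bar> powr p) + (LINT x:{0..}|lborel. (- v) * (du x * ?dz x + ?h x * ?z x))"
    by (intro set_integral_add(2) set_integral_diff(1) Ai Bi set_integrable_mult_right impI Ci)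
  also have "(LINT x:{0..}|lborel. ((du x)\<^sup>2 + (u x)\<^sup>2) - \<bar>u x\<bar> powr p) =
     E1 {0..} u du - Ep {0..} u"
    unfolding E1_def Ep_def by (rule set_integral_diff(2)[OF Ai Bi])
  also have "(LINT x:{0..}|lborel. (- v) * (du x * ?dz x + ?h x * ?z x)) = v * k"
    by (subst set_integral_mult_right) (simp add: C)
  finally show ?thesis using kF zero by (intro that[of k]) (auto simp: v_def)
qed

end

section \<open>Core-symmetric bound states\<close>

text \<open>The derivative component is kept: core symmetry identifies the values on the edges, not
  the stored derivatives.\<close>

lemma H1_on_cong:
  assumes "H1_on I u du" and eq: "\<And>x. x \<in> I \<Longrightarrow> v x = u x" and "0 \<in> I"
  shows "H1_on I v du"
proof -
  have i: "(\<lambda>x. indicator I x *\<^sub>R v x) = (\<lambda>x. indicator I x *\<^sub>R u x)"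
    "(\<lambda>x. indicator I x *\<^sub>R (v x)\<^sup>2) = (\<lambda>x. indicator I x *\<^sub>R (u x)\<^sup>2)"
    using eq by (auto simp: indicator_def)
  have "L2_on I v" using assms(1) unfolding H1_on_def L2_on_def set_borel_measurable_def set_integrable_def i by blast
  moreover have "\<forall>x\<in>I. set_integrable lborel {0..x} du \<and> v x = v 0 + (LINT t:{0..x}|lborel. du t)"
    using assms(1) eq \<open>0 \<in> I\<close> unfolding H1_on_def by metis
  ultimately show ?thesis using assms(1) unfolding H1_on_def by blast
qed

lemma H1_on_zero: "H1_on I (\<lambda>x. 0) (\<lambda>x. 0)"
  by (simp add: H1_on_def L2_on_def set_borel_measurable_def set_integrable_def set_lebesgue_integral_def)

context nls
begin

lemma action_sum:
  "action H P L l p u =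
     (\<Sum>i<H. E1 {0..} (hl u i) (dhl u i) / 2 - Ep {0..} (hl u i) / p) +
     (\<Sum>j<P + 2*L. E1 {0..l} (ce u j) (dce u j) / 2 - Ep {0..l} (ce u j) / p)"
  unfolding action_def gint_def E1_def Ep_def sum_subtractf sum_divide_distrib[symmetric]
  by argo

lemma E1_nonneg: "E1 I u du \<ge> 0"
  unfolding E1_def set_lebesgue_integral_def by (intro Bochner_Integration.integral_nonneg) auto

lemma in_H1_halfline:
  assumes "in_H1 H P L l u" "i < H"
  shows "H1_on {0..} (hl u i) (dhl u i)" "hl u i 0 = hl u 0 0"
  using assms unfolding in_H1_def by blast+

lemma in_H1_edge:
  assumes "in_H1 H P L l u" "j < P + 2 * L"
  shows "H1_on {0..l} (ce u j) (dce u j)" "ce u j 0 = hl u 0 0"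
  using assms unfolding in_H1_def by blast+

lemma weak_form_self:
  assumes H: "H1_on I u du" and I: "I = {0..} \<or> I = {0..l}"
  shows "weak I u du u du = E1 I u du - Ep I u"
proof -
  obtain M where M: "\<And>x. x \<in> I \<Longrightarrow> \<bar>u x\<bar> \<le> M" using H1_on_bounded[OF H I] by blast
  have Ld: "L2_on I du" and Lu: "L2_on I u" using H unfolding H1_on_def by blast+
  have Ai: "set_integrable lborel I (\<lambda>x. (du x)\<^sup>2 + (u x)\<^sup>2)"
    using Ld Lu by (intro set_integral_add) (auto simp: L2_on_def)
  have Bi: "set_integrable lborel I (\<lambda>x. \<bar>u x\<bar> powr p)" by (rule abs_powr_p_integrable[OF Lu M])
  have "(\<lambda>x. du x * du x + u x * u x - \<bar>u x\<bar> powr (p - 2) * u x * u x)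
      = (\<lambda>x. ((du x)\<^sup>2 + (u x)\<^sup>2) - \<bar>u x\<bar> powr p)"
    by (simp add: powr_p power2_eq_square mult.assoc)
  then show ?thesis unfolding E1_def Ep_def using set_integral_diff(2)[OF Ai Bi] by simp
qed

lemma bound_state_iff:
  "bound_state H P L l p u \<longleftrightarrow> in_H1 H P L l u \<and> nontrivial H P L l u \<and>
    (\<forall>\<eta>. in_H1 H P L l \<eta> \<longrightarrow> (\<Sum>i<H. weak {0..} (hl u i) (dhl u i) (hl \<eta> i) (dhl \<eta> i)) +
       (\<Sum>j<P + 2*L. weak {0..l} (ce u j) (dce u j) (ce \<eta> j) (dce \<eta> j)) = 0)"
  unfolding bound_state_def gint_def ..

lemma bound_state_nehari:
  assumes bs: "bound_state H P L l p u"
  shows "(\<Sum>i<H. E1 {0..} (hl u i) (dhl u i) - Ep {0..} (hl u i)) +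
     (\<Sum>j<P + 2*L. E1 {0..l} (ce u j) (dce u j) - Ep {0..l} (ce u j)) = 0"
proof -
  have u: "in_H1 H P L l u" using bs by (simp add: bound_state_def)
  then have "(\<Sum>i<H. weak {0..} (hl u i) (dhl u i) (hl u i) (dhl u i)) +
      (\<Sum>j<P + 2*L. weak {0..l} (ce u j) (dce u j) (ce u j) (dce u j)) = 0"
    using bs unfolding bound_state_iff by blast
  moreover have "weak {0..} (hl u i) (dhl u i) (hl u i) (dhl u i)
     = E1 {0..} (hl u i) (dhl u i) - Ep {0..} (hl u i)" if "i < H" for i
    by (rule weak_form_self) (use in_H1_halfline[OF u that] in auto)
  moreover have "weak {0..l} (ce u j) (dce u j) (ce u j) (dce u j)
     = E1 {0..l} (ce u j) (dce u j) - Ep {0..l} (ce u j)" if "j < P + 2 * L" for j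
    by (rule weak_form_self) (use in_H1_edge[OF u that] in auto)
  ultimately show ?thesis by simp
qed

lemma bound_state_action:
  assumes bs: "bound_state H P L l p u"
  shows "action H P L l p u = (1/2 - 1/p) * ((\<Sum>i<H. E1 {0..} (hl u i) (dhl u i)) +
     (\<Sum>j<P + 2*L. E1 {0..l} (ce u j) (dce u j)))"
proof -
  have "(\<Sum>i<H. Ep {0..} (hl u i)) + (\<Sum>j<P + 2*L. Ep {0..l} (ce u j)) =
     (\<Sum>i<H. E1 {0..} (hl u i) (dhl u i)) + (\<Sum>j<P + 2*L. E1 {0..l} (ce u j) (dce u j))"
    using bound_state_nehari[OF bs] by (simp add: sum_subtractf)
  then have "((\<Sum>i<H. Ep {0..} (hl u i)) + (\<Sum>j<P + 2*L. Ep {0..l} (ce u j))) / p =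
     ((\<Sum>i<H. E1 {0..} (hl u i) (dhl u i)) + (\<Sum>j<P + 2*L. E1 {0..l} (ce u j) (dce u j))) / p" by simp
  then show ?thesis unfolding action_sum
    by (simp add: sum_subtractf sum_divide_distrib[symmetric] add_divide_distrib algebra_simps)
qed

text \<open>A test function on one half-line that vanishes at the vertex extends by zero to the
  graph. Only the square of \<open>k\<close> is common to all half-lines; its sign may depend on
  \<open>i\<close>.\<close>

lemma bound_state_halfline:
  assumes bs: "bound_state H P L l p u" and i: "i < H"
  obtains k where "k\<^sup>2 = F (hl u 0 0)"
    "E1 {0..} (hl u i) (dhl u i) - Ep {0..} (hl u i) = - (hl u 0 0 * k)"
    "hl u 0 0 = 0 \<Longrightarrow> (\<forall>x\<ge>0. hl u i x = 0)"
proof -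
  have u: "in_H1 H P L l u" using bs by (simp add: bound_state_def)
  note Hi = in_H1_halfline(1)[OF u i] and h0 = in_H1_halfline(2)[OF u i]
  have W: "weak {0..} (hl u i) (dhl u i) \<eta> d\<eta> = 0"
    if e: "H1_on {0..} \<eta> d\<eta>" "\<eta> 0 = 0" for \<eta> d\<eta>
  proof -
    define e where "e = \<lparr>hl = (\<lambda>j. if j = i then \<eta> else (\<lambda>x. 0)), dhl = (\<lambda>j. if j = i then d\<eta> else (\<lambda>x. 0)),
       ce = (\<lambda>j x. 0), dce = (\<lambda>j x. 0)\<rparr>"
    have "in_H1 H P L l e" using that H1_on_zero by (auto simp: in_H1_def e_def)
    then have *: "(\<Sum>i<H. weak {0..} (hl u i) (dhl u i) (hl e i) (dhl e i)) +
       (\<Sum>j<P + 2*L. weak {0..l} (ce u j) (dce u j) (ce e j) (dce e j)) = 0"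
      using bs unfolding bound_state_iff by blast
    have 1: "weak {0..l} (ce u j) (dce u j) (ce e j) (dce e j) = 0" for j
      by (simp add: e_def)
    have 2: "weak {0..} (hl u j) (dhl u j) (hl e j) (dhl e j) =
       (if j = i then weak {0..} (hl u i) (dhl u i) \<eta> d\<eta> else 0)" for j
      by (simp add: e_def)
    show ?thesis using * i unfolding 1 2 by simp
  qed
  show ?thesis
  proof (rule halfline_regularity[OF Hi W])
    fix k assume "k\<^sup>2 = F (hl u i 0)" "E1 {0..} (hl u i) (dhl u i) - Ep {0..} (hl u i) = - (hl u i 0 * k)"
      "hl u i 0 = 0 \<Longrightarrow> (\<forall>x\<ge>0. hl u i x = 0)"
    then show ?thesis using that[of k] unfolding h0 by blast
  qed
qed

text \<open>The alternative is the sign of the total defect of the compact edges. If it is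
  nonpositive, the estimate on edges applies; otherwise the total defect of the half-lines is
  negative. The last term of the second bound is what the edges cost through their common vertex
  value.\<close>

lemma core_symmetric_action:
  fixes H P L m :: nat
  assumes bs: "bound_state H P L l p u" and cs: "core_symmetric P L l u"
    and l: "l \<ge> 1" and N: "P + 2 * L \<ge> 1" and m: "m \<le> H" "m = 1 \<or> m = 2"
  shows "(P + 2 * L) * (G mst - G (mst * sqrt (G mst / ((1/2 - 1/p) * l)))) \<le> action H P L l p u \<or>
    m * (2 * G mst - G (mst * \<bar>hl u 0 0\<bar>)) + (1/2 - 1/p) * ((P + 2 * L) * ((hl u 0 0)\<^sup>2 / 2)) \<le> action H P L l p u"
proof -
  define N where "N = P + 2 * L"
  define k where "k = 1/2 - 1/p"
  have k0: "k > 0" using p_gt_2 by (simp add: k_def field_simps)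
  define v where "v = hl u 0 0"
  define c where "c = ce u 0"
  have N1: "N \<ge> 1" using assms by (simp add: N_def)
  have u: "in_H1 H P L l u" using bs by (simp add: bound_state_def)
  have eq: "ce u j x = c x" if "j < N" "x \<in> {0..l}" for j x
    using cs that by (simp add: core_symmetric_def N_def c_def)
  have HE: "H1_on {0..l} c (dce u j)" if "j < N" for j
    by (rule H1_on_cong[of _ "ce u j"]) (use in_H1_edge(1)[OF u] that eq l in \<open>auto simp: N_def\<close>)
  have EE: "E1 {0..l} (ce u j) (dce u j) = E1 {0..l} c (dce u j)" if "j < N" for j
    unfolding E1_def by (rule set_lebesgue_integral_cong) (use eq that in auto)
  have EP: "Ep {0..l} (ce u j) = Ep {0..l} c" if "j < N" for j
    unfolding Ep_def by (rule set_lebesgue_integral_cong) (use eq that in auto)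
  have c0: "c 0 = v" unfolding c_def v_def by (rule in_H1_edge(2)[OF u]) (use N1 in \<open>unfold N_def, linarith\<close>)
  let ?SH = "\<Sum>i<H. E1 {0..} (hl u i) (dhl u i)" and ?SE = "\<Sum>j<N. E1 {0..l} c (dce u j)"
  have act: "action H P L l p u = k * ?SH + k * ?SE"
    unfolding bound_state_action[OF bs] k_def N_def[symmetric] using EE by (simp add: distrib_left)
  have neh: "(\<Sum>i<H. E1 {0..} (hl u i) (dhl u i) - Ep {0..} (hl u i)) + (?SE - N * Ep {0..l} c) = 0"
    using bound_state_nehari[OF bs] EE EP unfolding N_def[symmetric] by (simp add: sum_subtractf)
  have SH0: "?SH \<ge> 0" by (intro sum_nonneg E1_nonneg)
  have Gm: "G (mst * \<bar>v\<bar>) \<le> G mst" using mst_gt_1 by (intro G_le_Gm) auto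
  show ?thesis
  proof (cases "\<exists>x\<in>{0..l}. c x \<noteq> 0")
    \<comment> \<open>Vanishing on the core forces \<open>v = 0\<close> and therefore vanishing on
      the half-lines, against nontriviality.\<close>
    case False
    have v0: "v = 0" using False c0 l by auto
    have "hl u i x = 0" if "i < H" "x \<ge> 0" for i x
      using bound_state_halfline[OF bs that(1)] v0 that(2) unfolding v_def by metis
    moreover have "ce u j x = 0" if "j < N" "x \<in> {0..l}" for j x using eq[OF that] False that by auto
    ultimately have "\<not> nontrivial H P L l u" by (auto simp: nontrivial_def N_def)
    then show ?thesis using bs by (simp add: bound_state_def)
  next
    case True
    then obtain x1 where x1: "x1 \<in> {0..l}" "c x1 \<noteq> 0" by blast
    show ?thesis
    proof (cases "?SE \<le> N * Ep {0..l} c")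
      case True
      have "N * (G mst - G (mst * sqrt (G mst / ((1/2 - 1/p) * l)))) \<le> k * ?SE"
        unfolding k_def by (rule edges_lower_bound[OF _ _ HE _ x1]) (use l N1 True in auto)
      then have "N * (G mst - G (mst * sqrt (G mst / ((1/2 - 1/p) * l)))) \<le> action H P L l p u"
        unfolding act using SH0 k0 by (simp add: add_increasing)
      then show ?thesis by (simp add: N_def)
    next
      case False
      let ?D = "\<lambda>i. E1 {0..} (hl u i) (dhl u i) - Ep {0..} (hl u i)"
      define S where "S = {i. i < H \<and> ?D i < 0}"
      have neg: "(\<Sum>i<H. ?D i) < 0" using neh False by linarith
      define X where "X = \<bar>v\<bar> * sqrt (F v)"
      have DX: "?D i = (if i \<in> S then - X else X)" if i: "i < H" for i
      proof -
        obtain q where q: "q\<^sup>2 = F v" "?D i = - (v * q)" using bound_state_halfline[OF bs i] unfolding v_def by metis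
        have "\<bar>?D i\<bar> = X" unfolding q(2) X_def q(1)[symmetric] by (simp add: abs_mult)
        then show ?thesis using i by (auto simp: S_def)
      qed
      have "(\<Sum>i<H. ?D i) = (\<Sum>i<H. if i \<in> S then - X else X)" using DX by simp
      also have "\<dots> = (\<Sum>i\<in>{..<H} \<inter> S. - X) + (\<Sum>i\<in>{..<H} \<inter> - S. X)"
        by (subst sum.If_cases) (auto simp: Collect_mem_eq)
      also have "{..<H} \<inter> S = S" by (auto simp: S_def)
      also have "{..<H} \<inter> - S = {..<H} - S" by auto
      finally have sumD: "(\<Sum>i<H. ?D i) = X * (real (card ({..<H} - S)) - real (card S))" by (simp add: algebra_simps)
      have fS: "finite S" "S \<subseteq> {..<H}" by (auto simp: S_def)
      have cS: "card ({..<H} - S) + card S = H" using fS by (metis card_Diff_subset card_lessThan card_mono finite_lessThan le_add_diff_inverse2)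
      have "card ({..<H} - S) < card S"
      proof (rule ccontr)
        assume "\<not> ?thesis"
        moreover have "X \<ge> 0"
        proof -
          have "H \<ge> 1" using m by auto
          then obtain q where "q\<^sup>2 = F v" using bound_state_halfline[OF bs, of 0] unfolding v_def by (metis less_eq_Suc_le One_nat_def)
          then have "F v \<ge> 0" by (metis zero_le_power2)
          then show ?thesis by (simp add: X_def)
        qed
        ultimately have "X * (real (card ({..<H} - S)) - real (card S)) \<ge> 0" by (intro mult_nonneg_nonneg) auto
        then show False using neg sumD by linarith
      qed
      \<comment> \<open>The negative half-lines form a strict majority, so
        \<open>2 * card S > H \<ge> m\<close>; for \<open>m = 1\<close> or \<open>m = 2\<close> this
        gives \<open>m \<le> card S\<close>.\<close>
      then have mS: "m \<le> card S" using cS m by auto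
      define q where "q = 2 * G mst - G (mst * \<bar>v\<bar>)"
      have q0: "q \<ge> 0" using Gm G_mst_pos by (simp add: q_def)
      have each: "q \<le> k * E1 {0..} (hl u i) (dhl u i)" if i: "i \<in> S" for i
      proof -
        have iH: "i < H" using i by (simp add: S_def)
        have "hl u i 0 = v" "H1_on {0..} (hl u i) (dhl u i)"
          using in_H1_halfline[OF u iH] by (simp_all only: v_def)
        then show ?thesis using halfline_lower_bound[of "hl u i" "dhl u i"] i
          by (simp add: q_def k_def S_def)
      qed
      have "m * q \<le> card S * q" using mS q0 by (intro mult_right_mono) auto
      also have "\<dots> \<le> (\<Sum>i\<in>S. k * E1 {0..} (hl u i) (dhl u i))"
        using sum_bounded_below[of S q] each by simp
      also have "\<dots> \<le> (\<Sum>i<H. k * E1 {0..} (hl u i) (dhl u i))"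
        using fS k0 E1_nonneg by (intro sum_mono2) auto
      finally have 1: "m * q \<le> k * ?SH" by (simp add: sum_distrib_left)
      have "N * (v\<^sup>2 / 2) \<le> ?SE"
        using sum_bounded_below[of "{..<N}" "v\<^sup>2 / 2" "\<lambda>j. E1 {0..l} c (dce u j)"] edge_norm_ge[OF l HE] c0
        by simp
      then have 2: "k * (N * (v\<^sup>2 / 2)) \<le> k * ?SE" using k0 by (intro mult_left_mono) auto
      have "m * q + k * (N * (v\<^sup>2 / 2)) \<le> action H P L l p u" unfolding act using 1 2 by linarith
      then show ?thesis by (simp add: q_def v_def N_def k_def)
    qed
  qed
qed

lemma G_le_square: "y \<ge> 0 \<Longrightarrow> G y \<le> y\<^sup>2"
proof -
  assume y: "y \<ge> 0"
  have "R r \<le> y" if "0 \<le> r" "r \<le> y" for r using R_le[of r] that by simp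
  then have "G y - G 0 \<le> y * (y - 0)" by (intro G_diff_le y) auto
  then show ?thesis by (simp add: power2_eq_square)
qed

text \<open>With \<open>g = G mst\<close>, the choice of \<open>l1\<close> makes the loss per edge
  at most \<open>g / 4\<close>, so \<open>2 * m\<close> edges cost \<open>3/2 * m * g\<close>, which
  is at least \<open>m * g + g / 2\<close>. The second entry of the minimum defining
  \<open>e\<close> is the edge cost of a vertex value at the threshold of the case distinction
  below.\<close>

lemma core_symmetric_gap:
  fixes H P L m :: nat
  assumes N: "2 * m \<le> P + 2 * L" and m: "m \<le> H" "m = 1 \<or> m = 2"
  obtains \<epsilon> l1 :: real where "\<epsilon> > 0" "l1 \<ge> 1" "\<And>l u. l \<ge> l1 \<Longrightarrow> bound_state H P L l p u \<Longrightarrow> core_symmetric P L l u \<Longrightarrow>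
    m * G mst + \<epsilon> \<le> action H P L l p u"
proof -
  define k where "k = 1/2 - 1/p"
  have k0: "k > 0" using p_gt_2 by (simp add: k_def field_simps)
  define g where "g = G mst"
  have g0: "g > 0" using G_mst_pos by (simp add: g_def)
  have m1: "real m \<ge> 1" using m by auto
  define e where "e = min (g / 2) (k * g / (8 * mst\<^sup>2))"
  define l1 where "l1 = max 1 (4 * mst\<^sup>2 / k)"
  have e_le: "e \<le> g / 2" "e \<le> k * (g / (8 * mst\<^sup>2))" by (simp_all add: e_def)
  show ?thesis
  proof (rule that[of e l1])
    show "e > 0" using k0 g0 mst_gt_1 by (simp add: e_def)
    show "l1 \<ge> 1" by (simp add: l1_def)
    fix l u assume l: "l \<ge> l1" and bs: "bound_state H P L l p u" and cs: "core_symmetric P L l u"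
    have l': "l \<ge> 1" "l \<ge> 4 * mst\<^sup>2 / k" using l by (auto simp: l1_def)
    have Nr: "2 * real m \<le> real (P + 2 * L)" using N by linarith
    have Gle: "G mst \<ge> 0" using G_mst_pos by simp
    consider "(P + 2 * L) * (g - G (mst * sqrt (g / (k * l)))) \<le> action H P L l p u" |
      "m * (2 * g - G (mst * \<bar>hl u 0 0\<bar>)) + k * ((P + 2 * L) * ((hl u 0 0)\<^sup>2 / 2)) \<le> action H P L l p u"
      using core_symmetric_action[OF bs cs l'(1) _ m] N m by (auto simp: g_def k_def)
    then show "m * G mst + e \<le> action H P L l p u"
    proof cases
      case 1
      have "G (mst * sqrt (g / (k * l))) \<le> (mst * sqrt (g / (k * l)))\<^sup>2"
        using mst_gt_1 g0 k0 l' by (intro G_le_square) auto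
      also have "\<dots> = mst\<^sup>2 * (g / (k * l))" using g0 k0 l' by (simp add: power_mult_distrib)
      also have "\<dots> \<le> g / 4" using k0 l' g0 mult_right_mono[OF l'(2), of g] by (simp add: field_simps)
      finally have "3 / 4 * g \<le> g - G (mst * sqrt (g / (k * l)))" by simp
      then have "2 * real m * (3 / 4 * g) \<le> (P + 2 * L) * (g - G (mst * sqrt (g / (k * l))))"
        using Nr g0 by (intro mult_mono) auto
      moreover have "real m * g \<ge> 1 * g" using m1 g0 by (intro mult_right_mono) auto
      moreover have "2 * real m * (3 / 4 * g) = m * g + 1 / 2 * (m * g)" by simp
      ultimately show ?thesis using 1 e_le(1) unfolding g_def[symmetric] by linarith
    next
      case 2
      let ?v = "hl u 0 0"
      show ?thesis
      \<comment> \<open>Below this threshold \<open>G (mst * |v|) \<le> g / 4\<close> for the vertex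
        value \<open>v\<close>; above it \<open>v^2 / 2 \<ge> g / (8 * mst^2)\<close>.\<close>
      proof (cases "mst\<^sup>2 * ?v\<^sup>2 \<le> g / 4")
        case True
        have "G (mst * \<bar>?v\<bar>) \<le> (mst * \<bar>?v\<bar>)\<^sup>2" using mst_gt_1 by (intro G_le_square) auto
        also have "\<dots> \<le> g / 4" using True by (simp add: power_mult_distrib)
        finally have "m * (7 / 4 * g) \<le> m * (2 * g - G (mst * \<bar>?v\<bar>))" by (intro mult_left_mono) auto
        moreover have "k * ((P + 2 * L) * (?v\<^sup>2 / 2)) \<ge> 0" using k0 by simp
        moreover have "real m * g \<ge> 1 * g" using m1 g0 by (intro mult_right_mono) auto
        moreover have "m * (7 / 4 * g) = m * g + 3 / 4 * (m * g)" by simp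
        ultimately show ?thesis using 2 e_le(1) g0 unfolding g_def[symmetric] by linarith
      next
        case False
        have "G (mst * \<bar>?v\<bar>) \<le> g" using mst_gt_1 unfolding g_def by (intro G_le_Gm) auto
        then have a: "m * g \<le> m * (2 * g - G (mst * \<bar>?v\<bar>))" by (intro mult_left_mono) auto
        have "g / (4 * mst\<^sup>2) \<le> ?v\<^sup>2" using False mst_gt_1 by (simp add: field_simps)
        moreover have "1 * ?v\<^sup>2 \<le> real (P + 2 * L) * ?v\<^sup>2" using Nr m1 by (intro mult_right_mono) auto
        ultimately have "g / (8 * mst\<^sup>2) \<le> (P + 2 * L) * (?v\<^sup>2 / 2)" by simp
        then have "k * (g / (8 * mst\<^sup>2)) \<le> k * ((P + 2 * L) * (?v\<^sup>2 / 2))" using k0 by (intro mult_left_mono) auto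
        then show ?thesis using 2 a e_le(2) unfolding g_def[symmetric] by linarith
      qed
    qed
  qed
qed

end

section \<open>Second order initial value problems\<close>

definition ode_sol :: "(real \<Rightarrow> real) \<Rightarrow> real \<Rightarrow> real \<Rightarrow> (real \<Rightarrow> real) \<Rightarrow> (real \<Rightarrow> real) \<Rightarrow> bool" where
  "ode_sol g a b U V \<longleftrightarrow> (\<forall>t\<in>{a..b}. (U has_real_derivative V t) (at t within {a..b}) \<and>
     (V has_real_derivative g (U t)) (at t within {a..b}))"

lemma ode_solD:
  assumes "ode_sol g a b U V" "t \<in> {a..b}"
  shows "(U has_real_derivative V t) (at t within {a..b})"
    "(V has_real_derivative g (U t)) (at t within {a..b})"
  using assms unfolding ode_sol_def by blast+

lemma ode_sol_subinterval:
  assumes "ode_sol g a b U V" "a \<le> c" "d \<le> b"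
  shows "ode_sol g c d U V"
proof -
  have s: "{c..d} \<subseteq> {a..b}" using assms by auto
  show ?thesis unfolding ode_sol_def
  proof (intro ballI conjI)
    fix t assume t: "t \<in> {c..d}"
    note d = ode_solD[OF assms(1) subsetD[OF s t]]
    show "(U has_real_derivative V t) (at t within {c..d})" by (rule DERIV_subset[OF d(1) s])
    show "(V has_real_derivative g (U t)) (at t within {c..d})" by (rule DERIV_subset[OF d(2) s])
  qed
qed

lemma ode_sol_continuous:
  assumes "ode_sol g a b U V"
  shows "continuous_on {a..b} U" "continuous_on {a..b} V"
  by (rule DERIV_continuous_on[OF ode_solD(1)[OF assms]], assumption)
    (rule DERIV_continuous_on[OF ode_solD(2)[OF assms]], assumption)

text \<open>Gronwall for the squared distance in the phase plane: with differences \<open>z\<close>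
  of the \<open>U\<close> and \<open>w\<close> of the \<open>V\<close>, both
  \<open>2 * z * w\<close> and \<open>2 * w * (g U1 - g U2) / L\<close> (for \<open>L > 0\<close>)
  are at most \<open>z^2 + w^2\<close>.\<close>

lemma ode_sol_dependence:
  assumes S1: "ode_sol g a b U1 V1" and S2: "ode_sol g a b U2 V2"
    and L: "\<And>x y. \<bar>g x - g y\<bar> \<le> L * \<bar>x - y\<bar>" and t: "t \<in> {a..b}"
  shows "(U1 t - U2 t)\<^sup>2 + (V1 t - V2 t)\<^sup>2 \<le> ((U1 a - U2 a)\<^sup>2 + (V1 a - V2 a)\<^sup>2) * exp ((1 + L) * (t - a))"
proof -
  have L0: "L \<ge> 0" using L[of 1 0] by simp
  have at: "a \<le> t" using t by auto
  let ?E = "\<lambda>s. ((U1 s - U2 s)\<^sup>2 + (V1 s - V2 s)\<^sup>2) * exp (- ((1 + L) * (s - a)))"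
  have T1: "ode_sol g a t U1 V1" "ode_sol g a t U2 V2"
    by (rule ode_sol_subinterval[OF S1], use t in simp, use t in simp)
      (rule ode_sol_subinterval[OF S2], use t in simp, use t in simp)
  have "?E t \<le> ?E a"
  proof (rule has_real_derivative_nonpos_imp_le[OF at])
    fix s assume s: "s \<in> {a..t}"
    let ?z = "U1 s - U2 s" and ?w = "V1 s - V2 s" and ?d = "g (U1 s) - g (U2 s)"
    note d = ode_solD[OF T1(1) s] ode_solD[OF T1(2) s]
    show "(?E has_real_derivative (2 * ?z * ?w + 2 * ?w * ?d - (1 + L) * (?z\<^sup>2 + ?w\<^sup>2)) * exp (- ((1 + L) * (s - a)))) (at s within {a..t})"
      by (rule derivative_eq_intros d refl)+ (simp add: algebra_simps)
    have "?w * ?d \<le> \<bar>?w\<bar> * \<bar>?d\<bar>" by (metis abs_ge_self abs_mult)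
    also have "\<dots> \<le> \<bar>?w\<bar> * (L * \<bar>?z\<bar>)" by (intro mult_left_mono L) auto
    finally have 1: "2 * (?w * ?d) \<le> L * (2 * (\<bar>?z\<bar> * \<bar>?w\<bar>))" by (simp add: mult_ac)
    have 2: "2 * (\<bar>?z\<bar> * \<bar>?w\<bar>) \<le> ?z\<^sup>2 + ?w\<^sup>2" using sum_squares_bound[of "\<bar>?z\<bar>" "\<bar>?w\<bar>"] by simp
    have 3: "L * (2 * (\<bar>?z\<bar> * \<bar>?w\<bar>)) \<le> L * (?z\<^sup>2 + ?w\<^sup>2)" by (rule mult_left_mono[OF 2 L0])
    have 4: "?z * ?w \<le> \<bar>?z\<bar> * \<bar>?w\<bar>" by (metis abs_ge_self abs_mult)
    have "2 * (?z * ?w) + 2 * (?w * ?d) - ((?z\<^sup>2 + ?w\<^sup>2) + L * (?z\<^sup>2 + ?w\<^sup>2)) \<le> 0"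
      using 1 2 3 4 by linarith
    then have "2 * ?z * ?w + 2 * ?w * ?d - (1 + L) * (?z\<^sup>2 + ?w\<^sup>2) \<le> 0"
      by (simp only: distrib_right[of 1 L] mult.assoc mult_1)
    then show "(2 * ?z * ?w + 2 * ?w * ?d - (1 + L) * (?z\<^sup>2 + ?w\<^sup>2)) * exp (- ((1 + L) * (s - a))) \<le> 0"
      by (rule mult_nonpos_nonneg) simp
  qed
  then have "((U1 t - U2 t)\<^sup>2 + (V1 t - V2 t)\<^sup>2) / exp ((1 + L) * (t - a)) \<le> (U1 a - U2 a)\<^sup>2 + (V1 a - V2 a)\<^sup>2"
    by (simp add: exp_minus divide_inverse)
  then show ?thesis by (simp only: pos_divide_le_eq[OF exp_gt_zero])
qed

lemma ode_sol_unique: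
  assumes "ode_sol g a b U1 V1" "ode_sol g a b U2 V2"
    and "\<And>x y. \<bar>g x - g y\<bar> \<le> L * \<bar>x - y\<bar>" and "U1 a = U2 a" "V1 a = V2 a" and "t \<in> {a..b}"
  shows "U1 t = U2 t" "V1 t = V2 t"
proof -
  have "(U1 t - U2 t)\<^sup>2 + (V1 t - V2 t)\<^sup>2 \<le> 0"
    using ode_sol_dependence[OF assms(1,2,3,6)] assms(4,5) by simp
  then show "U1 t = U2 t" "V1 t = V2 t" by (simp_all add: sum_power2_le_zero_iff)
qed

text \<open>Fixed point iteration for \<open>exp (- mu t) * U t\<close>; the weight makes the integral operator a contraction on
  the whole interval.\<close>
lemma ode_sol_exists:
  fixes g :: "real \<Rightarrow> real"
  assumes L: "\<And>x y. \<bar>g x - g y\<bar> \<le> L * \<bar>x - y\<bar>" and T: "T \<ge> 0"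
  shows "\<exists>U V. ode_sol g 0 T U V \<and> U 0 = b \<and> V 0 = 0"
proof -
  have L0: "L \<ge> 0" using L[of 1 0] by simp
  have cg: "continuous_on UNIV g"
  proof (rule lipschitz_on_continuous_on)
    show "L-lipschitz_on UNIV g" using L L0 by (auto simp: lipschitz_on_def dist_real_def)
  qed
  \<comment> \<open>Each of the two integrations gains a factor \<open>1 / \<mu>\<close> in the
    weighted norm, so the contraction constant is \<open>L / \<mu>^2\<close>, which must be below
    1.\<close>
  define \<mu> where "\<mu> = L + 1"
  have \<mu>: "\<mu> > 0" "L < \<mu>\<^sup>2" using L0 by (auto simp: \<mu>_def power2_eq_square algebra_simps add_pos_nonneg)
  \<comment> \<open>Clamping the time to \<open>{0..T}\<close> turns the iterates into bounded
    continuous functions on the whole line, a complete space in which the fixed point theorem is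
    available.\<close>
  define cl where "cl t = max 0 (min T t)" for t
  have cl: "cl t \<in> {0..T}" for t using T by (auto simp: cl_def)
  have cl_id: "cl t = t" if "t \<in> {0..T}" for t using that by (auto simp: cl_def)
  define k where "k y s = g (exp (\<mu> * s) * apply_bcontfun y s)" for y :: "real \<Rightarrow>\<^sub>C real" and s
  define J where "J y s = integral {0..s} (k y)" for y s
  define I where "I y s = integral {0..s} (J y)" for y s
  define h where "h y c = exp (- (\<mu> * c)) * (b + I y c)" for y c
  have ck: "continuous_on S (k y)" for S y unfolding k_def
    by (rule continuous_on_compose2[OF cg]) (auto intro!: continuous_intros)
  have Jd: "(J y has_real_derivative k y t) (at t within {0..T})" if "t \<in> {0..T}" for y t
    unfolding J_def by (rule integral_has_real_derivative[OF ck that])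
  have cJ: "continuous_on {0..c} (J y)" for y c
    unfolding J_def by (intro indefinite_integral_continuous_1 integrable_continuous_real ck)
  have Id: "(I y has_real_derivative J y t) (at t within {0..T})" if "t \<in> {0..T}" for y t
    unfolding I_def by (rule integral_has_real_derivative[OF cJ that])
  have ch: "continuous_on {0..T} (h y)" for y unfolding h_def I_def
    by (intro continuous_intros indefinite_integral_continuous_1 integrable_continuous_real cJ)
  have bc: "(\<lambda>t. h y (cl t)) \<in> bcontfun" for y
  proof -
    have c: "continuous_on UNIV (\<lambda>t. h y (cl t))"
      by (rule continuous_on_compose2[OF ch, of _ cl]) (use cl in \<open>auto simp: cl_def intro!: continuous_intros\<close>)
    have "bounded (h y ` {0..T})" using ch compact_continuous_image compact_imp_bounded by blast
    then obtain M where "\<And>x. x \<in> {0..T} \<Longrightarrow> norm (h y x) \<le> M" unfolding bounded_iff by force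
    then have "norm (h y (cl t)) \<le> M" for t using cl by blast
    then show ?thesis by (rule bcontfun_normI[OF c])
  qed
  define \<Phi> where "\<Phi> y = Bcontfun (\<lambda>t. h y (cl t))" for y
  have \<Phi>: "apply_bcontfun (\<Phi> y) t = h y (cl t)" for y t
    unfolding \<Phi>_def by (simp add: Bcontfun_inverse bc)
  have contr: "dist (\<Phi> y) (\<Phi> z) \<le> (L / \<mu>\<^sup>2) * dist y z" for y z
  proof (rule dist_bound)
    fix t
    define c where "c = cl t"
    have c: "c \<in> {0..T}" using cl by (simp add: c_def)
    define D where "D = dist y z"
    have D0: "D \<ge> 0" by (simp add: D_def)
    have kd: "\<bar>k y s - k z s\<bar> \<le> L * D * exp (\<mu> * s)" for s
    proof -
      have "\<bar>k y s - k z s\<bar> \<le> L * \<bar>exp (\<mu> * s) * apply_bcontfun y s - exp (\<mu> * s) * apply_bcontfun z s\<bar>"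
        unfolding k_def by (rule L)
      also have "\<dots> = L * exp (\<mu> * s) * dist (apply_bcontfun y s) (apply_bcontfun z s)"
        by (simp add: right_diff_distrib[symmetric] abs_mult dist_real_def)
      also have "\<dots> \<le> L * exp (\<mu> * s) * D" unfolding D_def using L0 by (intro mult_left_mono dist_bounded) auto
      finally show ?thesis by (simp add: mult_ac)
    qed
    have ei: "integral {0..s} (\<lambda>r. K * exp (\<mu> * r)) \<le> K / \<mu> * exp (\<mu> * s)" if "K \<ge> 0" "s \<ge> 0" for K s
    proof -
      have "((\<lambda>r. K * exp (\<mu> * r)) has_integral (K / \<mu> * exp (\<mu> * s) - K / \<mu> * exp (\<mu> * 0))) {0..s}"
        by (rule fundamental_theorem_of_calculus)
          (use that \<mu> in \<open>auto intro!: derivative_eq_intros simp: has_real_derivative_iff_has_vector_derivative[symmetric]\<close>)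
      then have "integral {0..s} (\<lambda>r. K * exp (\<mu> * r)) = K / \<mu> * exp (\<mu> * s) - K / \<mu> * exp (\<mu> * 0)" by (rule integral_unique)
      then show ?thesis using that \<mu> by simp
    qed
    have Jdiff: "\<bar>J y s - J z s\<bar> \<le> L * D / \<mu> * exp (\<mu> * s)" if s: "s \<ge> 0" for s
    proof -
      have "J y s - J z s = integral {0..s} (\<lambda>r. k y r - k z r)" unfolding J_def
        by (intro Henstock_Kurzweil_Integration.integral_diff[symmetric] integrable_continuous_real ck)
      also have "\<bar>\<dots>\<bar> \<le> integral {0..s} (\<lambda>r. L * D * exp (\<mu> * r))"
      proof (rule set_integrable_abs_le_imp)
        show "set_integrable lborel {0..s} (\<lambda>r. k y r - k z r)"
          by (intro borel_integrable_atLeastAtMost' continuous_on_diff ck)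
        show "set_integrable lborel {0..s} (\<lambda>r. L * D * exp (\<mu> * r))"
          by (intro borel_integrable_atLeastAtMost' continuous_intros)
      qed (rule kd)
      also have "\<dots> \<le> L * D / \<mu> * exp (\<mu> * s)" using L0 D0 s by (intro ei) auto
      finally show ?thesis .
    qed
    have "I y c - I z c = integral {0..c} (\<lambda>r. J y r - J z r)" unfolding I_def
      by (intro Henstock_Kurzweil_Integration.integral_diff[symmetric] integrable_continuous_real cJ)
    also have "\<bar>\<dots>\<bar> \<le> integral {0..c} (\<lambda>r. L * D / \<mu> * exp (\<mu> * r))"
    proof (rule set_integrable_abs_le_imp)
      show "set_integrable lborel {0..c} (\<lambda>r. J y r - J z r)"
        by (intro borel_integrable_atLeastAtMost' continuous_on_diff cJ)
      show "set_integrable lborel {0..c} (\<lambda>r. L * D / \<mu> * exp (\<mu> * r))"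
        by (intro borel_integrable_atLeastAtMost' continuous_on_mult continuous_on_const continuous_on_exp continuous_on_id)
      show "\<bar>J y r - J z r\<bar> \<le> L * D / \<mu> * exp (\<mu> * r)" if "r \<in> {0..c}" for r using that by (intro Jdiff) auto
    qed
    also have "\<dots> \<le> L * D / \<mu> / \<mu> * exp (\<mu> * c)" using L0 D0 c \<mu> by (intro ei) auto
    finally have Idiff: "\<bar>I y c - I z c\<bar> \<le> L * D / \<mu> / \<mu> * exp (\<mu> * c)" .
    have "dist (apply_bcontfun (\<Phi> y) t) (apply_bcontfun (\<Phi> z) t) = exp (- (\<mu> * c)) * \<bar>I y c - I z c\<bar>"
      by (simp add: \<Phi> h_def c_def dist_real_def right_diff_distrib[symmetric] abs_mult)
    also have "\<dots> \<le> exp (- (\<mu> * c)) * (L * D / \<mu> / \<mu> * exp (\<mu> * c))" by (intro mult_left_mono Idiff) auto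
    also have "\<dots> = L / \<mu>\<^sup>2 * D" by (simp add: exp_minus power2_eq_square)
    finally show "dist (apply_bcontfun (\<Phi> y) t) (apply_bcontfun (\<Phi> z) t) \<le> L / \<mu>\<^sup>2 * dist y z" by (simp add: D_def)
  qed
  have "\<exists>!y. \<Phi> y = y"
    by (rule banach_fix_type[where c = "L / \<mu>\<^sup>2"]) (use contr L0 \<mu> in auto)
  then obtain y where y: "\<Phi> y = y" by blast
  define U where "U t = b + I y t" for t
  have k: "k y t = g (U t)" if "t \<in> {0..T}" for t
  proof -
    have "apply_bcontfun y t = h y (cl t)" using \<Phi>[of y t] y by simp
    then show ?thesis using cl_id[OF that] by (simp add: k_def U_def h_def exp_minus mult.assoc[symmetric])
  qed
  have Ud: "(U has_real_derivative J y t) (at t within {0..T})" if "t \<in> {0..T}" for t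
    unfolding U_def using DERIV_add[OF DERIV_const Id[OF that]] by simp
  have "ode_sol g 0 T U (J y)" unfolding ode_sol_def
  proof (intro ballI conjI)
    fix t assume t: "t \<in> {0..T}"
    show "(U has_real_derivative J y t) (at t within {0..T})" by (rule Ud[OF t])
    show "(J y has_real_derivative g (U t)) (at t within {0..T})" using Jd[OF t, of y] unfolding k[OF t] .
  qed
  moreover have "U 0 = b" "J y 0 = 0" by (simp_all add: U_def I_def J_def)
  ultimately show ?thesis by blast
qed

text \<open>The common tool of the continuation arguments below: an a priori bound is contradicted
  at the first time at which it could fail.\<close>

lemma first_hitting_time:
  fixes h :: "real \<Rightarrow> real"
  assumes c: "continuous_on {a..b} h" and h0: "h a < 0" and t: "t \<in> {a..b}" "h t \<ge> 0"
  obtains t0 where "t0 \<in> {a<..t}" "h t0 = 0" "\<And>s. s \<in> {a..<t0} \<Longrightarrow> h s < 0"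
proof -
  let ?S = "{a..t} \<inter> h -` {0..}"
  have ct: "continuous_on {a..t} h" by (rule continuous_on_subset[OF c]) (use t in auto)
  have "closed ?S" by (rule continuous_closed_preimage[OF ct]) auto
  moreover have "?S \<noteq> {}" using t by auto
  moreover have bb: "bdd_below ?S" by (rule bdd_belowI[of _ a]) auto
  ultimately have I: "Inf ?S \<in> ?S" by (intro closed_contains_Inf)
  define t0 where "t0 = Inf ?S"
  have t0: "t0 \<in> {a..t}" "h t0 \<ge> 0" using I by (auto simp: t0_def)
  have below: "h s < 0" if "s \<in> {a..<t0}" for s
  proof (rule ccontr)
    assume "\<not> h s < 0"
    then have "s \<in> ?S" using that t0(1) by auto
    then have "t0 \<le> s" unfolding t0_def using bb by (rule cInf_lower)
    then show False using that by auto
  qed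
  have at0: "a < t0" using h0 t0 by (cases "t0 = a") auto
  have "h t0 \<le> 0"
  proof (rule ccontr)
    assume *: "\<not> h t0 \<le> 0"
    have "continuous_on {a..t0} h" by (rule continuous_on_subset[OF ct]) (use t0 in auto)
    then have "\<exists>x\<ge>a. x \<le> t0 \<and> h x = 0"
      using * h0 at0 by (intro IVT') auto
    then obtain x where "a \<le> x" "x \<le> t0" "h x = 0" by blast
    then show False using below[of x] * by (cases "x = t0") auto
  qed
  then show ?thesis using t0 at0 below by (intro that[of t0]) auto
qed

text \<open>The shooting parameter is the initial height, with zero initial slope as required at the
  far end of an edge. Continuity is needed only for the final values, where the edge meets the
  vertex.\<close>

lemma ode_family:
  fixes g :: "real \<Rightarrow> real"
  assumes L: "\<And>x y. \<bar>g x - g y\<bar> \<le> L * \<bar>x - y\<bar>" and T: "T \<ge> 0"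
  obtains U V where "\<And>b. ode_sol g 0 T (U b) (V b)" "\<And>b. U b 0 = b" "\<And>b. V b 0 = 0"
    "continuous_on UNIV (\<lambda>b. U b T)" "continuous_on UNIV (\<lambda>b. V b T)"
proof -
  obtain U V where S: "\<And>b. ode_sol g 0 T (U b) (V b)" and U0: "\<And>b. U b 0 = b" and V0: "\<And>b. V b 0 = 0"
    using ode_sol_exists[OF L T] by metis
  define K where "K = sqrt (exp ((1 + L) * T))"
  have d: "(U b T - U b' T)\<^sup>2 + (V b T - V b' T)\<^sup>2 \<le> (K * \<bar>b - b'\<bar>)\<^sup>2" for b b'
    using ode_sol_dependence[OF S[of b] S[of b'] L, of T] T
    by (simp add: U0 V0 K_def power_mult_distrib mult.commute)
  have K0: "K \<ge> 0" by (simp add: K_def)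
  have lU: "\<bar>U b T - U b' T\<bar> \<le> K * \<bar>b - b'\<bar>" and lV: "\<bar>V b T - V b' T\<bar> \<le> K * \<bar>b - b'\<bar>" for b b'
  proof -
    have 0: "0 \<le> K * \<bar>b - b'\<bar>" using K0 by simp
    have "\<bar>U b T - U b' T\<bar>\<^sup>2 \<le> (K * \<bar>b - b'\<bar>)\<^sup>2"
      using d[of b b'] zero_le_power2[of "V b T - V b' T"] unfolding power2_abs by linarith
    then show "\<bar>U b T - U b' T\<bar> \<le> K * \<bar>b - b'\<bar>" using 0 by (rule power2_le_imp_le)
    have "\<bar>V b T - V b' T\<bar>\<^sup>2 \<le> (K * \<bar>b - b'\<bar>)\<^sup>2"
      using d[of b b'] zero_le_power2[of "U b T - U b' T"] unfolding power2_abs by linarith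
    then show "\<bar>V b T - V b' T\<bar> \<le> K * \<bar>b - b'\<bar>" using 0 by (rule power2_le_imp_le)
  qed
  have lip: "K-lipschitz_on UNIV (\<lambda>b. U b T)" "K-lipschitz_on UNIV (\<lambda>b. V b T)"
    using K0 lU lV unfolding lipschitz_on_def dist_real_def by blast+
  show ?thesis
    by (rule that[OF S U0 V0 lipschitz_on_continuous_on[OF lip(1)] lipschitz_on_continuous_on[OF lip(2)]])
qed

context nls
begin

text \<open>The truncation makes \<open>f\<close> globally Lipschitz and vanish on negative numbers, so that an orbit that
  reaches 0 continues as a straight line.\<close>
definition fc :: "real \<Rightarrow> real \<Rightarrow> real" where "fc B u = f (max 0 (min B u))"
text \<open>The positive critical point of \<open>f\<close>: up to here \<open>f\<close> is
  increasing, so small solutions are ordered by their initial heights.\<close>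

definition eta :: real where "eta = (1 / (p - 1)) powr (1 / (p - 2))"
text \<open>The value of \<open>f u / u\<close> at \<open>u = eta\<close>, hence its minimum for
  \<open>0 < u \<le> eta\<close>.\<close>

definition kap :: real where "kap = (p - 2) / (p - 1)"
definition phi :: "real \<Rightarrow> real" where "phi x = mst * cosh (th * x) powr (- 1 / th)"

lemma fc_eq: "0 \<le> u \<Longrightarrow> u \<le> B \<Longrightarrow> fc B u = f u" by (simp add: fc_def)
lemma fc_neg: "u \<le> 0 \<Longrightarrow> B \<ge> 0 \<Longrightarrow> fc B u = 0" by (simp add: fc_def max_def)

section \<open>Slope, monotonicity and Lipschitz bounds for the nonlinearity\<close>

lemma f_deriv: assumes "u > 0" shows "(f has_real_derivative 1 - (p - 1) * u powr (p - 2)) (at u)"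
proof -
  have "((\<lambda>u. u - u powr (p - 1)) has_real_derivative 1 - (p - 1) * u powr (p - 1 - 1)) (at u)"
    by (intro DERIV_diff DERIV_ident has_real_derivative_powr assms)
  then have "((\<lambda>u. u - u powr (p - 1)) has_real_derivative 1 - (p - 1) * u powr (p - 2)) (at u)" by simp
  then show ?thesis
  proof (rule has_field_derivative_transform_within_open[where S = "{0<..}"])
    fix x :: real assume "x \<in> {0<..}"
    then show "x - x powr (p - 1) = f x" by (simp add: f_def powr_mult_base mult.commute)
  qed (use assms in auto)
qed

lemma f_mvt:
  assumes "0 \<le> x" "x < y"
  obtains z where "x < z" "z < y" "f y - f x = (y - x) * (1 - (p - 1) * z powr (p - 2))"
proof -
  have "\<exists>l z. x < z \<and> z < y \<and> DERIV f z :> l \<and> f y - f x = (y - x) * l"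
  proof (rule MVT[OF assms(2) f_continuous])
    fix z assume "x < z" "z < y"
    then show "f differentiable at z" using f_deriv[of z] assms real_differentiable_def by force
  qed
  then obtain l z where z: "x < z" "z < y" "DERIV f z :> l" "f y - f x = (y - x) * l" by blast
  have "l = 1 - (p - 1) * z powr (p - 2)" using DERIV_unique[OF z(3) f_deriv] z assms by simp
  then show ?thesis using z that by blast
qed

lemma fc_lipschitz:
  assumes B: "B \<ge> 0"
  shows "\<bar>fc B x - fc B y\<bar> \<le> (1 + (p - 1) * B powr (p - 2)) * \<bar>x - y\<bar>"
proof -
  define L where "L = 1 + (p - 1) * B powr (p - 2)"
  have L0: "L \<ge> 0" using p_gt_2 by (simp add: L_def)
  have *: "\<bar>f y - f x\<bar> \<le> L * \<bar>y - x\<bar>" if h: "0 \<le> x" "x < y" "y \<le> B" for x y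
  proof -
    obtain z where z: "x < z" "z < y" "f y - f x = (y - x) * (1 - (p - 1) * z powr (p - 2))"
      by (rule f_mvt[OF h(1,2)])
    have "z powr (p - 2) \<le> B powr (p - 2)" using z h p_gt_2 by (intro powr_mono2) auto
    then have "(p - 1) * z powr (p - 2) \<le> (p - 1) * B powr (p - 2)" using p_gt_2 by (intro mult_left_mono) auto
    moreover have "(p - 1) * z powr (p - 2) \<ge> 0" using p_gt_2 by simp
    ultimately have "\<bar>1 - (p - 1) * z powr (p - 2)\<bar> \<le> L" unfolding L_def by linarith
    then have "\<bar>y - x\<bar> * \<bar>1 - (p - 1) * z powr (p - 2)\<bar> \<le> \<bar>y - x\<bar> * L" by (intro mult_left_mono) auto
    then show ?thesis unfolding z(3) abs_mult by (simp add: mult.commute)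
  qed
  have **: "\<bar>f x - f y\<bar> \<le> L * \<bar>x - y\<bar>" if "x \<in> {0..B}" "y \<in> {0..B}" for x y
    using *[of x y] *[of y x] that by (cases x y rule: linorder_cases) (auto simp: abs_minus_commute)
  have "\<bar>fc B x - fc B y\<bar> \<le> L * \<bar>max 0 (min B x) - max 0 (min B y)\<bar>"
    unfolding fc_def using B by (intro **) auto
  also have "\<dots> \<le> L * \<bar>x - y\<bar>"
    using L0 by (intro mult_left_mono) (auto simp: max_def min_def)
  finally show ?thesis by (simp add: L_def)
qed

lemma eta_pos: "eta > 0" and eta_lt_1: "eta < 1" and eta_powr: "eta powr (p - 2) = 1 / (p - 1)"
proof -
  show "eta > 0" using p_gt_2 by (simp add: eta_def)
  show e: "eta powr (p - 2) = 1 / (p - 1)" using p_gt_2 by (simp add: eta_def powr_powr)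
  show "eta < 1"
  proof (rule ccontr)
    assume "\<not> eta < 1"
    then have "1 powr (p - 2) \<le> eta powr (p - 2)" using p_gt_2 by (intro powr_mono2) auto
    then show False using e p_gt_2 by (simp add: field_simps)
  qed
qed

lemma kap_pos: "kap > 0" using p_gt_2 by (simp add: kap_def)

lemma f_mono_eta: assumes "0 \<le> x" "x \<le> y" "y \<le> eta" shows "f x \<le> f y"
proof (cases "x = y")
  case False
  then have "x < y" using assms by simp
  then obtain z where z: "x < z" "z < y" "f y - f x = (y - x) * (1 - (p - 1) * z powr (p - 2))"
    by (rule f_mvt[OF assms(1)])
  have "z powr (p - 2) \<le> 1 / (p - 1)" unfolding eta_powr[symmetric] using z assms p_gt_2 by (intro powr_mono2) auto
  then have "(p - 1) * z powr (p - 2) \<le> 1" using p_gt_2 by (simp add: field_simps)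
  then have "f y - f x \<ge> 0" unfolding z(3) using z by (intro mult_nonneg_nonneg) auto
  then show ?thesis by simp
qed simp

lemma f_ge_kap: assumes "0 \<le> x" "x \<le> eta" shows "kap * x \<le> f x"
proof -
  have "x powr (p - 2) \<le> 1 / (p - 1)" unfolding eta_powr[symmetric] using assms p_gt_2 by (intro powr_mono2) auto
  moreover have "kap = 1 - 1 / (p - 1)" using p_gt_2 by (simp add: kap_def field_simps)
  ultimately have "x * kap \<le> x * (1 - \<bar>x\<bar> powr (p - 2))" using assms by (intro mult_left_mono) auto
  then show ?thesis by (simp add: f_factor mult.commute)
qed

lemma fc_eta_mono: "x \<le> y \<Longrightarrow> fc eta x \<le> fc eta y"
proof -
  assume "x \<le> y"
  then have "max 0 (min eta x) \<le> max 0 (min eta y)" by (simp add: max_def min_def)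
  then show ?thesis unfolding fc_def by (rule f_mono_eta[rotated]) (use eta_pos in auto)
qed

section \<open>The explicit soliton\<close>

lemma phi_pos: "phi x > 0" using mst_gt_1 by (simp add: phi_def)

lemma phi_0 [simp]: "phi 0 = mst" by (simp add: phi_def)

lemma phi_le: "phi x \<le> mst"
proof -
  have "cosh (th * x) powr (- 1 / th) \<le> 1 powr (- 1 / th)"
    using th_pos by (intro powr_mono2') (auto simp: cosh_real_ge_1)
  then show ?thesis using mst_gt_1 by (simp add: phi_def)
qed

lemma phi_powr: "phi x powr (p - 2) = p / 2 * (1 - (tanh (th * x))\<^sup>2)"
proof -
  have c: "cosh (th * x) > 0" by simp
  have e: "- 1 / th * (p - 2) = - 2" using p_gt_2 by (simp add: th_def field_simps)
  have "phi x powr (p - 2) = mst powr (p - 2) * (cosh (th * x) powr (- 1 / th)) powr (p - 2)"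
    using mst_gt_1 by (simp add: phi_def powr_mult)
  also have "(cosh (th * x) powr (- 1 / th)) powr (p - 2) = cosh (th * x) powr (- 2)"
    unfolding powr_powr e ..
  also have "\<dots> = 1 / (cosh (th * x))\<^sup>2"
    using powr_realpow[of "cosh (th * x)" 2] by (simp add: powr_minus divide_inverse)
  also have "\<dots> = 1 - (tanh (th * x))\<^sup>2"
    using c by (simp add: tanh_def power_divide sinh_square_eq diff_divide_distrib)
  finally show ?thesis by (simp add: mst_powr)
qed

lemma phi_deriv: "(phi has_real_derivative - (phi x * tanh (th * x))) (at x)"
proof -
  have "((\<lambda>x. cosh (th * x)) has_real_derivative sinh (th * x) * th) (at x)"
    by (auto intro!: derivative_eq_intros)
  then have "((\<lambda>x. cosh (th * x) powr (- 1 / th)) has_real_derivative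
     (- 1 / th) * cosh (th * x) powr (- 1 / th - of_nat 1) * (sinh (th * x) * th)) (at x)"
    by (rule DERIV_fun_powr) simp
  also have "(- 1 / th) * cosh (th * x) powr (- 1 / th - of_nat 1) * (sinh (th * x) * th)
      = - (cosh (th * x) powr (- 1 / th) * tanh (th * x))"
    using th_pos by (simp add: powr_diff tanh_def)
  finally have "((\<lambda>x. mst * cosh (th * x) powr (- 1 / th)) has_real_derivative
      mst * - (cosh (th * x) powr (- 1 / th) * tanh (th * x))) (at x)" by (rule DERIV_cmult)
  then show ?thesis unfolding phi_def[abs_def] by (simp add: mult.assoc)
qed

lemma tanh_deriv: "((\<lambda>x. tanh (th * x)) has_real_derivative th * (1 - (tanh (th * x))\<^sup>2)) (at x)"
proof -
  have "((\<lambda>x. th * x) has_real_derivative th) (at x)" using DERIV_cmult[OF DERIV_ident, of th] by simp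
  then have "((\<lambda>x. tanh (th * x)) has_real_derivative (1 - (tanh (th * x))\<^sup>2) * th) (at x)"
    by (rule has_field_derivative_tanh[rotated]) simp
  then show ?thesis by (simp add: mult.commute)
qed

lemma phi_deriv2: "((\<lambda>x. - (phi x * tanh (th * x))) has_real_derivative f (phi x)) (at x)"
proof -
  let ?t = "tanh (th * x)"
  have "((\<lambda>x. - (phi x * tanh (th * x))) has_real_derivative
      - (- (phi x * ?t) * ?t + th * (1 - ?t\<^sup>2) * phi x)) (at x)"
    by (rule DERIV_minus[OF DERIV_mult[OF phi_deriv tanh_deriv]])
  also have "- (- (phi x * ?t) * ?t + th * (1 - ?t\<^sup>2) * phi x) = phi x * (1 - p / 2 * (1 - ?t\<^sup>2))"
    by (simp add: th_def field_simps power2_eq_square)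
  also have "\<dots> = f (phi x)" using phi_powr[of x] phi_pos[of x] by (simp add: f_factor)
  finally show ?thesis .
qed

lemma F_phi: "F (phi x) = (phi x * tanh (th * x))\<^sup>2"
proof -
  have "2 / p * \<bar>phi x\<bar> powr (p - 2) = 1 - (tanh (th * x))\<^sup>2"
    unfolding abs_of_pos[OF phi_pos] phi_powr using p_gt_2 by (simp add: mult.assoc[symmetric])
  then show ?thesis by (simp add: F_factor power_mult_distrib)
qed

lemma phi_ode_sol: "ode_sol f a b phi (\<lambda>x. - (phi x * tanh (th * x)))"
  unfolding ode_sol_def using has_field_derivative_at_within[OF phi_deriv] has_field_derivative_at_within[OF phi_deriv2] by blast

lemma phi_exp_bound: assumes "x \<ge> 0" shows "phi x \<le> mst * 2 powr (1 / th) * exp (- x)"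
proof -
  have "exp (th * x) / 2 \<le> cosh (th * x)" by (simp add: cosh_def)
  then have "cosh (th * x) powr (- 1 / th) \<le> (exp (th * x) / 2) powr (- 1 / th)"
    using th_pos by (intro powr_mono2') auto
  also have "\<dots> = exp (th * x) powr (- 1 / th) / 2 powr (- 1 / th)" by (simp add: powr_divide)
  also have "\<dots> = 2 powr (1 / th) * exp (- x)"
    using th_pos by (simp add: powr_def exp_minus divide_inverse)
  finally show ?thesis using mst_gt_1 unfolding phi_def by (simp add: mult.assoc)
qed

section \<open>Orbits starting at or above the height of the soliton\<close>

lemma ode_energy:
  assumes S: "ode_sol (fc B) a b U V" and r: "\<And>t. t \<in> {a..b} \<Longrightarrow> 0 \<le> U t \<and> U t \<le> B" and t: "t \<in> {a..b}"
  shows "(V t)\<^sup>2 - F (U t) = (V a)\<^sup>2 - F (U a)"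
proof -
  have "((\<lambda>t. (V t)\<^sup>2 - F (U t)) has_real_derivative 0) (at s within {a..b})" if s: "s \<in> {a..b}" for s
  proof -
    note d = ode_solD[OF S s]
    have e: "fc B (U s) = f (U s)" using r[OF s] by (simp add: fc_eq)
    have "((\<lambda>t. F (U t)) has_real_derivative 2 * f (U s) * V s) (at s within {a..b})"
      by (rule DERIV_chain2[OF F_deriv d(1)])
    from DERIV_diff[OF DERIV_power[OF d(2), of 2] this] show ?thesis by (simp add: e)
  qed
  then have "\<exists>c. \<forall>t\<in>{a..b}. (V t)\<^sup>2 - F (U t) = c"
    by (intro has_field_derivative_zero_constant) auto
  then obtain c where c: "\<And>t. t \<in> {a..b} \<Longrightarrow> (V t)\<^sup>2 - F (U t) = c" by blast
  have "a \<in> {a..b}" using t by auto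
  then show ?thesis using c t by simp
qed

text \<open>Comparison with the soliton profile: along an orbit of nonnegative energy the quantity
  \<open>V / U + tanh\<close> satisfies a linear differential inequality and vanishes initially.\<close>
lemma shoot_compare_aux:
  assumes S: "ode_sol (fc B) 0 T U V" and i: "U 0 = b" "V 0 = 0" and b: "mst \<le> b"
    and r: "\<And>t. t \<in> {0..T} \<Longrightarrow> 0 < U t \<and> U t \<le> B" and t: "t \<in> {0..T}"
  shows "V t \<le> - (U t * tanh (th * t))" "U t \<le> b * cosh (th * t) powr (- 1 / th)"
proof -
  have Fb: "F b \<le> 0" using F_neg[of b] F_mst b mst_gt_1 by (cases "b = mst") auto
  let ?h = "\<lambda>t. tanh (th * t)"
  \<comment> \<open>With \<open>Y = V / U\<close> the second factor,
    \<open>U powr (- th) * cosh (th * t)\<close>, has logarithmic derivative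
    \<open>th * (tanh (th * t) - Y)\<close>. It is the integrating factor for the Riccati inequality
    satisfied by \<open>Y + tanh (th * t)\<close>.\<close>
  let ?q = "\<lambda>t. (V t / U t + ?h t) * (exp (- (th * ln (U t))) * cosh (th * t))"
  have alg: "A * c + c * k * B = (A + B * k) * c" for A B c k :: real by (simp add: algebra_simps)
  have alg2: "1 - Q - Y\<^sup>2 + th * (1 - h\<^sup>2) + (Y + h) * (th * (h - Y)) = (1 + th) * (1 - Y\<^sup>2) - Q" for Q Y h
    by (simp add: algebra_simps power2_eq_square)
  have alg3: "A * C + C * h * u = (A + u * h) * C" for A C h u :: real by (simp add: algebra_simps)
  have neg: "V x / U x + ?h x \<le> 0" if x: "x \<in> {0..T}" for x
  proof -
    have Sx: "ode_sol (fc B) 0 x U V" by (rule ode_sol_subinterval[OF S]) (use x in auto)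
    have "?q x \<le> ?q 0"
    proof (rule has_real_derivative_nonpos_imp_le[where g = ?q])
      show "0 \<le> x" using x by simp
      fix s assume s: "s \<in> {0..x}"
      have sT: "s \<in> {0..T}" using s x by auto
      have u: "0 < U s" "U s \<le> B" using r[OF sT] by auto
      note d = ode_solD[OF Sx s]
      have e: "fc B (U s) = f (U s)" using u by (simp add: fc_eq)
      let ?Y = "V s / U s" and ?c = "exp (- (th * ln (U s))) * cosh (th * s)"
      have d1: "((\<lambda>t. V t / U t) has_real_derivative f (U s) / U s - ?Y\<^sup>2) (at s within {0..x})"
        using DERIV_divide[OF d(2) d(1)] u by (simp add: e power2_eq_square diff_divide_distrib)
      have d2: "(?h has_real_derivative th * (1 - (?h s)\<^sup>2)) (at s within {0..x})"
        by (rule has_field_derivative_at_within[OF tanh_deriv])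
      have d3: "((\<lambda>t. ln (U t)) has_real_derivative ?Y) (at s within {0..x})"
        using DERIV_chain2[OF DERIV_ln[OF u(1)] d(1)] by (simp add: divide_inverse mult.commute)
      have d4: "((\<lambda>t. exp (- (th * ln (U t)))) has_real_derivative exp (- (th * ln (U s))) * (- (th * ?Y))) (at s within {0..x})"
        by (rule DERIV_chain2[OF DERIV_exp DERIV_minus[OF DERIV_cmult[OF d3]]])
      have d5: "((\<lambda>t. cosh (th * t)) has_real_derivative sinh (th * s) * th) (at s within {0..x})"
        by (auto intro!: derivative_eq_intros)
      have d6: "((\<lambda>t. exp (- (th * ln (U t))) * cosh (th * t)) has_real_derivative
          ?c * (th * (?h s - ?Y))) (at s within {0..x})"
      proof -
        have "sinh (th * s) = cosh (th * s) * ?h s" by (simp add: tanh_def)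
        then have "exp (- (th * ln (U s))) * (- (th * ?Y)) * cosh (th * s) + sinh (th * s) * th * exp (- (th * ln (U s)))
            = ?c * (th * (?h s - ?Y))" by (simp add: algebra_simps)
        then show ?thesis using DERIV_mult[OF d4 d5] by simp
      qed
      show "(?q has_real_derivative (f (U s) / U s - ?Y\<^sup>2 + th * (1 - (?h s)\<^sup>2) + (?Y + ?h s) * (th * (?h s - ?Y))) * ?c) (at s within {0..x})"
        by (rule DERIV_cong[OF DERIV_mult[OF DERIV_add[OF d1 d2] d6]], rule alg)
      let ?Q = "\<bar>U s\<bar> powr (p - 2)"
      \<comment> \<open>Since \<open>F b \<le> 0\<close> the energy is nonnegative, which bounds
        \<open>?Y^2\<close> from below; the bound is an equality along the soliton, where the
        derivative of \<open>?q\<close> vanishes.\<close>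
      have "(V s)\<^sup>2 - F (U s) = (V 0)\<^sup>2 - F (U 0)" by (rule ode_energy[OF S _ sT]) (use r less_imp_le in blast)
      then have "(V s)\<^sup>2 \<ge> F (U s)" using i Fb by simp
      then have "(V s)\<^sup>2 / (U s)\<^sup>2 \<ge> F (U s) / (U s)\<^sup>2" by (intro divide_right_mono) auto
      then have "?Y\<^sup>2 \<ge> 1 - 2 / p * ?Q" using u by (simp add: F_factor power_divide)
      then have c1: "p / 2 * (1 - 2 / p * ?Q) \<le> p / 2 * ?Y\<^sup>2" using p_gt_2 by (intro mult_left_mono) auto
      have c2: "p / 2 * (1 - 2 / p * ?Q) = p / 2 - ?Q"
        using p_gt_2 by (simp add: right_diff_distrib mult.assoc[symmetric])
      have c3: "1 + th = p / 2" by (simp add: th_def field_simps)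
      have c4: "p / 2 * (1 - ?Y\<^sup>2) = p / 2 - p / 2 * ?Y\<^sup>2" by (simp only: right_diff_distrib mult_1_right)
      have "(1 + th) * (1 - ?Y\<^sup>2) \<le> ?Q" using c1 unfolding c2 c3 c4 by linarith
      moreover have "f (U s) / U s = 1 - ?Q" using u by (simp add: f_factor)
      ultimately have "f (U s) / U s - ?Y\<^sup>2 + th * (1 - (?h s)\<^sup>2) + (?Y + ?h s) * (th * (?h s - ?Y)) \<le> 0"
        using alg2[of ?Q ?Y "?h s"] by linarith
      then show "(f (U s) / U s - ?Y\<^sup>2 + th * (1 - (?h s)\<^sup>2) + (?Y + ?h s) * (th * (?h s - ?Y))) * ?c \<le> 0"
        by (rule mult_nonpos_nonneg) simp
    qed
    also have "?q 0 = 0" using i by simp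
    finally have "?q x \<le> 0" .
    moreover have "exp (- (th * ln (U x))) * cosh (th * x) > 0" by simp
    ultimately show ?thesis by (meson mult_pos_pos not_le)
  qed
  have "V t / U t \<le> - ?h t" using neg[OF t] by simp
  then show "V t \<le> - (U t * ?h t)" using r[OF t] by (simp add: pos_divide_le_eq mult.commute)
  let ?g = "\<lambda>t. U t * cosh (th * t) powr (1 / th)"
  have St: "ode_sol (fc B) 0 t U V" by (rule ode_sol_subinterval[OF S]) (use t in auto)
  have "?g t \<le> ?g 0"
  proof (rule has_real_derivative_nonpos_imp_le[where g = ?g])
    show "0 \<le> t" using t by simp
    fix s assume s: "s \<in> {0..t}"
    have sT: "s \<in> {0..T}" using s t by auto
    have d5: "((\<lambda>t. cosh (th * t)) has_real_derivative sinh (th * s) * th) (at s)"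
      by (auto intro!: derivative_eq_intros)
    have "((\<lambda>t. cosh (th * t) powr (1 / th)) has_real_derivative
       (1 / th) * cosh (th * s) powr (1 / th - of_nat 1) * (sinh (th * s) * th)) (at s)"
      by (rule DERIV_fun_powr[OF d5]) simp
    also have "(1 / th) * cosh (th * s) powr (1 / th - of_nat 1) * (sinh (th * s) * th) = cosh (th * s) powr (1 / th) * ?h s"
      using th_pos by (simp add: powr_diff tanh_def)
    finally have d6: "((\<lambda>t. cosh (th * t) powr (1 / th)) has_real_derivative cosh (th * s) powr (1 / th) * ?h s) (at s within {0..t})"
      by (rule has_field_derivative_at_within)
    show "(?g has_real_derivative (V s + U s * ?h s) * cosh (th * s) powr (1 / th)) (at s within {0..t})"
      by (rule DERIV_cong[OF DERIV_mult[OF ode_solD(1)[OF St s] d6]], rule alg3)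
    have "V s / U s \<le> - ?h s" using neg[OF sT] by simp
    then have "V s + U s * ?h s \<le> 0" using r[OF sT] by (simp add: pos_divide_le_eq mult.commute)
    then show "(V s + U s * ?h s) * cosh (th * s) powr (1 / th) \<le> 0" by (rule mult_nonpos_nonneg) simp
  qed
  then have "U t * cosh (th * t) powr (1 / th) \<le> b" using i by simp
  then have "U t \<le> b / cosh (th * t) powr (1 / th)" by (simp add: pos_le_divide_eq)
  then show "U t \<le> b * cosh (th * t) powr (- 1 / th)" by (simp add: powr_minus divide_inverse)
qed

text \<open>The upper bound \<open>U \<le> B\<close> is obtained by continuation: up to the first
  time at which \<open>B\<close> is reached, the comparison already gives
  \<open>U \<le> b < B\<close>.\<close>

lemma shoot_compare:
  assumes S: "ode_sol (fc B) 0 T U V" and i: "U 0 = b" "V 0 = 0" and b: "mst \<le> b" "b < B"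
    and r: "\<And>t. t \<in> {0..T} \<Longrightarrow> 0 < U t" and t: "t \<in> {0..T}"
  shows "V t \<le> - (U t * tanh (th * t))" "U t \<le> b * cosh (th * t) powr (- 1 / th)" "U t \<le> b"
    "(V t)\<^sup>2 = F (U t) - F b"
proof -
  have le: "b * cosh (th * s) powr (- 1 / th) \<le> b" for s
    using phi_le[of s] b mst_gt_1 by (simp add: phi_def)
  have lt: "U s < B" if s: "s \<in> {0..T}" for s
  proof (rule ccontr)
    assume *: "\<not> U s < B"
    have c: "continuous_on {0..T} (\<lambda>t. U t - B)" by (intro continuous_intros ode_sol_continuous(1)[OF S])
    obtain t0 where t0: "t0 \<in> {0<..s}" "U t0 - B = 0" "\<And>r. r \<in> {0..<t0} \<Longrightarrow> U r - B < 0"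
      by (rule first_hitting_time[OF c _ s]) (use * i b in auto)
    have S0: "ode_sol (fc B) 0 t0 U V" by (rule ode_sol_subinterval[OF S]) (use t0 s in auto)
    have "U t0 \<le> b * cosh (th * t0) powr (- 1 / th)"
    proof (rule shoot_compare_aux(2)[OF S0 i b(1)])
      fix q assume q: "q \<in> {0..t0}"
      show "0 < U q \<and> U q \<le> B" using r[of q] t0(2) t0(3)[of q] q t0(1) s by (cases "q = t0") auto
    qed (use t0 in auto)
    then show False using le[of t0] b t0(2) by simp
  qed
  have rB: "0 < U s \<and> U s \<le> B" if "s \<in> {0..T}" for s using r[OF that] lt[OF that] by simp
  show "V t \<le> - (U t * tanh (th * t))" by (rule shoot_compare_aux(1)[OF S i b(1) rB t])
  show *: "U t \<le> b * cosh (th * t) powr (- 1 / th)" by (rule shoot_compare_aux(2)[OF S i b(1) rB t])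
  show "U t \<le> b" using * le[of t] by simp
  have "(V t)\<^sup>2 - F (U t) = (V 0)\<^sup>2 - F (U 0)" by (rule ode_energy[OF S _ t]) (use rB less_imp_le in blast)
  then show "(V t)\<^sup>2 = F (U t) - F b" using i by simp
qed

text \<open>Above \<open>mst\<close> the energy \<open>- F b\<close> is positive, so a first zero is
  reached with strictly negative slope, and the orbit then descends along a line. Hence a positive
  value at \<open>T\<close> excludes any earlier zero, and the slope at \<open>T\<close> is negative
  in all cases.\<close>

lemma shoot_negative_slope:
  assumes S: "ode_sol (fc B) 0 T U V" and i: "U 0 = b" "V 0 = 0" and b: "mst < b" "b < B" and T: "T > 0"
  shows "V T < 0" "U T > 0 \<Longrightarrow> t \<in> {0..T} \<Longrightarrow> U t > 0"
proof -
  have "V T < 0 \<and> (U T > 0 \<longrightarrow> (\<forall>t\<in>{0..T}. U t > 0))"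
  proof (cases "\<forall>t\<in>{0..T}. U t > 0")
    case True
    have "V T \<le> - (U T * tanh (th * T))" by (rule shoot_compare(1)[OF S i]) (use b True T in auto)
    moreover have "U T * tanh (th * T) > 0" using True T th_pos by (intro mult_pos_pos) auto
    ultimately show ?thesis using True by simp
  next
    case False
    then obtain s where s: "s \<in> {0..T}" "- U s \<ge> 0" by force
    have c: "continuous_on {0..T} (\<lambda>t. - U t)" by (intro continuous_intros ode_sol_continuous(1)[OF S])
    obtain t0 where t0: "t0 \<in> {0<..s}" "- U t0 = 0" "\<And>r. r \<in> {0..<t0} \<Longrightarrow> - U r < 0"
      by (rule first_hitting_time[OF c _ s]) (use i b mst_gt_1 in auto)
    have t0T: "0 < t0" "t0 \<le> T" using t0 s by auto
    have S0: "ode_sol (fc B) 0 t0 U V" by (rule ode_sol_subinterval[OF S]) (use t0T in auto)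
    have pre: "V q \<le> 0" "U q \<le> b" if q: "q \<in> {0..<t0}" for q
    proof -
      have Sq: "ode_sol (fc B) 0 q U V" by (rule ode_sol_subinterval[OF S]) (use q t0T in auto)
      have pos: "0 < U r" if "r \<in> {0..q}" for r using t0(3)[of r] that q by auto
      have "V q \<le> - (U q * tanh (th * q))" by (rule shoot_compare(1)[OF Sq i]) (use b pos q in auto)
      moreover have "U q * tanh (th * q) \<ge> 0" using pos[of q] q th_pos by (intro mult_nonneg_nonneg) auto
      ultimately show "V q \<le> 0" by simp
      show "U q \<le> b" by (rule shoot_compare(3)[OF Sq i]) (use b pos q in auto)
    qed
    have "(V t0)\<^sup>2 - F (U t0) = (V 0)\<^sup>2 - F (U 0)"
    proof (rule ode_energy[OF S0])
      fix q assume q: "q \<in> {0..t0}"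
      show "0 \<le> U q \<and> U q \<le> B" using pre(2)[of q] t0(2) t0(3)[of q] q b mst_gt_1 by (cases "q = t0") auto
    qed (use t0T in auto)
    then have "(V t0)\<^sup>2 > 0" using F_neg[of b] b mst_gt_1 t0(2) i by simp
    moreover have "V t0 \<le> 0"
    proof (rule tendsto_upperbound)
      show "(V \<longlongrightarrow> V t0) (at t0 within {0..t0})"
        using ode_sol_continuous(2)[OF S0] t0T by (simp add: continuous_on_def)
      show "\<forall>\<^sub>F x in at t0 within {0..t0}. V x \<le> 0"
        using pre(1) by (auto simp: eventually_at_filter intro!: always_eventually)
      show "at t0 within {0..t0} \<noteq> bot" using t0T by (simp add: at_within_Icc_at_left)
    qed
    ultimately have Vn: "V t0 < 0" by (cases "V t0 = 0") auto
    \<comment> \<open>The truncated force vanishes on negative values, so after the zero the tangent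
      line is the solution, by uniqueness.\<close>
    let ?l = "\<lambda>t. V t0 * (t - t0)"
    have S1: "ode_sol (fc B) t0 T U V" by (rule ode_sol_subinterval[OF S]) (use t0T in auto)
    have S2: "ode_sol (fc B) t0 T ?l (\<lambda>t. V t0)" unfolding ode_sol_def
    proof (intro ballI conjI)
      fix t assume t: "t \<in> {t0..T}"
      show "(?l has_real_derivative V t0) (at t within {t0..T})" by (auto intro!: derivative_eq_intros)
      have "fc B (?l t) = 0" using Vn t b mst_gt_1 by (intro fc_neg) (auto simp: mult_nonpos_nonneg)
      then show "((\<lambda>t. V t0) has_real_derivative fc B (?l t)) (at t within {t0..T})" by simp
    qed
    have B0: "B \<ge> 0" using b mst_gt_1 by simp
    have "U T = ?l T" "V T = V t0"
      using ode_sol_unique[OF S1 S2 fc_lipschitz[OF B0], of T] t0 t0T by auto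
    then show ?thesis using Vn t0T by (auto simp: mult_nonpos_nonneg not_less zero_less_mult_iff)
  qed
  then show "V T < 0" "U T > 0 \<Longrightarrow> t \<in> {0..T} \<Longrightarrow> U t > 0" by blast+
qed

end

context nls
begin

section \<open>Shooting\<close>

lemma ode_sol_fc_imp_f:
  assumes "ode_sol (fc B) a b U V" "\<And>t. t \<in> {a..b} \<Longrightarrow> 0 \<le> U t \<and> U t \<le> B"
  shows "ode_sol f a b U V"
  using assms unfolding ode_sol_def by (simp add: fc_eq)

section \<open>Small orbits below \<open>eta\<close>\<close>

lemma fc_eta_nonneg: "fc eta u \<ge> 0"
proof -
  have x: "0 \<le> max 0 (min eta u)" "max 0 (min eta u) \<le> eta" using eta_pos by auto
  have "0 \<le> kap * max 0 (min eta u)" using kap_pos x by simp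
  also have "\<dots> \<le> fc eta u" unfolding fc_def by (rule f_ge_kap[OF x])
  finally show ?thesis .
qed

lemma fc_eta_increasing:
  assumes S: "ode_sol (fc eta) 0 l A C" and C0: "C 0 = 0" and st: "0 \<le> s" "s \<le> t" "t \<le> l"
  shows "C t \<ge> 0" "A s \<le> A t"
proof -
  have C: "C t \<ge> 0" if t: "0 \<le> t" "t \<le> l" for t
  proof -
    have S': "ode_sol (fc eta) 0 t A C" by (rule ode_sol_subinterval[OF S]) (use t in auto)
    have "- C t \<le> - C 0"
      by (rule has_real_derivative_nonpos_imp_le[where g = "\<lambda>t. - C t", OF t(1) DERIV_minus[OF ode_solD(2)[OF S']]])
        (use fc_eta_nonneg in auto)
    then show ?thesis using C0 by simp
  qed
  then show "C t \<ge> 0" using st by auto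
  have S': "ode_sol (fc eta) s t A C" by (rule ode_sol_subinterval[OF S]) (use st in auto)
  have "- A t \<le> - A s"
    by (rule has_real_derivative_nonpos_imp_le[where g = "\<lambda>t. - A t", OF st(2) DERIV_minus[OF ode_solD(1)[OF S']]])
      (use C st in auto)
  then show "A s \<le> A t" by simp
qed

text \<open>Until a first meeting point the monotone force keeps the slopes ordered as well, so the
  gap between the two solutions never shrinks and they cannot meet.\<close>

lemma fc_eta_strict_mono:
  assumes S: "ode_sol (fc eta) 0 l A C" "ode_sol (fc eta) 0 l A' C'" and 0: "C 0 = 0" "C' 0 = 0" "A 0 < A' 0" and l: "l \<ge> 0"
  shows "A l < A' l"
proof (rule ccontr)
  assume *: "\<not> A l < A' l"
  have c: "continuous_on {0..l} (\<lambda>t. A t - A' t)" by (intro continuous_intros ode_sol_continuous(1)[OF S(1)] ode_sol_continuous(1)[OF S(2)])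
  obtain t0 where t0: "t0 \<in> {0<..l}" "A t0 - A' t0 = 0" "\<And>r. r \<in> {0..<t0} \<Longrightarrow> A r - A' r < 0"
    by (rule first_hitting_time[OF c, of l]) (use * l 0 in auto)
  have sub: "ode_sol (fc eta) 0 t A C" "ode_sol (fc eta) 0 t A' C'" if "t \<in> {0..t0}" for t
    by (rule ode_sol_subinterval[OF S(1)]; use that t0 in simp) (rule ode_sol_subinterval[OF S(2)]; use that t0 in simp)
  have C: "C t - C' t \<le> 0" if t: "t \<in> {0..t0}" for t
  proof -
    have "C t - C' t \<le> C 0 - C' 0"
    proof (rule has_real_derivative_nonpos_imp_le[where g = "\<lambda>t. C t - C' t"])
      fix s assume s: "s \<in> {0..t}"
      show "((\<lambda>t. C t - C' t) has_real_derivative fc eta (A s) - fc eta (A' s)) (at s within {0..t})"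
        by (rule DERIV_diff[OF ode_solD(2)[OF sub(1)[OF t] s] ode_solD(2)[OF sub(2)[OF t] s]])
      have "A s \<le> A' s" using t0(2) t0(3)[of s] s t by (cases "s = t0") auto
      then show "fc eta (A s) - fc eta (A' s) \<le> 0" using fc_eta_mono by simp
    qed (use t in auto)
    then show ?thesis using 0 by simp
  qed
  have t00: "t0 \<in> {0..t0}" "0 \<le> t0" using t0(1) by auto
  have "A t0 - A' t0 \<le> A 0 - A' 0"
  proof (rule has_real_derivative_nonpos_imp_le[where g = "\<lambda>t. A t - A' t", OF t00(2)])
    fix s assume s: "s \<in> {0..t0}"
    show "((\<lambda>t. A t - A' t) has_real_derivative C s - C' s) (at s within {0..t0})"
      by (rule DERIV_diff[OF ode_solD(1)[OF sub(1)[OF t00(1)] s] ode_solD(1)[OF sub(2)[OF t00(1)] s]])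
    show "C s - C' s \<le> 0" by (rule C[OF s])
  qed
  then show False using t0 0 by simp
qed

text \<open>\<open>c\<close> is a Dirichlet-to-Neumann map: the slope at the vertex of the small
  solution with vertex value \<open>v\<close>. Strict monotonicity of the final value in the initial
  height lets the height be recovered continuously from \<open>v\<close>, so that a single shooting
  parameter remains.\<close>

lemma small_branch:
  assumes l: "l > 0"
  obtains c where "continuous_on {0..eta} c" "c 0 = 0"
    "\<And>v. v \<in> {0<..eta} \<Longrightarrow> 0 < c v \<and> c v \<le> v"
    "\<And>v. v \<in> {0<..eta} \<Longrightarrow> \<exists>A C. ode_sol f 0 l A C \<and> C 0 = 0 \<and> A l = v \<and> C l = c v \<and> (\<forall>t\<in>{0..l}. 0 \<le> A t \<and> A t \<le> eta)"
proof -
  have e0: "eta \<ge> 0" using eta_pos by simp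
  obtain A C where S: "\<And>a. ode_sol (fc eta) 0 l (A a) (C a)" and A0: "\<And>a. A a 0 = a" and C0: "\<And>a. C a 0 = 0"
    and cA: "continuous_on UNIV (\<lambda>a. A a l)" and cC: "continuous_on UNIV (\<lambda>a. C a l)"
    using ode_family[OF fc_lipschitz[OF e0] less_imp_le[OF l]] by blast
  have sm: "A a l < A a' l" if "a < a'" for a a'
    by (rule fc_eta_strict_mono[OF S S]) (use that A0 C0 l in auto)
  have inj: "inj_on (\<lambda>a. A a l) {0..eta}" using sm by (intro linorder_inj_onI) (auto simp: less_le)
  have zero: "A 0 l = 0" "C 0 l = 0"
  proof -
    have "ode_sol (fc eta) 0 l (\<lambda>t. 0) (\<lambda>t. 0)" unfolding ode_sol_def by (simp add: fc_neg e0)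
    from ode_sol_unique[OF S[of 0] this fc_lipschitz[OF e0], of l] show "A 0 l = 0" "C 0 l = 0"
      using A0 C0 l by auto
  qed
  \<comment> \<open>Solutions do not decrease, so initial heights up to \<open>eta\<close> reach
    every vertex value up to \<open>eta\<close>.\<close>
  have top: "A eta l \<ge> eta" using fc_eta_increasing(2)[OF S C0, of 0 l eta] A0 l by simp
  define ia where "ia = the_inv_into {0..eta} (\<lambda>a. A a l)"
  have ia1: "ia (A a l) = a" if "a \<in> {0..eta}" for a unfolding ia_def by (rule the_inv_into_f_f[OF inj that])
  have img: "{0..eta} \<subseteq> (\<lambda>a. A a l) ` {0..eta}"
  proof
    fix v assume v: "v \<in> {0..eta}"
    have "\<exists>a\<ge>0. a \<le> eta \<and> A a l = v"
      by (rule IVT'[of "\<lambda>a. A a l"]) (use v zero top e0 continuous_on_subset[OF cA] in auto)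
    then show "v \<in> (\<lambda>a. A a l) ` {0..eta}" by auto
  qed
  have ia2: "ia v \<in> {0..eta} \<and> A (ia v) l = v" if v: "v \<in> {0..eta}" for v
  proof -
    obtain a where a: "a \<in> {0..eta}" "v = A a l" using img v by blast
    then show ?thesis using ia1[OF a(1)] by simp
  qed
  have "continuous_on ((\<lambda>a. A a l) ` {0..eta}) ia"
    by (rule continuous_on_inv) (use ia1 continuous_on_subset[OF cA] in auto)
  then have cia: "continuous_on {0..eta} ia" using img by (rule continuous_on_subset)
  define c where "c v = C (ia v) l" for v
  show ?thesis
  proof (rule that[of c])
    show "continuous_on {0..eta} c" unfolding c_def by (rule continuous_on_compose2[OF cC cia]) auto
    have "ia 0 = 0" using ia1[of 0] zero e0 by simp
    then show "c 0 = 0" using zero by (simp add: c_def)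
    fix v assume v: "v \<in> {0<..eta}"
    have a: "ia v \<in> {0..eta}" "A (ia v) l = v" using ia2[of v] v by auto
    have range: "ia v \<le> A (ia v) t \<and> A (ia v) t \<le> v" if t: "t \<in> {0..l}" for t
      using fc_eta_increasing(2)[OF S C0, of 0 t "ia v"] fc_eta_increasing(2)[OF S C0, of t l "ia v"] t a(2) A0 by auto
    have a0: "ia v > 0" using a zero v by (cases "ia v = 0") auto
    have r: "0 \<le> A (ia v) t \<and> A (ia v) t \<le> eta" if t: "t \<in> {0..l}" for t using range[OF t] a0 v by auto
    have Sf: "ode_sol f 0 l (A (ia v)) (C (ia v))" by (rule ode_sol_fc_imp_f[OF S r])
    \<comment> \<open>The slope grows at least at rate \<open>kap * ia v\<close>, hence is positive
      at the vertex. The upper bound on it comes afterwards from the energy,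
      \<open>(c v)^2 = F v - F (ia v) \<le> v^2\<close>.\<close>
    have "kap * ia v * l - C (ia v) l \<le> kap * ia v * 0 - C (ia v) 0"
    proof (rule has_real_derivative_nonpos_imp_le[where g = "\<lambda>t. kap * ia v * t - C (ia v) t"])
      fix t assume t: "t \<in> {0..l}"
      show "((\<lambda>t. kap * ia v * t - C (ia v) t) has_real_derivative kap * ia v - f (A (ia v) t)) (at t within {0..l})"
        using DERIV_diff[OF DERIV_cmult[OF DERIV_ident] ode_solD(2)[OF Sf t]] by simp
      have "kap * ia v \<le> kap * A (ia v) t" using range[OF t] kap_pos by (intro mult_left_mono) auto
      also have "\<dots> \<le> f (A (ia v) t)" using r[OF t] by (intro f_ge_kap) auto
      finally show "kap * ia v - f (A (ia v) t) \<le> 0" by simp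
    qed (use l in simp)
    then have "kap * ia v * l \<le> c v" using C0 by (simp add: c_def)
    moreover have "kap * ia v * l > 0" using kap_pos a0 l by simp
    ultimately have cpos: "c v > 0" by linarith
    have "(C (ia v) l)\<^sup>2 - F (A (ia v) l) = (C (ia v) 0)\<^sup>2 - F (A (ia v) 0)"
      by (rule ode_energy[OF S r]) (use l in auto)
    moreover have "F (ia v) \<ge> 0" using a eta_lt_1 mst_gt_1 by (intro F_nonneg) auto
    ultimately have "(c v)\<^sup>2 \<le> v\<^sup>2" using F_le_square[of v] a(2) A0 C0 by (simp add: c_def)
    then have "c v \<le> v" by (rule power2_le_imp_le) (use v in auto)
    then show "0 < c v \<and> c v \<le> v" using cpos by simp
    show "\<exists>A C. ode_sol f 0 l A C \<and> C 0 = 0 \<and> A l = v \<and> C l = c v \<and> (\<forall>t\<in>{0..l}. 0 \<le> A t \<and> A t \<le> eta)"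
      using Sf C0 a(2) r by (intro exI[of _ "A (ia v)"] exI[of _ "C (ia v)"]) (simp add: c_def)
  qed
qed

lemma phi_tendsto_0: "(phi \<longlongrightarrow> 0) at_top"
proof (rule tendsto_sandwich)
  show "\<forall>\<^sub>F x in at_top. 0 \<le> phi x" using phi_pos less_imp_le by (intro always_eventually) blast
  show "\<forall>\<^sub>F x in at_top. phi x \<le> mst * 2 powr (1 / th) * exp (- x)"
    unfolding eventually_at_top_linorder using phi_exp_bound by blast
  have "((\<lambda>x::real. exp (- x)) \<longlongrightarrow> 0) at_top"
    by (rule filterlim_compose[OF exp_at_bot filterlim_uminus_at_bot_at_top])
  from tendsto_mult_right_zero[OF this] show "((\<lambda>x. mst * 2 powr (1 / th) * exp (- x)) \<longlongrightarrow> 0) at_top" .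
qed auto

text \<open>\<open>U\<close> (bump) and \<open>A\<close> (small) are read from the far end of an edge towards the central vertex, so the outgoing
  derivatives there are \<open>- V l\<close>, \<open>- C l\<close> and, on half-lines, \<open>- R v\<close>; the last conjunct is Kirchhoff's condition.\<close>
definition profile where
  "profile m n h l v b U V A C \<longleftrightarrow> 0 < v \<and> v \<le> eta \<and> mst \<le> b \<and> ode_sol f 0 l U V \<and> U l = v \<and> V 0 = 0 \<and> (\<forall>t\<in>{0..l}. 0 < U t \<and> U t \<le> b \<and> V t \<le> 0 \<and> (V t)\<^sup>2 = F (U t) - F b) \<and>
     ode_sol f 0 l A C \<and> C 0 = 0 \<and> A l = v \<and> (\<forall>t\<in>{0..l}. 0 \<le> A t \<and> A t \<le> eta) \<and> 0 \<le> C l \<and> C l \<le> v \<and>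
     m * V l + n * C l + h * R v = 0"

text \<open>Intermediate value theorem for the Kirchhoff defect \<open>K\<close> as a function of
  the bump height \<open>b\<close>, between the soliton height \<open>mst\<close> (defect negative
  because \<open>m \<le> h\<close>) and \<open>mst + \<delta>\<close> (defect positive because the
  slope is bounded away from 0 while the vertex value is tiny).\<close>

lemma shooting:
  fixes m n h v1 \<delta> :: real
  assumes m: "m > 0" and n: "n > 0" and h: "m \<le> h" and v1: "v1 > 0" and \<delta>: "\<delta> > 0" "\<delta> < 1"
  obtains l0 where "l0 > 0" "\<And>l. l \<ge> l0 \<Longrightarrow> \<exists>v b U V A C. v \<le> v1 \<and> b \<le> mst + \<delta> \<and> profile m n h l v b U V A C"
proof -
  define B where "B = mst + 1"
  define b1 where "b1 = mst + \<delta>"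
  have B0: "B \<ge> 0" using mst_gt_1 by (simp add: B_def)
  have b1: "mst < b1" "b1 < B" using \<delta> by (auto simp: b1_def B_def)
  \<comment> \<open>The least slope, in modulus, with which an orbit of initial height
    \<open>b1\<close> can arrive at a vertex value in \<open>{0..mst}\<close>.\<close>
  define \<sigma> where "\<sigma> = sqrt (- F b1)"
  have Fb1: "F b1 < 0" using F_neg[of b1] b1 mst_gt_1 by simp
  have \<sigma>: "\<sigma> > 0" using Fb1 by (simp add: \<sigma>_def)
  have nh: "n + h > 0" using m n h by simp
  \<comment> \<open>The last bound makes the outflow \<open>(n + h) * r\<close> at most half of the
    inflow \<open>m * \<sigma>\<close>.\<close>
  define r where "r = min v1 (min eta (m * \<sigma> / (2 * (n + h))))"
  have r: "r > 0" "r \<le> v1" "r \<le> eta" "r \<le> m * \<sigma> / (2 * (n + h))"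
    using v1 eta_pos m \<sigma> nh by (auto simp: r_def)
  have "\<forall>\<^sub>F x in at_top. phi x < r * mst / B"
    using phi_tendsto_0 r mst_gt_1 B_def by (intro order_tendstoD(2)[OF phi_tendsto_0]) auto
  \<comment> \<open>The comparison envelope at \<open>l\<close> is \<open>b * phi l / mst\<close>,
    so this makes it at most \<open>r\<close> for all \<open>b \<le> B\<close> at once.\<close>
  then obtain l0 where l0: "\<And>x. x \<ge> l0 \<Longrightarrow> phi x < r * mst / B" unfolding eventually_at_top_linorder by blast
  show ?thesis
  proof (rule that[of "max 1 l0"])
    fix l :: real assume l: "l \<ge> max 1 l0"
    have lp: "l > 0" using l by simp
    have small: "b * cosh (th * l) powr (- 1 / th) \<le> r" if b: "0 \<le> b" "b \<le> B" for b
    proof -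
      have "b * cosh (th * l) powr (- 1 / th) = b * (phi l / mst)" using mst_gt_1 by (simp add: phi_def)
      also have "\<dots> \<le> B * ((r * mst / B) / mst)"
        using b l0[of l] l mst_gt_1 phi_pos[of l] by (intro mult_mono divide_right_mono) auto
      also have "\<dots> = r" using mst_gt_1 by (simp add: B_def)
      finally show ?thesis .
    qed
    obtain c where cc: "continuous_on {0..eta} c" and c0: "c 0 = 0"
      and cv: "\<And>v. v \<in> {0<..eta} \<Longrightarrow> 0 < c v \<and> c v \<le> v"
      and cA: "\<And>v. v \<in> {0<..eta} \<Longrightarrow> \<exists>A C. ode_sol f 0 l A C \<and> C 0 = 0 \<and> A l = v \<and> C l = c v \<and> (\<forall>t\<in>{0..l}. 0 \<le> A t \<and> A t \<le> eta)"
      using small_branch[OF lp] by blast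
    obtain U V where S: "\<And>a. ode_sol (fc B) 0 l (U a) (V a)" and U0: "\<And>a. U a 0 = a" and V0: "\<And>a. V a 0 = 0"
      and cU: "continuous_on UNIV (\<lambda>a. U a l)" and cV: "continuous_on UNIV (\<lambda>a. V a l)"
      using ode_family[OF fc_lipschitz[OF B0] less_imp_le[OF lp]] by blast
    have soliton: "U mst t = phi t \<and> V mst t = - (phi t * tanh (th * t))" if t: "t \<in> {0..l}" for t
    proof -
      have "ode_sol (fc B) 0 l phi (\<lambda>x. - (phi x * tanh (th * x)))"
      proof -
        have "fc B (phi x) = f (phi x)" for x using phi_pos[of x] phi_le[of x] by (intro fc_eq) (auto simp: B_def)
        then show ?thesis using phi_ode_sol[of 0 l] unfolding ode_sol_def by simp
      qed
      from ode_sol_unique[OF S[of mst] this fc_lipschitz[OF B0] _ _ t] show ?thesis using U0 V0 by simp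
    qed
    have pos: "U b t > 0" if b: "mst \<le> b" "b \<le> b1" and Ul: "U b l > 0" and t: "t \<in> {0..l}" for b t
    proof (cases "b = mst")
      case True then show ?thesis using soliton[OF t] phi_pos by simp
    next
      case False
      then show ?thesis
        using shoot_negative_slope(2)[OF S[of b] U0 V0 _ _ lp Ul t] b b1 by simp
    qed
    have sc: "V b t \<le> - (U b t * tanh (th * t))" "U b t \<le> b * cosh (th * t) powr (- 1 / th)" "U b t \<le> b"
       "(V b t)\<^sup>2 = F (U b t) - F b"
      if b: "mst \<le> b" "b \<le> b1" and Ul: "U b l > 0" and t: "t \<in> {0..l}" for b t
      by (rule shoot_compare[OF S[of b] U0 V0 _ _ pos[OF b Ul] t]; use b b1 in simp)+
    have Ur: "U b l \<le> r" if b: "mst \<le> b" "b \<le> b1" for b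
    proof (cases "U b l > 0")
      case True
      have "U b l \<le> b * cosh (th * l) powr (- 1 / th)" by (rule sc(2)[OF b True]) (use lp in auto)
      also have "\<dots> \<le> r" using b b1 mst_gt_1 by (intro small) auto
      finally show ?thesis .
    qed (use r in simp)
    \<comment> \<open>The positive part keeps the Kirchhoff defect \<open>K\<close> defined when the orbit crosses 0 before \<open>l\<close>.\<close>
    define v where "v b = max 0 (U b l)" for b
    have v: "v b \<in> {0..eta}" if "b \<in> {mst..b1}" for b using Ur[of b] that r by (auto simp: v_def)
    define K where "K b = - m * V b l - n * c (v b) - h * R (v b)" for b
    have contv: "continuous_on {mst..b1} v" unfolding v_def
      by (intro continuous_on_max continuous_on_const continuous_on_subset[OF cU]) auto
    have contK: "continuous_on {mst..b1} K" unfolding K_def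
      by (intro continuous_intros continuous_on_subset[OF cV] continuous_on_compose2[OF cc contv]
          continuous_on_compose2[OF R_continuous[of UNIV] contv]) (use v in auto)
    have ll: "l \<in> {0..l}" using lp by simp
    \<comment> \<open>The bumps and the tails on the half-lines are pieces of the same soliton with
      the same slope in modulus. They contribute \<open>m - h \<le> 0\<close> times that slope, and
      the small edges make the sum strictly negative.\<close>
    have Kmst: "K mst < 0"
    proof -
      have vm: "v mst = phi l" using soliton[OF ll] phi_pos[of l] by (simp add: v_def)
      have "F (phi l) \<ge> 0" unfolding F_phi by simp
      then have "R (phi l) = phi l * tanh (th * l)" using phi_pos[of l] lp th_pos
        unfolding R_def max_absorb2[OF \<open>F (phi l) \<ge> 0\<close>] unfolding F_phi by simp
      then have "K mst = (m - h) * (phi l * tanh (th * l)) - n * c (phi l)"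
        using soliton[OF ll] by (simp add: K_def vm algebra_simps)
      moreover have "(m - h) * (phi l * tanh (th * l)) \<le> 0"
        using h phi_pos[of l] lp th_pos by (intro mult_nonpos_nonneg) auto
      moreover have "phi l \<in> {0<..eta}" using v[of mst] vm phi_pos[of l] b1 by simp
      then have "n * c (phi l) > 0" using cv n by simp
      ultimately show ?thesis by linarith
    qed
    have Vneg: "V b l < 0" if "mst < b" "b \<le> b1" for b
      by (rule shoot_negative_slope(1)[OF S[of b] U0 V0 _ _ lp]) (use that b1 in auto)
    \<comment> \<open>After a crossing the clipped vertex value is 0 and only
      \<open>- m * V b l > 0\<close> remains; a zero of \<open>K\<close> therefore belongs to an
      orbit that is positive up to \<open>l\<close>.\<close>
    have Kneg: "K b > 0" if "mst < b" "b \<le> b1" "U b l \<le> 0" for b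
      using Vneg[OF that(1,2)] that(3) m c0 by (simp add: K_def v_def mult_pos_neg)
    have Kb1: "K b1 > 0"
    proof (cases "U b1 l > 0")
      case False then show ?thesis using Kneg[of b1] b1 by simp
    next
      case True
      have vb: "v b1 = U b1 l" using True by (simp add: v_def)
      have vr: "v b1 \<le> r" "v b1 > 0" using Ur[of b1] b1 True vb by auto
      have "F (v b1) \<ge> 0" using vr r eta_lt_1 mst_gt_1 by (intro F_nonneg) auto
      then have "(V b1 l)\<^sup>2 \<ge> - F b1" using sc(4)[of b1 l] b1 True ll vb by simp
      then have "\<sigma> \<le> \<bar>V b1 l\<bar>" unfolding \<sigma>_def using real_sqrt_le_mono by fastforce
      then have "m * \<sigma> \<le> m * - V b1 l" using Vneg[of b1] b1 m by (intro mult_left_mono) auto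
      moreover have "n * c (v b1) \<le> n * v b1" using cv[of "v b1"] vr r n by (intro mult_left_mono) auto
      moreover have "h * R (v b1) \<le> h * v b1" using R_le[of "v b1"] vr m h by (intro mult_left_mono) auto
      moreover have "n * v b1 + h * v b1 \<le> m * \<sigma> / 2"
      proof -
        have "(n + h) * v b1 \<le> (n + h) * (m * \<sigma> / (2 * (n + h)))" using vr r nh by (intro mult_left_mono) auto
        also have "\<dots> = m * \<sigma> / 2"
          using nonzero_mult_divide_mult_cancel_left[of "n + h" "m * \<sigma>" 2] nh by (simp add: mult.commute)
        finally show ?thesis by (simp only: distrib_right)
      qed
      moreover have "m * \<sigma> > 0" using m \<sigma> by simp
      ultimately show ?thesis unfolding K_def by linarith
    qed
    have "\<exists>b\<ge>mst. b \<le> b1 \<and> K b = 0"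
      by (rule IVT'[of K]) (use Kmst Kb1 contK b1 in auto)
    then obtain b where b: "mst \<le> b" "b \<le> b1" "K b = 0" by blast
    have bm: "b \<noteq> mst" using b Kmst by auto
    have Ul: "U b l > 0"
    proof (rule ccontr)
      assume "\<not> U b l > 0"
      then have "K b > 0" using bm b by (intro Kneg) auto
      then show False using b by simp
    qed
    have vb: "v b = U b l" using Ul by (simp add: v_def)
    have vb': "v b \<in> {0<..eta}" using v[of b] vb Ul b by auto
    obtain A C where AC: "ode_sol f 0 l A C" "C 0 = 0" "A l = v b" "C l = c (v b)" "\<forall>t\<in>{0..l}. 0 \<le> A t \<and> A t \<le> eta"
      using cA[OF vb'] by blast
    have Sf: "ode_sol f 0 l (U b) (V b)"
    proof (rule ode_sol_fc_imp_f[OF S])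
      fix t assume t: "t \<in> {0..l}"
      show "0 \<le> U b t \<and> U b t \<le> B" using pos[OF b(1,2) Ul t] sc(3)[OF b(1,2) Ul t] b b1 by simp
    qed
    have all: "0 < U b t \<and> U b t \<le> b \<and> V b t \<le> 0 \<and> (V b t)\<^sup>2 = F (U b t) - F b" if t: "t \<in> {0..l}" for t
    proof -
      have "U b t * tanh (th * t) \<ge> 0" using pos[OF b(1,2) Ul t] t th_pos by (intro mult_nonneg_nonneg) auto
      then show ?thesis using pos[OF b(1,2) Ul t] sc[OF b(1,2) Ul t] by simp
    qed
    have "v b \<le> v1 \<and> b \<le> mst + \<delta> \<and> profile m n h l (v b) b (U b) (V b) A C"
      unfolding profile_def
    proof (intro conjI ballI)
      show "0 < v b" "v b \<le> eta" using vb' by auto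
      show "v b \<le> v1" using Ur[OF b(1,2)] vb r by simp
      show "mst \<le> b" "b \<le> mst + \<delta>" using b by (auto simp: b1_def)
      show "m * V b l + n * C l + h * R (v b) = 0" using b(3) AC(4) by (simp add: K_def)
      show "0 \<le> C l" "C l \<le> v b" using cv[OF vb'] AC(4) by auto
    qed (use Sf vb V0 all AC in auto)
    then show "\<exists>v b U V A C. v \<le> v1 \<and> b \<le> mst + \<delta> \<and> profile m n h l v b U V A C" by blast
  qed simp
qed

end

section \<open>A bound state of small action\<close>

text \<open>Shooting starts at the far end of an edge, whereas edges of the graph are parametrized
  from the vertex.\<close>

lemma ode_sol_reflect:
  assumes S: "ode_sol g 0 l U V"
  shows "ode_sol g 0 l (\<lambda>x. U (l - x)) (\<lambda>x. - V (l - x))"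
  unfolding ode_sol_def
proof (intro ballI conjI)
  fix x assume x: "x \<in> {0..l}"
  have lx: "l - x \<in> {0..l}" using x by auto
  have img: "(\<lambda>x. l - x) ` {0..l} = {0..l}" by (auto simp: image_iff intro!: bexI[of _ "l - _"])
  have d: "((\<lambda>x. l - x) has_real_derivative - 1) (at x within {0..l})" by (auto intro!: derivative_eq_intros)
  have "((U \<circ> (\<lambda>x. l - x)) has_real_derivative V (l - x) * - 1) (at x within {0..l})"
    by (rule DERIV_image_chain[OF _ d]) (use ode_solD(1)[OF S lx] in \<open>simp add: img\<close>)
  then show "((\<lambda>x. U (l - x)) has_real_derivative - V (l - x)) (at x within {0..l})" by (simp add: o_def)
  have "((V \<circ> (\<lambda>x. l - x)) has_real_derivative g (U (l - x)) * - 1) (at x within {0..l})"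
    by (rule DERIV_image_chain[OF _ d]) (use ode_solD(2)[OF S lx] in \<open>simp add: img\<close>)
  then have "((\<lambda>x. V (l - x)) has_real_derivative - g (U (l - x))) (at x within {0..l})" by (simp add: o_def)
  from DERIV_minus[OF this] show "((\<lambda>x. - V (l - x)) has_real_derivative g (U (l - x))) (at x within {0..l})" by simp
qed

lemma set_integrable_exp_halfline: "set_integrable lborel {0..} (\<lambda>x::real. exp (- 2 * x))"
proof -
  have "(\<lambda>x::real. exp (- 2 * x)) absolutely_integrable_on {0..}"
    by (intro nonnegative_absolutely_integrable_1 integrable_on_exp_minus_to_infinity) auto
  moreover have "(\<lambda>x::real. indicator {0..} x *\<^sub>R exp (- 2 * x)) \<in> borel_measurable lborel" by measurable
  ultimately show ?thesis unfolding set_integrable_def using integrable_completion by blast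
qed

lemma L2_on_halfline_exp:
  assumes c: "continuous_on {0..} q" and b: "\<And>x. x \<ge> 0 \<Longrightarrow> \<bar>q x\<bar> \<le> K * exp (- x)"
  shows "L2_on {0..} q"
proof -
  have m: "set_borel_measurable lborel {0..} q"
    using borel_measurable_continuous_on_indicator[OF _ c] unfolding set_borel_measurable_def by simp
  have c2: "continuous_on {0..} (\<lambda>x. (q x)\<^sup>2)" by (intro continuous_intros c)
  have m2: "(\<lambda>x. indicator {0..} x *\<^sub>R (q x)\<^sup>2) \<in> borel_measurable lborel"
    using borel_measurable_continuous_on_indicator[OF _ c2] by simp
  have "set_integrable lborel {0..} (\<lambda>x. K\<^sup>2 * exp (- 2 * x))"
    by (intro set_integrable_mult_right impI set_integrable_exp_halfline)
  then have "set_integrable lborel {0..} (\<lambda>x. (q x)\<^sup>2)" unfolding set_integrable_def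
  proof (rule Bochner_Integration.integrable_bound)
    have "(q x)\<^sup>2 \<le> K\<^sup>2 * exp (- 2 * x)" if "x \<ge> 0" for x
    proof -
      have "\<bar>q x\<bar>\<^sup>2 \<le> (K * exp (- x))\<^sup>2" by (rule power_mono[OF b[OF that]]) simp
      also have "(K * exp (- x))\<^sup>2 = K\<^sup>2 * exp (- 2 * x)"
        by (simp add: power_mult_distrib power2_eq_square exp_add[symmetric])
      finally show ?thesis by simp
    qed
    then show "AE x in lborel. norm (indicator {0..} x *\<^sub>R (q x)\<^sup>2) \<le> norm (indicator {0..} x *\<^sub>R (K\<^sup>2 * exp (- 2 * x)))"
      by (intro AE_I2) (auto simp: indicator_def)
  qed (rule m2)
  then show ?thesis using m by (simp add: L2_on_def)
qed

context nls
begin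

lemma ode_sol_ac_on:
  assumes S: "ode_sol f 0 l w dw"
  shows "ac_on 0 l w dw" "ac_on 0 l dw (\<lambda>x. f (w x))" "continuous_on {0..l} (\<lambda>x. f (w x))"
proof -
  note c = ode_sol_continuous[OF S]
  show cf: "continuous_on {0..l} (\<lambda>x. f (w x))" by (rule continuous_on_compose2[OF f_continuous[of UNIV] c(1)]) auto
  show "ac_on 0 l w dw" by (rule ac_on_deriv[OF ode_solD(1)[OF S] c(2)])
  show "ac_on 0 l dw (\<lambda>x. f (w x))" by (rule ac_on_deriv[OF ode_solD(2)[OF S] cf])
qed

lemma ode_sol_H1_on:
  assumes S: "ode_sol f 0 l w dw"
  shows "H1_on {0..l} w dw"
  by (rule H1_on_of_ac_on[OF ode_sol_ac_on(1)[OF S] L2_on_continuous[OF ode_sol_continuous(2)[OF S]]])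

lemma weak_integrand: "d * e + u * y - \<bar>u\<bar> powr (p - 2) * u * y = d * e + y * f u"
  by (simp add: f_def algebra_simps)

lemma edge_weak_form:
  assumes S: "ode_sol f 0 l w dw" and H: "H1_on {0..l} \<eta> d\<eta>" and l: "l \<ge> 0"
  shows "weak {0..l} w dw \<eta> d\<eta> = dw l * \<eta> l - dw 0 * \<eta> 0"
proof -
  have E: "ac_on 0 l \<eta> d\<eta>" by (rule H1_on_ac_on[OF H]) simp
  have L: "L2_on {0..l} \<eta>" "L2_on {0..l} d\<eta>" using H unfolding H1_on_def by blast+
  have i: "set_integrable lborel {0..l} (\<lambda>x. dw x * d\<eta> x + \<eta> x * f (w x))"
    by (intro set_integral_add L2_on_mult L L2_on_continuous ode_sol_continuous(2)[OF S] ode_sol_ac_on(3)[OF S])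
  show ?thesis unfolding weak_integrand set_borel_integral_eq_integral(2)[OF i]
    by (rule ac_on_integral_mult[OF l ode_sol_ac_on(2)[OF S] E])
qed

lemma action_density_integral:
  assumes H: "H1_on I u du" and I: "I = {0..} \<or> I = {0..l}"
  shows "set_integrable lborel I (\<lambda>x. ((du x)\<^sup>2 + F (u x)) / 2)"
    "E1 I u du / 2 - Ep I u / p = (LINT x:I|lborel. ((du x)\<^sup>2 + F (u x)) / 2)"
proof -
  obtain M where M: "\<And>x. x \<in> I \<Longrightarrow> \<bar>u x\<bar> \<le> M" using H1_on_bounded[OF H I] by blast
  have Ld: "L2_on I du" and Lu: "L2_on I u" using H unfolding H1_on_def by blast+
  have Ai: "set_integrable lborel I (\<lambda>x. (du x)\<^sup>2 + (u x)\<^sup>2)"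
    using Ld Lu by (intro set_integral_add) (auto simp: L2_on_def)
  have Bi: "set_integrable lborel I (\<lambda>x. \<bar>u x\<bar> powr p)" by (rule abs_powr_p_integrable[OF Lu M])
  have A2: "set_integrable lborel I (\<lambda>x. ((du x)\<^sup>2 + (u x)\<^sup>2) / 2)"
    and B2: "set_integrable lborel I (\<lambda>x. \<bar>u x\<bar> powr p / p)" using Ai Bi by auto
  have eq: "(\<lambda>x. ((du x)\<^sup>2 + (u x)\<^sup>2) / 2 - \<bar>u x\<bar> powr p / p) = (\<lambda>x. ((du x)\<^sup>2 + F (u x)) / 2)"
    by (simp add: F_def add_divide_distrib diff_divide_distrib add_diff_eq)
  show "set_integrable lborel I (\<lambda>x. ((du x)\<^sup>2 + F (u x)) / 2)" using set_integral_diff(1)[OF A2 B2] unfolding eq .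
  show "E1 I u du / 2 - Ep I u / p = (LINT x:I|lborel. ((du x)\<^sup>2 + F (u x)) / 2)"
    using set_integral_diff(2)[OF A2 B2] unfolding eq E1_def Ep_def by simp
qed

text \<open>For a solution the integral of \<open>dw^2 + w * f w\<close> is a pure boundary term,
  and below \<open>eta\<close> this integrand dominates \<open>kap * (dw^2 + F w)\<close> because
  \<open>f w \<ge> kap * w\<close>.\<close>

lemma small_edge_action:
  assumes S: "ode_sol f 0 l w dw" and l: "l \<ge> 0" and r: "\<And>x. x \<in> {0..l} \<Longrightarrow> 0 \<le> w x \<and> w x \<le> eta" and dl: "dw l = 0"
  shows "E1 {0..l} w dw / 2 - Ep {0..l} w / p \<le> - (dw 0 * w 0) / (2 * kap)"
proof -
  note H = ode_sol_H1_on[OF S]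
  note D = action_density_integral[OF H disjI2[OF refl]]
  note hk = set_borel_integral_eq_integral
  have k1: "kap \<le> 1" "kap > 0" using p_gt_2 by (auto simp: kap_def)
  have i: "set_integrable lborel {0..l} (\<lambda>x. dw x * dw x + w x * f (w x))"
    by (intro set_integral_add L2_on_mult L2_on_continuous ode_sol_continuous[OF S] ode_sol_ac_on(3)[OF S])
  have i': "set_integrable lborel {0..l} (\<lambda>x. (dw x * dw x + w x * f (w x)) / (2 * kap))" using i by simp
  have "E1 {0..l} w dw / 2 - Ep {0..l} w / p = integral {0..l} (\<lambda>x. ((dw x)\<^sup>2 + F (w x)) / 2)"
    using D hk(2)[OF D(1)] by simp
  also have "\<dots> \<le> integral {0..l} (\<lambda>x. (dw x * dw x + w x * f (w x)) / (2 * kap))"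
  proof (rule integral_le[OF hk(1)[OF D(1)] hk(1)[OF i']])
    fix x assume x: "x \<in> {0..l}"
    have "kap * (dw x)\<^sup>2 \<le> 1 * (dw x)\<^sup>2" by (rule mult_right_mono[OF k1(1)]) simp
    moreover have "kap * F (w x) \<le> kap * (w x)\<^sup>2" using k1 F_le_square by (intro mult_left_mono) auto
    moreover have "w x * (kap * w x) \<le> w x * f (w x)" using r[OF x] by (intro mult_left_mono f_ge_kap) auto
    ultimately have "kap * ((dw x)\<^sup>2 + F (w x)) \<le> dw x * dw x + w x * f (w x)"
      by (simp add: power2_eq_square algebra_simps)
    then show "((dw x)\<^sup>2 + F (w x)) / 2 \<le> (dw x * dw x + w x * f (w x)) / (2 * kap)"
      using k1 by (simp add: field_simps)
  qed
  also have "\<dots> = integral {0..l} (\<lambda>x. dw x * dw x + w x * f (w x)) / (2 * kap)" by simp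
  also have "integral {0..l} (\<lambda>x. dw x * dw x + w x * f (w x)) = dw l * w l - dw 0 * w 0"
    by (rule ac_on_integral_mult[OF l ode_sol_ac_on(2)[OF S] ode_sol_ac_on(1)[OF S]])
  finally show ?thesis using dl by simp
qed

text \<open>The action density is at most \<open>dw^2\<close>, and the energy identity gives
  \<open>dw \<le> R w + sqrt (- F b)\<close>; hence the density is at most the derivative of
  \<open>G w + sqrt (- F b) * w\<close>. The excess over \<open>G mst\<close> does not depend on
  \<open>l\<close> and vanishes as \<open>b\<close> tends to \<open>mst\<close>.\<close>

lemma bump_edge_action:
  assumes S: "ode_sol f 0 l w dw" and l: "l \<ge> 0" and b: "mst \<le> b"
    and r: "\<And>x. x \<in> {0..l} \<Longrightarrow> 0 < w x \<and> w x \<le> b \<and> 0 \<le> dw x \<and> (dw x)\<^sup>2 = F (w x) - F b"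
  shows "E1 {0..l} w dw / 2 - Ep {0..l} w / p \<le> G mst + sqrt (- F b) * b"
proof -
  note H = ode_sol_H1_on[OF S]
  note D = action_density_integral[OF H disjI2[OF refl]]
  note hk = set_borel_integral_eq_integral
  define s where "s = sqrt (- F b)"
  have Fb: "F b \<le> 0" using F_neg[of b] F_mst b mst_gt_1 by (cases "b = mst") auto
  have s0: "s \<ge> 0" using Fb by (simp add: s_def)
  let ?\<Psi> = "\<lambda>x. G (w x) + s * w x" and ?d = "\<lambda>x. R (w x) * dw x + s * dw x"
  have d: "(?\<Psi> has_real_derivative ?d x) (at x within {0..l})" if x: "x \<in> {0..l}" for x
    by (intro DERIV_add DERIV_cmult DERIV_chain2[OF G_deriv] ode_solD(1)[OF S x]) (use r[OF x] in auto)
  have "(?d has_integral (?\<Psi> l - ?\<Psi> 0)) {0..l}"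
    by (rule fundamental_theorem_of_calculus[OF l]) (use d in \<open>simp add: has_real_derivative_iff_has_vector_derivative\<close>)
  then have di: "?d integrable_on {0..l}" "integral {0..l} ?d = ?\<Psi> l - ?\<Psi> 0" by (auto simp: integral_unique has_integral_integrable)
  have "E1 {0..l} w dw / 2 - Ep {0..l} w / p = integral {0..l} (\<lambda>x. ((dw x)\<^sup>2 + F (w x)) / 2)"
    using D hk(2)[OF D(1)] by simp
  also have "\<dots> \<le> integral {0..l} ?d"
  proof (rule integral_le[OF hk(1)[OF D(1)] di(1)])
    fix x assume x: "x \<in> {0..l}"
    note rx = r[OF x]
    have "((dw x)\<^sup>2 + F (w x)) / 2 \<le> dw x * dw x" using rx Fb by (simp add: power2_eq_square)
    moreover have "dw x \<le> R (w x) + s"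
    proof (rule power2_le_imp_le)
      have "(R (w x) + s)\<^sup>2 \<ge> (R (w x))\<^sup>2 + s\<^sup>2" using s0 by (simp add: power2_sum)
      moreover have "(R (w x))\<^sup>2 \<ge> F (w x)" by (simp add: R_def)
      moreover have "s\<^sup>2 = - F b" using Fb by (simp add: s_def)
      ultimately show "(dw x)\<^sup>2 \<le> (R (w x) + s)\<^sup>2" using rx by linarith
      show "0 \<le> R (w x) + s" using s0 by simp
    qed
    then have "dw x * dw x \<le> (R (w x) + s) * dw x" using rx by (intro mult_right_mono) auto
    ultimately show "((dw x)\<^sup>2 + F (w x)) / 2 \<le> ?d x" by (simp add: distrib_right)
  qed
  also have "\<dots> \<le> G mst + s * b"
  proof -
    have "G (w l) \<le> G mst" "s * w l \<le> s * b" using r[of l] l s0 by (auto intro!: G_le_Gm mult_left_mono)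
    moreover have "G (w 0) \<ge> 0" "s * w 0 \<ge> 0" using r[of 0] l s0 by (auto intro!: G_nonneg)
    ultimately show ?thesis unfolding di(2) by linarith
  qed
  finally show ?thesis by (simp add: s_def)
qed

lemma tanh_abs_le_1: "\<bar>tanh (x::real)\<bar> \<le> 1"
  using tanh_real_lt_1[of x] tanh_real_gt_neg1[of x] by linarith

text \<open>On a half-line the competitor is a translate of the soliton starting at the vertex value
  \<open>phi a\<close>. Its action density equals \<open>dq^2\<close>, which is at most
  \<open>- q * dq\<close>, the derivative of \<open>- q^2 / 2\<close>; in the weak form the boundary
  term at infinity vanishes.\<close>

lemma soliton_tail:
  fixes a :: real
  defines "q \<equiv> \<lambda>x. phi (x + a)" and "dq \<equiv> \<lambda>x. - (phi (x + a) * tanh (th * (x + a)))"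
  assumes a: "a \<ge> 0"
  shows "H1_on {0..} q dq"
    "\<And>\<eta> d\<eta>. H1_on {0..} \<eta> d\<eta> \<Longrightarrow>
      weak {0..} q dq \<eta> d\<eta> = R (phi a) * \<eta> 0"
    "E1 {0..} q dq / 2 - Ep {0..} q / p \<le> (phi a)\<^sup>2 / 2"
proof -
  have qd: "(q has_real_derivative dq x) (at x)" for x
    unfolding q_def dq_def by (rule DERIV_shift[THEN iffD1, OF phi_deriv])
  have dqd: "(dq has_real_derivative f (q x)) (at x)" for x
    unfolding q_def dq_def by (rule DERIV_shift[THEN iffD1, OF phi_deriv2])
  have S: "ode_sol f 0 l q dq" for l unfolding ode_sol_def
    using has_field_derivative_at_within[OF qd] has_field_derivative_at_within[OF dqd] by blast
  have q0: "q x > 0" for x by (simp add: q_def phi_pos)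
  have dqle: "\<bar>dq x\<bar> \<le> q x" for x
    using mult_left_mono[OF tanh_abs_le_1, of "phi (x + a)" "th * (x + a)"] phi_pos[of "x + a"]
    by (simp add: dq_def q_def abs_mult)
  define K where "K = mst * 2 powr (1 / th)"
  have qexp: "q x \<le> K * exp (- x)" if "x \<ge> 0" for x
  proof -
    have "q x \<le> K * exp (- (x + a))" unfolding q_def K_def using that a by (intro phi_exp_bound) auto
    also have "\<dots> \<le> K * exp (- x)" using a mst_gt_1 by (intro mult_left_mono) (auto simp: K_def)
    finally show ?thesis .
  qed
  have cq: "continuous_on {0..} q" "continuous_on {0..} dq"
    using qd dqd by (meson DERIV_isCont continuous_at_imp_continuous_on)+
  have Lq: "L2_on {0..} q" by (rule L2_on_halfline_exp[OF cq(1), of K]) (use qexp q0 in \<open>simp add: less_imp_le\<close>)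
  have Ldq: "L2_on {0..} dq" by (rule L2_on_halfline_exp[OF cq(2), of K]) (use qexp dqle order_trans in blast)
  have ac: "ac_on 0 l q dq" for l by (rule ode_sol_ac_on(1)[OF S])
  have "set_integrable lborel {0..x} dq \<and> q x = q 0 + (LINT t:{0..x}|lborel. dq t)" if x: "x \<in> {0..}" for x
  proof -
    have i: "set_integrable lborel {0..x} dq" using ac[of x] by (simp add: ac_on_def)
    have "q x - q 0 = integral {0..x} dq" by (rule ac_on_diff[OF ac[of x]]) (use x in auto)
    then show ?thesis using i set_borel_integral_eq_integral(2)[OF i] by simp
  qed
  then show H: "H1_on {0..} q dq" unfolding H1_on_def using Lq Ldq by blast
  have ql: "(q \<longlongrightarrow> 0) at_top" by (rule H1_on_halfline_tendsto_0[OF H])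
  have dql: "(dq \<longlongrightarrow> 0) at_top"
    by (rule Lim_null_comparison[OF _ ql]) (use dqle in simp)
  have dq0: "dq 0 = - R (phi a)"
  proof -
    have F0: "F (phi a) \<ge> 0" by (simp add: F_phi)
    have "R (phi a) = phi a * tanh (th * a)" unfolding R_def max_absorb2[OF F0] unfolding F_phi
      using phi_pos[of a] a th_pos by simp
    then show ?thesis by (simp add: dq_def)
  qed
  show "weak {0..} q dq \<eta> d\<eta> = R (phi a) * \<eta> 0"
    if E: "H1_on {0..} \<eta> d\<eta>" for \<eta> d\<eta>
  proof -
    have LE: "L2_on {0..} \<eta>" "L2_on {0..} d\<eta>" using E unfolding H1_on_def by blast+
    have Lf: "L2_on {0..} (\<lambda>x. \<bar>q x\<bar> powr (p - 2) * q x)"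
      by (rule L2_on_powr[OF Lq, of mst]) (use phi_le q0 in \<open>simp add: q_def abs_of_pos phi_pos\<close>)
    have i: "set_integrable lborel {0..} (\<lambda>x. dq x * d\<eta> x + q x * \<eta> x - \<bar>q x\<bar> powr (p - 2) * q x * \<eta> x)"
      by (intro set_integral_add set_integral_diff L2_on_mult LE Lq Ldq Lf)
    have "integral {0..x} (\<lambda>x. dq x * d\<eta> x + q x * \<eta> x - \<bar>q x\<bar> powr (p - 2) * q x * \<eta> x) = dq x * \<eta> x - dq 0 * \<eta> 0"
      if x: "x \<ge> 0" for x
      unfolding weak_integrand
      by (rule ac_on_integral_mult[OF x ode_sol_ac_on(2)[OF S] H1_on_ac_on[OF E]]) auto
    then have ev: "\<forall>\<^sub>F x in at_top. dq x * \<eta> x - dq 0 * \<eta> 0 = integral {0..x} (\<lambda>x. dq x * d\<eta> x + q x * \<eta> x - \<bar>q x\<bar> powr (p - 2) * q x * \<eta> x)"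
      by (intro eventually_at_top_linorderI[of 0]) simp
    have "((\<lambda>x. dq x * \<eta> x - dq 0 * \<eta> 0) \<longlongrightarrow> 0 * 0 - dq 0 * \<eta> 0) at_top"
      by (intro tendsto_intros dql H1_on_halfline_tendsto_0[OF E])
    then have "((\<lambda>x. integral {0..x} (\<lambda>x. dq x * d\<eta> x + q x * \<eta> x - \<bar>q x\<bar> powr (p - 2) * q x * \<eta> x)) \<longlongrightarrow> 0 * 0 - dq 0 * \<eta> 0) at_top"
      by (rule Lim_transform_eventually[OF _ ev])
    from tendsto_unique[OF _ set_integral_halfline_limit[OF i] this] show ?thesis by (simp add: dq0)
  qed
  note D = action_density_integral[OF H disjI1[OF refl]]
  note Di = D(1)
  have "(LINT x:{0..}|lborel. ((dq x)\<^sup>2 + F (q x)) / 2) \<le> (phi a)\<^sup>2 / 2"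
  proof (rule tendsto_upperbound[OF set_integral_halfline_limit[OF Di]])
    have "integral {0..x} (\<lambda>x. ((dq x)\<^sup>2 + F (q x)) / 2) \<le> (phi a)\<^sup>2 / 2" if x: "x \<ge> 0" for x
    proof -
      have i1: "set_integrable lborel {0..x} (\<lambda>x. ((dq x)\<^sup>2 + F (q x)) / 2)" by (rule set_integrable_subset[OF Di]) auto
      have i2: "set_integrable lborel {0..x} (\<lambda>t. (- 1 / 2) * (q t * dq t + q t * dq t))"
        by (intro set_integrable_mult_right set_integral_add L2_on_mult L2_on_continuous ode_sol_continuous[OF S] impI)
      note hk = set_borel_integral_eq_integral(1)
      have "integral {0..x} (\<lambda>x. ((dq x)\<^sup>2 + F (q x)) / 2) \<le> integral {0..x} (\<lambda>t. (- 1 / 2) * (q t * dq t + q t * dq t))"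
      proof (rule integral_le[OF hk[OF i1] hk[OF i2]])
        fix t assume t: "t \<in> {0..x}"
        have "F (q t) = (dq t)\<^sup>2" by (simp add: q_def dq_def F_phi)
        moreover have neg: "dq t \<le> 0" using phi_pos[of "t + a"] t a th_pos by (simp add: dq_def)
        moreover have "- dq t * - dq t \<le> q t * - dq t" using dqle[of t] neg by (intro mult_right_mono) auto
        ultimately show "((dq t)\<^sup>2 + F (q t)) / 2 \<le> (- 1 / 2) * (q t * dq t + q t * dq t)"
          by (simp add: power2_eq_square mult.commute[of "q t"])
      qed
      also have "\<dots> = (- 1 / 2) * (q x * q x - q 0 * q 0)"
        unfolding integral_mult_right ac_on_integral_mult[OF x ac ac] ..
      also have "\<dots> \<le> q 0 * q 0 / 2"
      proof -
        have "(- 1 / 2) * (X - Y) \<le> Y / 2" if "X \<ge> 0" for X Y :: real using that by (simp add: field_simps)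
        from this[OF zero_le_square] show ?thesis .
      qed
      also have "\<dots> = (phi a)\<^sup>2 / 2" by (simp add: q_def power2_eq_square)
      finally show ?thesis .
    qed
    then show "\<forall>\<^sub>F x in at_top. integral {0..x} (\<lambda>x. ((dq x)\<^sup>2 + F (q x)) / 2) \<le> (phi a)\<^sup>2 / 2"
      unfolding eventually_at_top_linorder by blast
  qed simp
  then show "E1 {0..} q dq / 2 - Ep {0..} q / p \<le> (phi a)\<^sup>2 / 2" using D(2) by simp
qed

lemma sum_if_less:
  fixes x y :: real
  assumes "m \<le> (N::nat)"
  shows "(\<Sum>j<N. if j < m then x else y) = m * x + (real N - m) * y"
proof -
  have 1: "{..<N} \<inter> {j. j < m} = {..<m}" and 2: "{..<N} \<inter> - {j. j < m} = {m..<N}" using assms by auto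
  have "(\<Sum>j<N. if j < m then x else y) = (\<Sum>j\<in>{..<m}. x) + (\<Sum>j\<in>{m..<N}. y)"
    by (subst sum.If_cases) (simp_all only: finite_lessThan 1 2)
  then show ?thesis using assms by simp
qed

lemma phi_surj: assumes "0 < v" "v \<le> mst" obtains a where "a \<ge> 0" "phi a = v"
proof -
  obtain x where x: "\<And>y. y \<ge> x \<Longrightarrow> phi y < v"
    using order_tendstoD(2)[OF phi_tendsto_0 assms(1)] unfolding eventually_at_top_linorder by blast
  have c: "continuous_on {0..max 0 x} phi" by (rule ode_sol_continuous(1)[OF phi_ode_sol])
  have "\<exists>a\<ge>0. a \<le> max 0 x \<and> phi a = v"
    by (rule IVT2'[OF _ _ _ c]) (use assms x[of "max 0 x"] in \<open>auto simp: less_imp_le\<close>)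
  then show ?thesis using that by blast
qed

text \<open>The edges \<open>j < m\<close> carry the bump: for \<open>P \<ge> 1\<close> this is one
  pendant, for \<open>P = 0\<close> the two halves of the first loop. The error
  \<open>\<epsilon>\<close> is split equally between the excess of the bumps, controlled by their
  height, and everything else, controlled by the vertex value.\<close>

lemma competitor:
  fixes H P L m :: nat
  assumes m: "m \<ge> 1" "m \<le> H" "m < P + 2 * L" and glue: "P = 0 \<Longrightarrow> m = 2" "P \<ge> 1 \<Longrightarrow> m = 1" and e: "\<epsilon> > 0"
  obtains l0 where "\<And>l. l \<ge> l0 \<Longrightarrow> \<exists>u. bound_state H P L l p u \<and> action H P L l p u \<le> m * G mst + \<epsilon>"
proof -
  define N where "N = P + 2 * L"
  define n where "n = real N - m"
  have n: "n > 0" using m by (simp add: n_def N_def)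
  have mN: "m \<le> N" using m by (simp add: N_def)
  \<comment> \<open>The coefficient of \<open>v^2\<close> in the action outside the bumps:
    \<open>1 / (2 * kap)\<close> for each of the \<open>n\<close> small edges and
    \<open>1 / 2\<close> for each half-line.\<close>
  define q where "q = n / (2 * kap) + real H / 2"
  have q: "q > 0" using n kap_pos by (auto simp: q_def intro!: add_pos_nonneg)
  have "continuous_on UNIV (\<lambda>b. sqrt (- F b) * b)" by (intro continuous_intros F_continuous)
  then have "((\<lambda>b. sqrt (- F b) * b) \<longlongrightarrow> sqrt (- F mst) * mst) (at mst)"
    unfolding continuous_on_def by blast
  then have "((\<lambda>b. sqrt (- F b) * b) \<longlongrightarrow> 0) (at mst)" by simp
  then have "\<forall>\<^sub>F b in at mst. sqrt (- F b) * b < \<epsilon> / (2 * m)" using e m by (intro order_tendstoD(2)) auto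
  then obtain d where d: "d > 0" "\<And>b. b \<noteq> mst \<Longrightarrow> dist b mst < d \<Longrightarrow> sqrt (- F b) * b < \<epsilon> / (2 * m)"
    unfolding eventually_at by blast
  define \<delta> where "\<delta> = min (1/2) (d / 2)"
  have \<delta>: "\<delta> > 0" "\<delta> < 1" "\<delta> < d" using d by (auto simp: \<delta>_def)
  have bs: "sqrt (- F b) * b \<le> \<epsilon> / (2 * m)" if "mst \<le> b" "b \<le> mst + \<delta>" for b
  proof (cases "b = mst")
    case True then show ?thesis using e by simp
  next
    case False then show ?thesis using d(2)[of b] that \<delta> by (auto simp: dist_real_def)
  qed
  \<comment> \<open>With \<open>v \<le> v1 \<le> 1\<close> one has
    \<open>v^2 * q \<le> v * q \<le> \<epsilon> / 2\<close>.\<close>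
  define v1 where "v1 = min 1 (\<epsilon> / (2 * q))"
  have v1: "v1 > 0" "v1 \<le> 1" "v1 \<le> \<epsilon> / (2 * q)" using e q by (auto simp: v1_def)
  have mr: "real m > 0" "real m \<le> real H" using m by auto
  obtain l0 where l0: "l0 > 0" "\<And>l. l \<ge> l0 \<Longrightarrow> \<exists>v b U V A C. v \<le> v1 \<and> b \<le> mst + \<delta> \<and> profile m n H l v b U V A C"
    by (rule shooting[OF mr(1) n mr(2) v1(1) \<delta>(1,2)]) (rule that)
  show ?thesis
  proof (rule that[of l0])
    fix l assume l: "l \<ge> l0"
    have lp: "l > 0" using l l0 by simp
    obtain v b U V A C where v: "0 < v" "v \<le> v1" "v \<le> eta" and b: "mst \<le> b" "b \<le> mst + \<delta>"
      and SU: "ode_sol f 0 l U V" and U: "U l = v" "V 0 = 0"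
      and Ur: "\<And>t. t \<in> {0..l} \<Longrightarrow> 0 < U t \<and> U t \<le> b \<and> V t \<le> 0 \<and> (V t)\<^sup>2 = F (U t) - F b"
      and SA: "ode_sol f 0 l A C" and A: "C 0 = 0" "A l = v" and Ar: "\<And>t. t \<in> {0..l} \<Longrightarrow> 0 \<le> A t \<and> A t \<le> eta"
      and C: "0 \<le> C l" "C l \<le> v" and kirchhoff: "real m * V l + n * C l + real H * R v = 0"
      using l0(2)[OF l] unfolding profile_def by blast
    obtain a where a: "a \<ge> 0" "phi a = v" using phi_surj[OF v(1)] v eta_lt_1 mst_gt_1 by auto
    define w where "w j x = (if j < m then U (l - x) else A (l - x))" for j x
    define dw where "dw j x = (if j < m then - V (l - x) else - C (l - x))" for j x
    define u where "u = \<lparr>hl = (\<lambda>i x. phi (x + a)), dhl = (\<lambda>i x. - (phi (x + a) * tanh (th * (x + a)))), ce = w, dce = dw\<rparr>"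
    have Sw: "ode_sol f 0 l (w j) (dw j)" for j
      using ode_sol_reflect[OF SU] ode_sol_reflect[OF SA] unfolding w_def dw_def by (cases "j < m") simp_all
    have w0: "w j 0 = v" for j using U A by (simp add: w_def)
    \<comment> \<open>Zero slope at \<open>x = l\<close> is the natural condition at the tip of a
      pendant and removes the contribution of the dummy vertex from each half of a loop.\<close>
    have dwl: "dw j l = 0" for j using U A by (simp add: dw_def)
    have dw0: "dw j 0 = (if j < m then - V l else - C l)" for j by (simp add: dw_def)
    have lx: "l - x \<in> {0..l}" if "x \<in> {0..l}" for x using that by auto
    \<comment> \<open>The cut at \<open>m\<close> never separates two halves of a loop: for
      \<open>P = 0\<close> it falls after the first pair, otherwise after the first pendant.\<close>
    have loop: "w (P + 2 * k) l = w (P + 2 * k + 1) l" for k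
      using glue by (cases "P = 0") (auto simp: w_def)
    have inH: "in_H1 H P L l u"
      unfolding in_H1_def u_def using soliton_tail(1)[OF a(1)] ode_sol_H1_on[OF Sw] w0 a(2) loop by simp
    have nt: "nontrivial H P L l u"
      unfolding nontrivial_def using v a m by (intro disjI1 exI[of _ 0] conjI) (auto simp: u_def)
    have weak: "(\<Sum>i<H. weak {0..} (hl u i) (dhl u i) (hl \<eta> i) (dhl \<eta> i)) +
       (\<Sum>j<P + 2*L. weak {0..l} (ce u j) (dce u j) (ce \<eta> j) (dce \<eta> j)) = 0"
      if eta: "in_H1 H P L l \<eta>" for \<eta>
    proof -
      define y where "y = hl \<eta> 0 0"
      have h1: "weak {0..} (hl u i) (dhl u i) (hl \<eta> i) (dhl \<eta> i) = R v * y"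
        if i: "i < H" for i
        using soliton_tail(2)[OF a(1) in_H1_halfline(1)[OF eta i]] in_H1_halfline(2)[OF eta i] a(2) by (simp add: u_def y_def)
      have h2: "weak {0..l} (ce u j) (dce u j) (ce \<eta> j) (dce \<eta> j)
          = (if j < m then V l * y else C l * y)" if j: "j < P + 2 * L" for j
        using edge_weak_form[OF Sw[of j] in_H1_edge(1)[OF eta j] less_imp_le[OF lp]] in_H1_edge(2)[OF eta j] dwl[of j] dw0[of j]
        by (simp add: u_def y_def)
      have "(\<Sum>j<P + 2 * L. if j < m then V l * y else C l * y) = m * (V l * y) + n * (C l * y)"
        using sum_if_less[OF mN] by (simp add: n_def N_def)
      then have "(\<Sum>i<H. weak {0..} (hl u i) (dhl u i) (hl \<eta> i) (dhl \<eta> i)) +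
          (\<Sum>j<P + 2*L. weak {0..l} (ce u j) (dce u j) (ce \<eta> j) (dce \<eta> j))
         = H * (R v * y) + (m * (V l * y) + n * (C l * y))"
        using h1 h2 by simp
      also have "\<dots> = (real m * V l + n * C l + real H * R v) * y" by (simp add: algebra_simps)
      finally show ?thesis using kirchhoff by simp
    qed
    have bound: "bound_state H P L l p u" unfolding bound_state_iff using inH nt weak by blast
    have v2: "v\<^sup>2 * q \<le> \<epsilon> / 2"
    proof -
      have "v\<^sup>2 \<le> 1 * v" unfolding power2_eq_square using v v1 by (intro mult_right_mono) auto
      then have "v\<^sup>2 * q \<le> v1 * q" using v q by (intro mult_right_mono) auto
      also have "\<dots> \<le> \<epsilon> / (2 * q) * q" using v1 q by (intro mult_right_mono) auto
      finally show ?thesis using q by simp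
    qed
    define s where "s = \<epsilon> / (2 * m)"
    have ah: "E1 {0..} (hl u i) (dhl u i) / 2 - Ep {0..} (hl u i) / p \<le> v\<^sup>2 / 2" for i
      using soliton_tail(3)[OF a(1)] a(2) by (simp add: u_def)
    have ae: "E1 {0..l} (ce u j) (dce u j) / 2 - Ep {0..l} (ce u j) / p \<le> (if j < m then G mst + s else v\<^sup>2 / (2 * kap))" for j
    proof (cases "j < m")
      case True
      have "E1 {0..l} (w j) (dw j) / 2 - Ep {0..l} (w j) / p \<le> G mst + sqrt (- F b) * b"
        by (rule bump_edge_action[OF Sw less_imp_le[OF lp] b(1)]) (use True Ur[OF lx] in \<open>simp add: w_def dw_def\<close>)
      also have "\<dots> \<le> G mst + s" using bs[OF b] by (simp add: s_def)
      finally show ?thesis using True by (simp add: u_def)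
    next
      case False
      have "E1 {0..l} (w j) (dw j) / 2 - Ep {0..l} (w j) / p \<le> - (dw j 0 * w j 0) / (2 * kap)"
        by (rule small_edge_action[OF Sw less_imp_le[OF lp] _ dwl]) (use False Ar[OF lx] in \<open>simp add: w_def\<close>)
      also have "- (dw j 0 * w j 0) = C l * v" using False by (simp add: dw0 w0)
      also have "C l * v / (2 * kap) \<le> v * v / (2 * kap)" using C v kap_pos by (intro divide_right_mono mult_right_mono) auto
      finally show ?thesis using False by (simp add: u_def power2_eq_square)
    qed
    have "action H P L l p u \<le> (\<Sum>i<H. v\<^sup>2 / 2) + (\<Sum>j<N. if j < m then G mst + s else v\<^sup>2 / (2 * kap))"
      unfolding action_sum N_def by (intro add_mono sum_mono ah ae)
    also have "\<dots> = m * G mst + m * s + v\<^sup>2 * q"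
      using sum_if_less[OF mN] by (simp add: q_def n_def[symmetric] algebra_simps)
    also have "m * s = \<epsilon> / 2" using m by (simp add: s_def)
    finally have "action H P L l p u \<le> m * G mst + \<epsilon>" using v2 by simp
    then show "\<exists>u. bound_state H P L l p u \<and> action H P L l p u \<le> m * G mst + \<epsilon>" using bound by blast
  qed
qed

text \<open>The competitor is taken with half the gap, so it lies strictly below every
  core-symmetric bound state. From \<open>P + L > 1\<close> come both
  \<open>2 * m \<le> P + 2 * L\<close>, which doubles the number of passages of a core-symmetric
  function, and \<open>m < P + 2 * L\<close>, which leaves a small edge for the competitor.\<close>

lemma no_core_symmetric_ground_state:
  fixes H P L :: nat
  assumes "H \<ge> 1" "P + L > 1" "P = 0 \<longrightarrow> H \<ge> 2"
  shows "\<exists>l0>0. \<forall>l\<ge>l0. \<forall>u. action_ground_state H P L l p u \<longrightarrow> \<not> core_symmetric P L l u"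
proof -
  define m :: nat where "m = (if P = 0 then 2 else 1)"
  have m: "m = 1 \<or> m = 2" "m \<le> H" "m \<ge> 1" "2 * m \<le> P + 2 * L" "m < P + 2 * L"
    using assms by (auto simp: m_def)
  obtain \<epsilon> l1 where e: "\<epsilon> > 0" and l1: "l1 \<ge> 1" and gap: "\<And>l u. l \<ge> l1 \<Longrightarrow> bound_state H P L l p u \<Longrightarrow>
      core_symmetric P L l u \<Longrightarrow> m * G mst + \<epsilon> \<le> action H P L l p u"
    using core_symmetric_gap[OF m(4,2,1)] by blast
  have e2: "\<epsilon> / 2 > 0" using e by simp
  obtain l2 where l2: "\<And>l. l \<ge> l2 \<Longrightarrow> \<exists>u. bound_state H P L l p u \<and> action H P L l p u \<le> m * G mst + \<epsilon> / 2"
    by (rule competitor[OF m(3,2,5) _ _ e2]) (auto simp: m_def)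
  show ?thesis
  proof (intro exI[of _ "max l1 l2"] conjI allI impI notI)
    show "max l1 l2 > 0" using l1 by simp
    fix l u assume l: "max l1 l2 \<le> l" and g: "action_ground_state H P L l p u" and c: "core_symmetric P L l u"
    obtain v where v: "bound_state H P L l p v" "action H P L l p v \<le> m * G mst + \<epsilon> / 2" using l2[of l] l by auto
    have "action H P L l p u \<le> action H P L l p v" "bound_state H P L l p u"
      using g v(1) by (auto simp: action_ground_state_def)
    then show False using gap[of l u] l c v(2) e by simp
  qed
qed

end

theorem theorem1p15:
  fixes p :: real and H P L :: nat
  assumes "p > 2" and "H \<ge> 1" and "P + L > 1" and "P = 0 \<longrightarrow> H \<ge> 2"
  shows "\<exists>l0>0. \<forall>l\<ge>l0. \<forall>u. action_ground_state H P L l p u \<longrightarrow> \<not> core_symmetric P L l u"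
proof -
  interpret nls p by unfold_locales (rule assms(1))
  show ?thesis by (rule no_core_symmetric_ground_state[OF assms(2-4)])
qed

end
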